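(* Let $\tau>0$ and $t\in\mathbb{R}$. For each integer $n\ge1$ let $(p_{k,n})_{k=0}^\infty$ and $(q_{k,n})_{k=0}^\infty$ be the sequences of monic polynomials, $\deg p_{k,n}=\deg q_{k,n}=k$, defined by $$\int_{-\infty}^{\infty}\int_{-\infty}^{\infty} p_{k,n}(x)q_{j,n}(y)e^{-n(x^2/2+y^4/4+ty^2/2-\tau xy)}\,dx\,dy=0,\qquad k\neq j.$$ Then there exists a Borel probability measure $\nu_1$ with $\operatorname{supp}(\nu_1)\subset\mathbb{R}$ such that $\nu_1$ is the limiting zero distribution of the diagonal polynomials $p_{n,n}$, i.e. $$\lim_{n\to\infty}\nu(p_{n,n})=\nu_1$$ in the sense of weak convergence of measures.
   Context: The biorthogonal polynomials $p_{k,n},q_{k,n}$ exist and are unique (known result). For a polynomial $P$ of degree $n$, $\nu(P)=\frac1n\sum_{P(x)=0}\delta_x$ is its normalized zero counting measure, the sum being over all zeros of $P$ counted with multiplicity. A sequence of measures $\nu_n$ converges weakly to $\nu$ if $\int f\,d\nu_n\to\int f\,d\nu$ for every bounded continuous function $f$. *)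

theory Defs
  imports "HOL-Probability.Probability" "HOL-Computational_Algebra.Computational_Algebra"
begin

definition biorth_weight :: "real \<Rightarrow> real \<Rightarrow> nat \<Rightarrow> real \<Rightarrow> real \<Rightarrow> real" where
  "biorth_weight \<tau> t n x y =
     exp (- (real n * (x ^ 2 / 2 + y ^ 4 / 4 + t * y ^ 2 / 2 - \<tau> * x * y)))"

text \<open>
  The pairing is bilinear (no complex conjugation).  The weight decays fast enough that
  polynomials times the weight are absolutely integrable over the plane when \<open>n \<ge> 1\<close>, so the
  convention that a non-integrable function has integral 0 plays no role.
\<close>
definition biorthogonal ::
  "real \<Rightarrow> real \<Rightarrow> nat \<Rightarrow> (nat \<Rightarrow> complex poly) \<Rightarrow> (nat \<Rightarrow> complex poly) \<Rightarrow> bool" where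
  "biorthogonal \<tau> t n P Q \<longleftrightarrow>
     (\<forall>k. degree (P k) = k \<and> lead_coeff (P k) = 1) \<and>
     (\<forall>k. degree (Q k) = k \<and> lead_coeff (Q k) = 1) \<and>
     (\<forall>k j. k \<noteq> j \<longrightarrow>
        (LINT y|lborel. LINT x|lborel.
           poly (P k) (complex_of_real x) * poly (Q j) (complex_of_real y) *
           complex_of_real (biorth_weight \<tau> t n x y)) = 0)"

definition zero_counting_measure :: "complex poly \<Rightarrow> complex measure" where
  "zero_counting_measure P =
     measure_of UNIV (sets borel)
       (\<lambda>A. (\<Sum>x | poly P x = 0. of_nat (order x P) * indicator A x) / of_nat (degree P))"

text \<open>
  \<^const>\<open>measure_of\<close> is the null measure unless the given set function is a measure; the next
  lemma shows that it is one here.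
\<close>
lemma emeasure_zero_counting_measure:
  assumes "A \<in> sets borel"
  shows "emeasure (zero_counting_measure P) A =
    (\<Sum>x | poly P x = 0. of_nat (order x P) * indicator A x) / of_nat (degree P)"
proof -
  let ?m = "\<lambda>A. (\<Sum>x | poly P x = 0. of_nat (order x P) * indicator A x) / of_nat (degree P) :: ennreal"
  have "countably_additive (sets borel) ?m"
  proof (rule countably_additiveI)
    fix F :: "nat \<Rightarrow> complex set" assume "disjoint_family F"
    then show "(\<Sum>i. ?m (F i)) = ?m (\<Union>i. F i)"
      by (simp add: divide_ennreal_def suminf_sum suminf_indicator)
  qed
  moreover have "positive (sets borel) ?m" by (simp add: positive_def)
  ultimately show ?thesis
    using sets.sigma_algebra_axioms[of "borel :: complex measure"] assms
    unfolding zero_counting_measure_def by (intro emeasure_measure_of_sigma) auto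
qed

definition measure_support :: "'a::topological_space measure \<Rightarrow> 'a set" where
  "measure_support M = {x. \<forall>U. open U \<longrightarrow> x \<in> U \<longrightarrow> emeasure M U > 0}"

definition converges_weakly ::
  "(nat \<Rightarrow> 'a::topological_space measure) \<Rightarrow> 'a measure \<Rightarrow> bool" where
  "converges_weakly M N \<longleftrightarrow>
     (\<forall>f :: 'a \<Rightarrow> real. continuous_on UNIV f \<longrightarrow> bounded (range f) \<longrightarrow>
        (\<lambda>n. LINT x|M n. f x) \<longlonglongrightarrow> (LINT x|N. f x))"

end

theory Submission
  imports Defs
begin

text \<open>
  Integrating out \<open>x\<close> shows that the heat flow \<open>K\<^sub>k = exp (D\<^sup>2 / (2 n)) p\<^sub>k\<^sub>,\<^sub>n\<close> turns the biorthogonal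
  polynomials into orthogonal polynomials \<open>K\<^sub>k\<close> for an even quartic weight. Their recurrence
  coefficients satisfy Freud's equation, which makes the logarithmic derivative of \<open>K\<^sub>n\<close> a solution of
  \<open>G\<^sup>2 - V' G + P = 0\<close> up to an error \<open>O(1 / n)\<close>, where \<open>P\<close> contains one unknown number \<open>e\<^sub>n\<close>. On the
  imaginary axis the discriminant of this quadratic is nonnegative for every \<open>n\<close>, and if two values
  of \<open>e\<^sub>n\<close> differed by a fixed amount, the discriminant for the larger one would stay positive; but
  positivity of the zero measure forces the branch of the square root to change between \<open>0\<close> and
  \<open>\<infinity>\<close>. So \<open>e\<^sub>n\<close> converges, with no case distinction between the one-cut and the two-cut regime, and
  with it all moments of the zeros of \<open>K\<^sub>n\<close>. The backward heat flow acts on normalized power sums by a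
  triangular system of differential equations, so the moments of the zeros of \<open>p\<^sub>n\<^sub>,\<^sub>n\<close> converge as well.
  It also preserves real zeros, and the banded recurrence of the \<open>p\<^sub>k\<^sub>,\<^sub>n\<close> bounds them uniformly; hence
  moment convergence is weak convergence.
\<close>

section \<open>The heat operator on polynomials\<close>

text \<open>The heat flow appears because, for fixed \<open>y\<close>, the weight is a Gaussian in
  \<open>x\<close> with mean \<open>\<tau> * y\<close> and variance \<open>1 / n\<close>, and
  averaging a polynomial over a Gaussian of variance v is the operator exp (v D^2 / 2). What is left
  in \<open>y\<close> is an even quartic weight with \<open>t - \<tau>^2\<close> in place of
  \<open>t\<close>. The obstacle is that the recurrence coefficients themselves need not converge:
  for a double well, even and odd indices may have different limits. Only one combination of three
  neighbouring coefficients, the number e_n, enters the loop equation, and only its convergence is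
  proved. The imaginary axis is chosen because all terms of the recurrence are positive there: the
  logarithmic derivative has no poles and a definite sign, and the error is a Wronskian of
  consecutive polynomials, which a positivity induction controls. Along the heat flow the power sums
  are followed instead of the individual zeros, so collisions of zeros cause no trouble.\<close>

definition heat :: "'a::field_char_0 \<Rightarrow> 'a poly \<Rightarrow> 'a poly" where
  "heat a P = (\<Sum>k\<le>degree P. smult (a ^ k / fact k) ((pderiv ^^ (2 * k)) P))"

lemma higher_pderiv_eq_0:
  fixes P :: "'a::field_char_0 poly"
  assumes "degree P < m"
  shows "(pderiv ^^ m) P = 0"
  by (rule poly_eqI) (use assms in \<open>simp add: coeff_higher_pderiv coeff_eq_0\<close>)

lemma smult_sum_right: "smult c (sum f A) = (\<Sum>i\<in>A. smult c (f i))"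
  by (induction A rule: infinite_finite_induct) (simp_all add: smult_add_right)

text \<open>Derivatives of order above the degree vanish, so any larger bound gives the same sum;
  polynomials of different degrees can then share one range.\<close>

lemma heat_eq_sum:
  assumes "degree P \<le> m"
  shows "heat a P = (\<Sum>k\<le>m. smult (a ^ k / fact k) ((pderiv ^^ (2 * k)) P))"
  unfolding heat_def
proof (rule sum.mono_neutral_left)
  show "\<forall>i\<in>{..m} - {..degree P}. smult (a ^ i / fact i) ((pderiv ^^ (2 * i)) P) = 0"
    by (auto simp: higher_pderiv_eq_0)
qed (use assms in auto)

lemma heat_0 [simp]: "heat a 0 = 0"
  by (simp add: heat_def)

lemma heat_1 [simp]: "heat a 1 = 1"
  by (simp add: heat_def)

lemma heat_add: "heat a (P + Q) = heat a P + heat a Q"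
proof -
  define m where "m = max (degree P) (degree Q)"
  have "degree (P + Q) \<le> m" "degree P \<le> m" "degree Q \<le> m"
    by (auto simp: m_def degree_add_le_max)
  then show ?thesis
    by (simp add: heat_eq_sum higher_pderiv_add smult_add_right sum.distrib)
qed

lemma heat_smult: "heat a (smult c P) = smult c (heat a P)"
proof -
  have "degree (smult c P) \<le> degree P" by (rule degree_smult_le)
  then show ?thesis
    by (simp add: heat_eq_sum[of _ "degree P"] higher_pderiv_smult smult_sum_right mult.commute)
qed

lemma pderiv_heat: "pderiv (heat a P) = heat a (pderiv P)"
proof -
  have "degree (pderiv P) \<le> degree P" by (simp add: degree_pderiv)
  then show ?thesis
    by (simp add: heat_eq_sum[of _ "degree P"] higher_pderiv_sum[of 1, simplified] pderiv_smult funpow_swap1)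
qed

lemma higher_pderiv_pCons:
  fixes P :: "'a::field_char_0 poly"
  shows "(pderiv ^^ Suc m) (pCons 0 P) =
    pCons 0 ((pderiv ^^ Suc m) P) + smult (of_nat (Suc m)) ((pderiv ^^ m) P)"
proof (induction m)
  case 0
  show ?case by (simp add: pderiv_pCons add.commute)
next
  case (Suc m)
  have "(pderiv ^^ Suc (Suc m)) (pCons 0 P) = pderiv ((pderiv ^^ Suc m) (pCons 0 P))"
    by simp
  also have "\<dots> = pCons 0 ((pderiv ^^ Suc (Suc m)) P) + smult (of_nat (Suc (Suc m))) ((pderiv ^^ Suc m) P)"
    unfolding Suc.IH
    by (rule poly_eqI) (simp add: pderiv_add pderiv_pCons pderiv_smult algebra_simps)
  finally show ?case .
qed

text \<open>The commutation rule exp (a D^2) x = (x + 2 a D) exp (a D^2), from Leibniz' rule D^(2k)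
  x = x D^(2k) + 2k D^(2k-1). It yields the inverse of the flow and, in
  \<open>heat_recurrence\<close>, the recurrence after the flow.\<close>

lemma heat_pCons:
  "heat a (pCons 0 P) = pCons 0 (heat a P) + smult (2 * a) (heat a (pderiv P))"
proof (cases "P = 0")
  case False
  define m where "m = degree P"
  have d: "degree (pCons 0 P) \<le> Suc m" "degree P \<le> Suc m" "degree (pderiv P) \<le> m"
    by (auto simp: m_def degree_pderiv degree_pCons_le)
  have "heat a (pCons 0 P) =
      (\<Sum>k\<le>Suc m. smult (a ^ k / fact k) (pCons 0 ((pderiv ^^ (2 * k)) P))) +
      (\<Sum>k\<le>Suc m. smult (a ^ k / fact k * of_nat (2 * k)) ((pderiv ^^ (2 * k - 1)) P))"
    unfolding heat_eq_sum[OF d(1)] sum.distrib[symmetric]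
  proof (rule sum.cong)
    fix k assume "k \<in> {..Suc m}"
    show "smult (a ^ k / fact k) ((pderiv ^^ (2 * k)) (pCons 0 P)) =
      smult (a ^ k / fact k) (pCons 0 ((pderiv ^^ (2 * k)) P)) +
      smult (a ^ k / fact k * of_nat (2 * k)) ((pderiv ^^ (2 * k - 1)) P)"
    proof (cases k)
      case (Suc j)
      then show ?thesis
        using higher_pderiv_pCons[of "2 * j + 1" P] by (simp add: smult_add_right)
    qed simp
  qed simp
  also have "(\<Sum>k\<le>Suc m. smult (a ^ k / fact k) (pCons 0 ((pderiv ^^ (2 * k)) P))) = pCons 0 (heat a P)"
    unfolding heat_eq_sum[OF d(2)] by (rule poly_eqI) (simp add: coeff_sum coeff_pCons split: nat.split)
  also have "(\<Sum>k\<le>Suc m. smult (a ^ k / fact k * of_nat (2 * k)) ((pderiv ^^ (2 * k - 1)) P)) =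
      smult (2 * a) (heat a (pderiv P))"
    unfolding heat_eq_sum[OF d(3)] sum.atMost_Suc_shift smult_sum_right
  proof -
    have "smult (a ^ Suc k / fact (Suc k) * of_nat (2 * Suc k)) ((pderiv ^^ (2 * Suc k - 1)) P) =
      smult (2 * a) (smult (a ^ k / fact k) ((pderiv ^^ (2 * k)) (pderiv P)))" for k
    proof -
      have "a ^ Suc k / fact (Suc k) * of_nat (2 * Suc k) = 2 * a * (a ^ k / fact k)"
      proof -
        have "of_nat (2 * Suc k) = 2 * (of_nat (Suc k) :: 'a)" by simp
        moreover have "of_nat (Suc k) \<noteq> (0 :: 'a)" by (rule of_nat_neq_0)
        ultimately show ?thesis by (simp add: field_simps del: of_nat_Suc)
      qed
      moreover have "(pderiv ^^ (2 * Suc k - 1)) P = (pderiv ^^ (2 * k)) (pderiv P)"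
        by (simp add: funpow_swap1)
      ultimately show ?thesis by simp
    qed
    then show "smult (a ^ 0 / fact 0 * of_nat (2 * 0)) ((pderiv ^^ (2 * 0 - 1)) P) +
      (\<Sum>i\<le>m. smult (a ^ Suc i / fact (Suc i) * of_nat (2 * Suc i)) ((pderiv ^^ (2 * Suc i - 1)) P)) =
      (\<Sum>n\<le>m. smult (2 * a) (smult (a ^ n / fact n) ((pderiv ^^ (2 * n)) (pderiv P))))"
      by simp
  qed
  finally show ?thesis .
qed simp

text \<open>Proved from the commutation rule rather than by multiplying series: the commutators of
  the two flows with \<open>x\<close> have opposite signs and cancel.\<close>

lemma heat_uminus_heat: "heat (- a) (heat a P) = P"
proof (induction P)
  case (pCons c P)
  have c: "pCons c P = [:c:] + pCons 0 P" by simp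
  have "heat b [:c:] = [:c:]" for b :: 'a by (simp add: heat_def)
  then show ?case
    unfolding c heat_add heat_pCons heat_smult pderiv_heat[symmetric] using pCons.IH
    by (simp add: heat_add heat_pCons heat_smult pderiv_heat)
qed simp

lemma coeff_heat:
  assumes "degree P \<le> m"
  shows "coeff (heat a P) j = (\<Sum>k\<le>m. a ^ k / fact k * coeff ((pderiv ^^ (2 * k)) P) j)"
  by (simp add: heat_eq_sum[OF assms] coeff_sum)

lemma degree_heat [simp]: "degree (heat a P) = degree P"
  and lead_coeff_heat [simp]: "coeff (heat a P) (degree P) = lead_coeff P"
proof -
  have c: "coeff (heat a P) j = coeff P j" if "j \<ge> degree P" for j
  proof -
    have "coeff ((pderiv ^^ (2 * k)) P) j = (if k = 0 then coeff P j else 0)" for k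
      using that by (auto simp: coeff_higher_pderiv intro!: coeff_eq_0)
    then have "coeff (heat a P) j = (\<Sum>k\<le>degree P. if k = 0 then coeff P j else 0)"
      unfolding coeff_heat[OF order_refl] by (intro sum.cong) auto
    then show ?thesis by simp
  qed
  show d: "degree (heat a P) = degree P"
  proof (cases "P = 0")
    case False
    show ?thesis
    proof (rule antisym)
      show "degree (heat a P) \<le> degree P"
        by (rule degree_le) (simp add: c coeff_eq_0)
      show "degree P \<le> degree (heat a P)"
        by (rule le_degree) (simp add: c False)
    qed
  qed simp
  show "coeff (heat a P) (degree P) = lead_coeff P"
    by (simp add: c)
qed

lemma heat_parameter_0 [simp]: "heat 0 P = P"
proof -
  have "heat 0 P = (\<Sum>k\<le>degree P. if k = 0 then P else 0)"
    unfolding heat_def by (intro sum.cong) auto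
  then show ?thesis by simp
qed

text \<open>The heat equation d/ds = D^2, coefficient by coefficient.\<close>

lemma coeff_heat_has_derivative:
  fixes P :: "complex poly"
  shows "((\<lambda>s. coeff (heat s P) j) has_field_derivative coeff (pderiv (pderiv (heat s P))) j) (at s)"
proof -
  \<comment> \<open>One extra term, so that the index shift caused by differentiation leaves a sum
    up to \<open>degree P\<close>.\<close>
  define m where "m = Suc (degree P)"
  have d: "degree P \<le> m" "degree (pderiv (pderiv P)) \<le> degree P" by (auto simp: m_def degree_pderiv)
  have "((\<lambda>s. \<Sum>k\<le>m. s ^ k / fact k * coeff ((pderiv ^^ (2 * k)) P) j) has_field_derivative
     (\<Sum>k\<le>m. (of_nat k * s ^ (k - 1)) / fact k * coeff ((pderiv ^^ (2 * k)) P) j)) (at s)"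
    by (auto intro!: derivative_eq_intros sum.cong)
  also have "(\<Sum>k\<le>m. (of_nat k * s ^ (k - 1)) / fact k * coeff ((pderiv ^^ (2 * k)) P) j) =
      (\<Sum>k\<le>degree P. s ^ k / fact k * coeff ((pderiv ^^ (2 * k)) (pderiv (pderiv P))) j)"
  proof -
    have "(of_nat (Suc k) * s ^ (Suc k - 1)) / fact (Suc k) = s ^ k / fact k" for k
      by (simp add: divide_simps del: of_nat_Suc)
    then show ?thesis unfolding m_def sum.atMost_Suc_shift
      by (simp add: funpow_swap1 del: of_nat_Suc fact_Suc)
  qed
  finally show ?thesis
    unfolding pderiv_heat coeff_heat[OF d(1)] coeff_heat[OF d(2)] .
qed

section \<open>Real-rootedness under the backward heat flow\<close>

lemma monic_poly_eq_prod_proots: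
  fixes P :: "complex poly"
  assumes "lead_coeff P = 1"
  shows "P = (\<Prod>a\<in>#proots P. [:- a, 1:])"
  using complex_poly_decompose_multiset[of P] assms by simp

lemma poly_pderiv_prod_linear:
  fixes A :: "'a::field multiset"
  assumes "x \<notin># A"
  shows "poly (pderiv (\<Prod>a\<in>#A. [:- a, 1:])) x =
    poly (\<Prod>a\<in>#A. [:- a, 1:]) x * (\<Sum>a\<in>#A. 1 / (x - a))"
  using assms
proof (induction A)
  case (add b A)
  then have "x - b \<noteq> 0" by auto
  let ?p = "\<Prod>a\<in>#A. [:- a, 1:]"
  have "poly (pderiv (\<Prod>a\<in>#add_mset b A. [:- a, 1:])) x = (x - b) * poly (pderiv ?p) x + poly ?p x"
    by (simp add: pderiv_mult pderiv_pCons del: mult_pCons_left)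
  also have "\<dots> = (x - b) * poly ?p x * (1 / (x - b) + (\<Sum>a\<in>#A. 1 / (x - a)))"
    using add \<open>x - b \<noteq> 0\<close> by (simp add: field_simps)
  also have "(x - b) * poly ?p x = poly (\<Prod>a\<in>#add_mset b A. [:- a, 1:]) x"
    by (simp add: algebra_simps)
  also have "1 / (x - b) + (\<Sum>a\<in>#A. 1 / (x - a)) = (\<Sum>a\<in>#add_mset b A. 1 / (x - a))"
    by simp
  finally show ?case .
qed simp

lemma poly_pderiv_eq_sum_proots:
  fixes P :: "complex poly"
  assumes "lead_coeff P = 1" "poly P x \<noteq> 0"
  shows "poly (pderiv P) x = poly P x * (\<Sum>a\<in>#proots P. 1 / (x - a))"
proof -
  have "P \<noteq> 0" using assms by auto
  then have "x \<notin># proots P" using assms by simp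
  then show ?thesis
    using poly_pderiv_prod_linear[of x "proots P"] monic_poly_eq_prod_proots[OF assms(1)] by metis
qed

lemma Im_sum_mset: "Im (\<Sum>a\<in>#A. f a) = (\<Sum>a\<in>#A. Im (f a))"
  by (induction A) simp_all

definition real_rooted :: "complex poly \<Rightarrow> bool" where
  "real_rooted P \<longleftrightarrow> (\<forall>z. poly P z = 0 \<longrightarrow> Im z = 0)"

lemma Im_inverse_real_shift:
  assumes "Im a = 0"
  shows "Im (1 / (z - a)) = - Im z / (cmod (z - a))\<^sup>2"
  using assms by (simp add: Im_divide cmod_power2)

text \<open>At a nonreal zero \<open>z\<close> of P - b P' the sum of 1 / (z - a) over the zeros of
  P, times b, equals 1. Each term has an imaginary part of sign opposite to that of Im z, so a real
  total forces P to have no zeros at all; but then the sum is 0, not 1.\<close>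

lemma real_rooted_minus_pderiv:
  assumes P: "lead_coeff P = 1" "real_rooted P"
  shows "real_rooted (P - smult (complex_of_real b) (pderiv P))"
  unfolding real_rooted_def
proof (intro allI impI, rule ccontr)
  fix z assume z: "poly (P - smult (complex_of_real b) (pderiv P)) z = 0" "Im z \<noteq> 0"
  let ?S = "\<Sum>a\<in>#proots P. 1 / (z - a)"
  have nz: "poly P z \<noteq> 0" using P z by (auto simp: real_rooted_def)
  have "poly P z * (1 - b * ?S) = 0"
    using z poly_pderiv_eq_sum_proots[OF P(1) nz] by (simp add: algebra_simps)
  then have S: "complex_of_real b * ?S = 1" using nz by simp
  have "P \<noteq> 0" using P by auto
  have im: "Im a = 0" if "a \<in># proots P" for a
    using that P \<open>P \<noteq> 0\<close> by (auto simp: real_rooted_def)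
  have "Im ?S = (\<Sum>a\<in>#proots P. Im (1 / (z - a)))"
    by (rule Im_sum_mset)
  also have "\<dots> = (\<Sum>a\<in>#proots P. - Im z * (1 / (cmod (z - a))\<^sup>2))"
    by (intro arg_cong[of _ _ sum_mset] image_mset_cong) (simp add: Im_inverse_real_shift im)
  also have "\<dots> = - Im z * (\<Sum>a\<in>#proots P. 1 / (cmod (z - a))\<^sup>2)"
    by (simp add: sum_mset_distrib_left)
  finally have IS: "Im ?S = - Im z * (\<Sum>a\<in>#proots P. 1 / (cmod (z - a))\<^sup>2)" .
  have "b \<noteq> 0" using S by auto
  have "Im (complex_of_real b * ?S) = 0" unfolding S by simp
  then have "Im ?S = 0" using \<open>b \<noteq> 0\<close> by simp
  then have s0: "(\<Sum>a\<in>#proots P. 1 / (cmod (z - a))\<^sup>2) = 0" using IS z by simp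
  have "proots P = {#}"
  proof (rule ccontr)
    assume "proots P \<noteq> {#}"
    then obtain c where c: "c \<in># proots P" by blast
    then obtain A where A: "proots P = add_mset c A" by (meson mset_add)
    have "z \<noteq> c" using im[OF c] z by auto
    moreover have "(\<Sum>a\<in>#A. 1 / (cmod (z - a))\<^sup>2) \<ge> 0" by (induction A) auto
    ultimately have "(\<Sum>a\<in>#proots P. 1 / (cmod (z - a))\<^sup>2) > 0"
      unfolding A by (simp add: add_pos_nonneg)
    then show False using s0 by simp
  qed
  then show False using S by simp
qed

text \<open>A lower bound that depends on P only through its degree survives coefficientwise limits;
  it does the work of Hurwitz's theorem in \<open>real_rooted_limit\<close>.\<close>

lemma cmod_poly_real_rooted_ge:
  assumes P: "lead_coeff P = 1" "real_rooted P"
  shows "cmod (poly P z) \<ge> \<bar>Im z\<bar> ^ degree P"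
proof -
  have "P \<noteq> 0" using P by auto
  have im: "Im a = 0" if "a \<in># proots P" for a
    using that P \<open>P \<noteq> 0\<close> by (auto simp: real_rooted_def)
  have gen: "(\<forall>a\<in>#A. Im a = 0) \<Longrightarrow> \<bar>Im z\<bar> ^ size A \<le> cmod (poly (\<Prod>a\<in>#A. [:- a, 1:]) z)" for A
  proof (induction A)
    case (add b A)
    have "\<bar>Im z\<bar> \<le> cmod (z - b)" using add.prems abs_Im_le_cmod[of "z - b"] by simp
    then have "\<bar>Im z\<bar> * \<bar>Im z\<bar> ^ size A \<le> cmod (z - b) * cmod (poly (\<Prod>a\<in>#A. [:- a, 1:]) z)"
      using add by (intro mult_mono) auto
    also have "\<dots> = cmod (poly (\<Prod>a\<in>#add_mset b A. [:- a, 1:]) z)"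
      by (simp add: algebra_simps flip: norm_mult)
    finally show ?case by simp
  qed simp
  show ?thesis
    using gen[of "proots P"] im monic_poly_eq_prod_proots[OF P(1)] size_proots_complex[of P] by metis
qed

lemma real_rooted_limit:
  fixes P :: "nat \<Rightarrow> complex poly"
  assumes "\<And>m. lead_coeff (P m) = 1" "\<And>m. degree (P m) = n" "\<And>m. real_rooted (P m)"
    and "degree Q = n" and lim: "\<And>j. (\<lambda>m. coeff (P m) j) \<longlonglongrightarrow> coeff Q j"
  shows "real_rooted Q"
  unfolding real_rooted_def
proof (intro allI impI)
  fix z assume z: "poly Q z = 0"
  have "(\<lambda>m. poly (P m) z) \<longlonglongrightarrow> poly Q z"
    unfolding poly_altdef assms by (intro tendsto_intros lim)
  then have "(\<lambda>m. cmod (poly (P m) z)) \<longlonglongrightarrow> 0"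
    using z by (simp add: tendsto_norm_zero)
  then have "\<bar>Im z\<bar> ^ n \<le> 0"
    by (rule tendsto_lowerbound)
      (use assms(1,3) cmod_poly_real_rooted_ge[of "P _" z] in \<open>auto simp: assms(2)\<close>)
  then show "Im z = 0" by (meson not_less zero_less_abs_iff zero_less_power)
qed

lemma degree_minus_pderiv:
  fixes P :: "complex poly"
  shows "degree (P - smult b (pderiv P)) = degree P"
    and "lead_coeff (P - smult b (pderiv P)) = lead_coeff P"
proof -
  have c: "coeff (P - smult b (pderiv P)) j = coeff P j" if "j \<ge> degree P" for j
    using that by (simp add: coeff_pderiv coeff_eq_0)
  show d: "degree (P - smult b (pderiv P)) = degree P"
  proof (cases "P = 0")
    case False
    show ?thesis
    proof (rule antisym)
      show "degree (P - smult b (pderiv P)) \<le> degree P"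
        by (rule degree_le) (use c in \<open>simp add: coeff_eq_0\<close>)
      show "degree P \<le> degree (P - smult b (pderiv P))"
        by (rule le_degree) (use c[OF order_refl] False in \<open>simp only: leading_coeff_0_iff not_False_eq_True\<close>)
    qed
  qed simp
  show "lead_coeff (P - smult b (pderiv P)) = lead_coeff P"
    unfolding d using c by simp
qed

text \<open>An explicit Euler step of the heat equation: \<open>m\<close> steps of size
  \<open>c / m\<close> apply (1 + c D^2 / m)^m, which tends to exp (c D^2).\<close>

definition euler_step :: "complex \<Rightarrow> complex poly \<Rightarrow> complex poly" where
  "euler_step c P = P + smult c (pderiv (pderiv P))"

text \<open>1 - b^2 D^2 = (1 + b D) (1 - b D), so for real \<open>b\<close> a backward step is two
  uses of \<open>real_rooted_minus_pderiv\<close>.\<close>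

lemma euler_step_factor:
  "euler_step (- (b\<^sup>2)) P =
    (let R = P - smult b (pderiv P) in R - smult (- b) (pderiv R))"
  by (rule poly_eqI)
    (simp add: euler_step_def Let_def pderiv_diff pderiv_smult power2_eq_square algebra_simps)

lemma euler_step_real_rooted:
  assumes "c \<ge> 0" "lead_coeff P = 1" "real_rooted P"
  shows "degree (euler_step (- complex_of_real c) P) = degree P"
    and "lead_coeff (euler_step (- complex_of_real c) P) = 1"
    and "real_rooted (euler_step (- complex_of_real c) P)"
proof -
  define b where "b = sqrt c"
  define R where "R = P - smult (complex_of_real b) (pderiv P)"
  have c: "complex_of_real c = (complex_of_real b)\<^sup>2"
    using assms by (simp add: b_def flip: of_real_power)
  have e: "euler_step (- complex_of_real c) P = R - smult (complex_of_real (- b)) (pderiv R)"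
    unfolding c euler_step_factor R_def Let_def by simp
  have R: "degree R = degree P" "lead_coeff R = 1" "real_rooted R"
    unfolding R_def using assms degree_minus_pderiv[of P "complex_of_real b"] real_rooted_minus_pderiv[OF assms(2,3), of b]
    by metis+
  show "degree (euler_step (- complex_of_real c) P) = degree P"
    and "lead_coeff (euler_step (- complex_of_real c) P) = 1"
    and "real_rooted (euler_step (- complex_of_real c) P)"
    unfolding e using R degree_minus_pderiv[of R "complex_of_real (- b)"] real_rooted_minus_pderiv[OF R(2,3), of "- b"]
    by metis+
qed

lemma euler_step_iterate_real_rooted:
  assumes "c \<ge> 0" "lead_coeff P = 1" "real_rooted P"
  shows "degree ((euler_step (- complex_of_real c) ^^ m) P) = degree P \<and>
    lead_coeff ((euler_step (- complex_of_real c) ^^ m) P) = 1 \<and>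
    real_rooted ((euler_step (- complex_of_real c) ^^ m) P)"
proof (induction m)
  case (Suc m)
  then show ?case
    using euler_step_real_rooted[OF assms(1), of "(euler_step (- complex_of_real c) ^^ m) P"]
    by (metis comp_apply funpow.simps(2))
qed (use assms in simp)

lemma euler_step_iterate:
  "(euler_step c ^^ m) P = (\<Sum>k\<le>m. smult (of_nat (m choose k) * c ^ k) ((pderiv ^^ (2 * k)) P))"
proof (induction m)
  case (Suc m)
  let ?D = "\<lambda>k. (pderiv ^^ (2 * k)) P"
  have "(euler_step c ^^ Suc m) P =
     (\<Sum>k\<le>m. smult (of_nat (m choose k) * c ^ k) (?D k)) +
     smult c (pderiv (pderiv (\<Sum>k\<le>m. smult (of_nat (m choose k) * c ^ k) (?D k))))"
    by (simp only: funpow.simps comp_apply Suc euler_step_def)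
  also have "pderiv (pderiv (\<Sum>k\<le>m. smult (of_nat (m choose k) * c ^ k) (?D k))) =
     (\<Sum>k\<le>m. smult (of_nat (m choose k) * c ^ k) (?D (Suc k)))"
    by (simp add: higher_pderiv_sum[of 1, simplified] pderiv_smult)
  also have "smult c \<dots> = (\<Sum>k\<le>m. smult (of_nat (m choose k) * c ^ Suc k) (?D (Suc k)))"
    by (simp add: smult_sum_right mult_ac)
  also have "(\<Sum>k\<le>m. smult (of_nat (m choose k) * c ^ k) (?D k)) =
     (\<Sum>k\<le>Suc m. smult (of_nat (m choose k) * c ^ k) (?D k))"
    by (simp add: binomial_eq_0)
  also have "\<dots> = ?D 0 + (\<Sum>k\<le>m. smult (of_nat (m choose Suc k) * c ^ Suc k) (?D (Suc k)))"
    by (subst sum.atMost_Suc_shift) simp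
  finally have "(euler_step c ^^ Suc m) P =
     ?D 0 + ((\<Sum>k\<le>m. smult (of_nat (m choose Suc k) * c ^ Suc k) (?D (Suc k))) +
       (\<Sum>k\<le>m. smult (of_nat (m choose k) * c ^ Suc k) (?D (Suc k))))"
    by (simp only: add.assoc)
  also have "\<dots> = (\<Sum>k\<le>Suc m. smult (of_nat (Suc m choose k) * c ^ k) (?D k))"
    unfolding sum.distrib[symmetric] smult_add_left[symmetric] sum.atMost_Suc_shift
    by (simp add: algebra_simps smult_add_left)
  finally show ?case .
qed simp

lemma tendsto_binomial_over_power:
  "(\<lambda>m. of_nat (m choose k) / of_nat m ^ k :: complex) \<longlonglongrightarrow> 1 / fact k"
proof (induction k)
  case (Suc k)
  have lim: "(\<lambda>m. 1 - of_nat k / of_nat m :: complex) \<longlonglongrightarrow> 1 - 0"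
    by (intro tendsto_intros tendsto_divide_0[OF tendsto_const] tendsto_of_nat)
  have "(\<lambda>m. of_nat (m choose k) / of_nat m ^ k * (1 - of_nat k / of_nat m) / of_nat (Suc k) :: complex)
      \<longlonglongrightarrow> 1 / fact k * (1 - 0) / of_nat (Suc k)"
    by (intro tendsto_intros Suc lim) (simp del: of_nat_Suc)
  moreover have "of_nat (m choose k) / of_nat m ^ k * (1 - of_nat k / of_nat m) / of_nat (Suc k) =
      (of_nat (m choose Suc k) / of_nat m ^ Suc k :: complex)" if "m \<ge> Suc k" for m
  proof -
    have "Suc k * (m choose Suc k) = (m - k) * (m choose k)"
      using that by (metis binomial_absorb_comp binomial_absorption)
    then have "of_nat (Suc k) * of_nat (m choose Suc k) = (of_nat m - of_nat k) * (of_nat (m choose k) :: complex)"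
      using that by (metis of_nat_diff of_nat_mult Suc_leD)
    moreover have "of_nat (Suc k) \<noteq> (0 :: complex)" "of_nat m \<noteq> (0 :: complex)" using that by (auto simp del: of_nat_Suc)
    ultimately have "of_nat (m choose Suc k) = (of_nat m - of_nat k) * (of_nat (m choose k) :: complex) / of_nat (Suc k)"
      by (simp add: eq_divide_eq mult.commute del: of_nat_Suc)
    moreover have "1 - of_nat k / of_nat m = ((of_nat m - of_nat k) / of_nat m :: complex)"
      using \<open>of_nat m \<noteq> (0 :: complex)\<close> by (simp add: diff_divide_distrib)
    ultimately show ?thesis by (simp add: mult_ac del: of_nat_Suc)
  qed
  then have "\<forall>\<^sub>F m in sequentially. of_nat (m choose k) / of_nat m ^ k * (1 - of_nat k / of_nat m) / of_nat (Suc k) =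
      (of_nat (m choose Suc k) / of_nat m ^ Suc k :: complex)"
    by (auto simp: eventually_sequentially)
  ultimately show ?case
    by (simp add: filterlim_cong field_simps del: of_nat_Suc)
qed simp

text \<open>exp (- c D^2) is the limit of (1 - c D^2 / m)^m. Every such iterate keeps the zeros real
  and the degree fixed, so the limit may be taken coefficientwise.\<close>

lemma real_rooted_heat:
  assumes "c \<ge> 0" "lead_coeff P = 1" "real_rooted P"
  shows "real_rooted (heat (- complex_of_real c) P)"
proof (rule real_rooted_limit)
  define Pm where "Pm = (\<lambda>m. (euler_step (- complex_of_real (c / real m)) ^^ m) P)"
  have Pm: "degree (Pm m) = degree P \<and> lead_coeff (Pm m) = 1 \<and> real_rooted (Pm m)" for m
    unfolding Pm_def using assms by (intro euler_step_iterate_real_rooted) auto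
  show "lead_coeff (Pm m) = 1" "degree (Pm m) = degree P" "real_rooted (Pm m)" for m
    using Pm by blast+
  show "(\<lambda>m. coeff (Pm m) j) \<longlonglongrightarrow> coeff (heat (- complex_of_real c) P) j" for j
  proof -
    let ?D = "\<lambda>k. coeff ((pderiv ^^ (2 * k)) P) j"
    have "(\<lambda>m. \<Sum>k\<le>degree P. (of_nat (m choose k) / of_nat m ^ k) * (- complex_of_real c) ^ k * ?D k)
       \<longlonglongrightarrow> (\<Sum>k\<le>degree P. (1 / fact k) * (- complex_of_real c) ^ k * ?D k)"
      by (intro tendsto_intros tendsto_binomial_over_power)
    also have "(\<Sum>k\<le>degree P. (1 / fact k) * (- complex_of_real c) ^ k * ?D k) =
        coeff (heat (- complex_of_real c) P) j"
      by (simp add: coeff_heat[of P "degree P"])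
    finally have L: "(\<lambda>m. \<Sum>k\<le>degree P. (of_nat (m choose k) / of_nat m ^ k) * (- complex_of_real c) ^ k * ?D k)
       \<longlonglongrightarrow> coeff (heat (- complex_of_real c) P) j" .
    have "(\<Sum>k\<le>degree P. (of_nat (m choose k) / of_nat m ^ k) * (- complex_of_real c) ^ k * ?D k) =
        coeff (Pm m) j" if "m \<ge> degree P" for m
    proof -
      have "coeff (Pm m) j = (\<Sum>k\<le>m. of_nat (m choose k) * (- complex_of_real (c / m)) ^ k * ?D k)"
        by (simp add: Pm_def euler_step_iterate coeff_sum)
      also have "\<dots> = (\<Sum>k\<le>degree P. of_nat (m choose k) * (- complex_of_real (c / m)) ^ k * ?D k)"
        using that by (intro sum.mono_neutral_right) (auto simp: higher_pderiv_eq_0)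
      also have "\<dots> = (\<Sum>k\<le>degree P. (of_nat (m choose k) / of_nat m ^ k) * (- complex_of_real c) ^ k * ?D k)"
      proof -
        have "(- complex_of_real (c / m)) ^ k = (- complex_of_real c) ^ k / of_nat m ^ k" for k
          by (simp flip: power_divide)
        then show ?thesis by simp
      qed
      finally show ?thesis by simp
    qed
    then have "\<forall>\<^sub>F m in sequentially. (\<Sum>k\<le>degree P. (of_nat (m choose k) / of_nat m ^ k) * (- complex_of_real c) ^ k * ?D k) =
        coeff (Pm m) j"
      by (auto simp: eventually_sequentially)
    then show ?thesis using L by (rule Lim_transform_eventually[rotated])
  qed
qed simp

section \<open>Power sums of zeros along the heat flow\<close>

definition psum :: "nat \<Rightarrow> complex poly \<Rightarrow> complex" where
  "psum k P = (\<Sum>a\<in>#proots P. a ^ k)"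

abbreviation (input) fps_euler :: "complex fps \<Rightarrow> complex fps" where
  "fps_euler F \<equiv> fps_X * fps_deriv F"

lemma fps_geometric: "(1 - fps_const a * fps_X) * Abs_fps (\<lambda>k. a ^ k) = (1 :: complex fps)"
proof (rule fps_ext)
  fix n
  have "((1 - fps_const a * fps_X) * Abs_fps (\<lambda>k. a ^ k)) $ n =
      (Abs_fps (\<lambda>k. a ^ k) - fps_const a * (fps_X * Abs_fps (\<lambda>k. a ^ k))) $ n"
    by (simp add: algebra_simps)
  also have "\<dots> = (1 :: complex fps) $ n"
    by (cases n) simp_all
  finally show "((1 - fps_const a * fps_X) * Abs_fps (\<lambda>k. a ^ k)) $ n = (1 :: complex fps) $ n" .
qed

lemma fps_euler_nth: "(fps_X * fps_deriv F) $ k = of_nat k * (F :: complex fps) $ k"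
  by (cases k) simp_all

lemma fps_const_minus_euler_nth:
  "(of_nat n * F - fps_X * fps_deriv F) $ k = (of_nat n - of_nat k) * (F :: complex fps) $ k"
proof -
  have "(of_nat n * F) $ k = of_nat n * F $ k"
    by (simp only: fps_of_nat[symmetric] fps_mult_left_const_nth)
  then show ?thesis by (simp only: fps_sub_nth fps_euler_nth left_diff_distrib)
qed

text \<open>Newton's identities. With C the product of the factors 1 - a X, the power sums have
  generating function S, the sum of 1 / (1 - a X), and X C' / C is the sum of 1 - 1 / (1 - a X),
  that is \<open>size A\<close> minus S. Reversing the polynomial gives C constant term 1.\<close>

lemma newton_fps_prod_linear:
  fixes A :: "complex multiset"
  defines "C \<equiv> fps_of_poly (reflect_poly (\<Prod>a\<in>#A. [:- a, 1:]))"
  shows "C * Abs_fps (\<lambda>k. \<Sum>a\<in>#A. a ^ k) = of_nat (size A) * C - fps_euler C"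
  unfolding C_def
proof (induction A)
  case empty
  show ?case by (simp add: fps_zero_def[symmetric])
next
  case (add b A)
  define L :: "complex fps" where "L = 1 - fps_const b * fps_X"
  define C where "C = fps_of_poly (reflect_poly (\<Prod>a\<in>#A. [:- a, 1:]))"
  define S where "S = Abs_fps (\<lambda>k. \<Sum>a\<in>#A. a ^ k)"
  define G where "G = Abs_fps (\<lambda>k. b ^ k)"
  have "fps_of_poly (reflect_poly [:- b, 1:]) = L"
    by (cases "b = 0") (simp_all add: reflect_poly_pCons reflect_poly_pCons' L_def fps_of_poly_pCons cCons_def numeral_2_eq_2)
  then have C': "fps_of_poly (reflect_poly (\<Prod>a\<in>#add_mset b A. [:- a, 1:])) = L * C"
    by (simp only: C_def image_mset_add_mset prod_mset.add_mset reflect_poly_mult fps_of_poly_mult)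
  have S': "Abs_fps (\<lambda>k. \<Sum>a\<in>#add_mset b A. a ^ k) = G + S"
    by (rule fps_ext) (simp add: S_def G_def)
  have IH: "C * S = of_nat (size A) * C - fps_X * fps_deriv C"
    using add unfolding C_def S_def .
  have LG: "L * G = 1" unfolding L_def G_def by (rule fps_geometric)
  have dL: "fps_deriv L = - fps_const b" by (simp add: L_def)
  have "L * C * (G + S) = C * (L * G) + L * (C * S)" by (simp add: algebra_simps)
  also have "\<dots> = C + L * (of_nat (size A) * C - fps_X * fps_deriv C)"
    unfolding LG IH by simp
  also have "\<dots> = of_nat (size (add_mset b A)) * (L * C) - fps_X * fps_deriv (L * C)"
  proof -
    have "C = L * C + fps_const b * (fps_X * C)" by (simp add: L_def algebra_simps)
    then show ?thesis by (simp add: dL algebra_simps del: fps_const_neg)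
  qed
  finally show ?case unfolding C' S' .
qed

lemma newton_fps:
  assumes "lead_coeff P = 1"
  defines "C \<equiv> fps_of_poly (reflect_poly P)"
  shows "C * Abs_fps (\<lambda>k. psum k P) = of_nat (degree P) * C - fps_euler C"
  using newton_fps_prod_linear[of "proots P"] monic_poly_eq_prod_proots[OF assms(1)]
  unfolding C_def psum_def by (simp add: size_proots_complex)

lemma psum_recursion:
  assumes "lead_coeff P = 1"
  shows "psum k P = (of_nat (degree P) - of_nat k) * coeff (reflect_poly P) k -
    (\<Sum>j=1..k. coeff (reflect_poly P) j * psum (k - j) P)"
proof -
  have "(fps_of_poly (reflect_poly P) * Abs_fps (\<lambda>k. psum k P)) $ k =
      (of_nat (degree P) * fps_of_poly (reflect_poly P) - fps_euler (fps_of_poly (reflect_poly P))) $ k"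
    unfolding newton_fps[OF assms] ..
  then have "(\<Sum>j=0..k. coeff (reflect_poly P) j * psum (k - j) P) =
      (of_nat (degree P) - of_nat k) * coeff (reflect_poly P) k"
    unfolding fps_const_minus_euler_nth by (simp add: fps_mult_nth)
  moreover have "{0..k} = insert 0 {1..k}" by auto
  ultimately show ?thesis using assms by (simp add: algebra_simps)
qed

lemma coeff_reflect_heat_has_derivative:
  fixes P :: "complex poly"
  shows "((\<lambda>s. coeff (reflect_poly (heat s P)) k) has_field_derivative
    (if k < 2 then 0 else (of_nat (degree P) - of_nat k + 1) * (of_nat (degree P) - of_nat k + 2) *
       coeff (reflect_poly (heat s P)) (k - 2))) (at s)"
proof (cases "k > degree P")
  case True
  then have c: "coeff (reflect_poly (heat s P)) k = 0" for s
    by (simp add: coeff_reflect_poly)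
  \<comment> \<open>Just beyond the degree, at \<open>degree P + 1\<close> and
    \<open>degree P + 2\<close>, one of the two factors vanishes; further out the coefficient
    does.\<close>
  have "(of_nat (degree P) - of_nat k + 1) * (of_nat (degree P) - of_nat k + 2) *
       coeff (reflect_poly (heat s P)) (k - 2) = 0" if "k \<ge> 2"
  proof -
    consider "k = degree P + 1" | "k = degree P + 2" | "k > degree P + 2" using True by linarith
    then show ?thesis by cases (auto simp: coeff_reflect_poly)
  qed
  then show ?thesis by (auto simp: c)
next
  case False
  then have k: "k \<le> degree P" by simp
  have c: "coeff (reflect_poly (heat s P)) k = coeff (heat s P) (degree P - k)" for s
    using k by (simp add: coeff_reflect_poly)
  have "coeff (pderiv (pderiv (heat s P))) (degree P - k) =
    (if k < 2 then 0 else (of_nat (degree P) - of_nat k + 1) * (of_nat (degree P) - of_nat k + 2) *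
       coeff (reflect_poly (heat s P)) (k - 2))"
  proof (cases "k < 2")
    case True
    then show ?thesis using k by (simp add: coeff_pderiv coeff_eq_0)
  next
    case False
    then obtain j where j: "k = j + 2" by (metis add.commute le_Suc_ex not_less)
    then obtain m where m: "degree P = m + (j + 2)" using k by (metis le_Suc_ex add.commute)
    have "coeff (reflect_poly (heat s P)) j = coeff (heat s P) (Suc (Suc m))"
      by (simp add: coeff_reflect_poly m)
    then show ?thesis unfolding m j by (simp add: coeff_pderiv algebra_simps)
  qed
  then show ?thesis unfolding c using coeff_heat_has_derivative[of P "degree P - k" s] by simp
qed

text \<open>Only existence of the derivative, by solving Newton's identities recursively. Its value
  is then found by differentiating the identities as a whole.\<close>

lemma psum_heat_differentiable:
  assumes "lead_coeff P = 1"
  shows "(\<lambda>s. psum k (heat s P)) field_differentiable (at s)"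
proof (induction k rule: less_induct)
  case (less k)
  have c: "(\<lambda>s. coeff (reflect_poly (heat s P)) j) field_differentiable (at s)" for j
    using coeff_reflect_heat_has_derivative field_differentiable_def by blast
  have "(\<lambda>s. psum k (heat s P)) = (\<lambda>s. (of_nat (degree P) - of_nat k) * coeff (reflect_poly (heat s P)) k -
    (\<Sum>j=1..k. coeff (reflect_poly (heat s P)) j * psum (k - j) (heat s P)))"
    using psum_recursion[of "heat _ P" k] assms by simp
  moreover have "(\<lambda>s. (of_nat (degree P) - of_nat k) * coeff (reflect_poly (heat s P)) k -
    (\<Sum>j=1..k. coeff (reflect_poly (heat s P)) j * psum (k - j) (heat s P))) field_differentiable (at s)"
    by (intro field_differentiable_diff field_differentiable_mult field_differentiable_sum
        field_differentiable_const c less) auto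
  ultimately show ?case by simp
qed

text \<open>For simple zeros this is the motion a' = - 2 * sum 1 / (a - b), multiplied by k a^(k-1),
  summed over a and symmetrized in a and b. Working with generating functions makes it valid at
  multiple zeros as well.\<close>

lemma psum_heat_has_derivative:
  assumes "lead_coeff P = 1"
  shows "((\<lambda>s. psum k (heat s P)) has_field_derivative
    (if k < 2 then 0 else of_nat k * (of_nat (k - 1) * psum (k - 2) (heat s P) -
       (\<Sum>i=0..k-2. psum i (heat s P) * psum (k - 2 - i) (heat s P))))) (at s)"
proof -
  define N :: "complex fps" where "N = of_nat (degree P)"
  define C where "C = fps_of_poly (reflect_poly (heat s P))"
  define S where "S = Abs_fps (\<lambda>k. psum k (heat s P))"
  define S' where "S' = Abs_fps (\<lambda>k. deriv (\<lambda>s. psum k (heat s P)) s)"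
  define C' where "C' = Abs_fps (\<lambda>k. if k < 2 then 0 else
     (of_nat (degree P) - of_nat k + 1) * (of_nat (degree P) - of_nat k + 2) * C $ (k - 2))"
  have DS: "((\<lambda>s. psum k (heat s P)) has_field_derivative S' $ k) (at s)" for k
    unfolding S'_def using psum_heat_differentiable[OF assms] by (simp add: field_differentiable_derivI)
  have DC: "((\<lambda>s. coeff (reflect_poly (heat s P)) k) has_field_derivative C' $ k) (at s)" for k
    unfolding C'_def C_def fps_nth_Abs_fps fps_of_poly_nth by (rule coeff_reflect_heat_has_derivative)
  have N1: "C * S = N * C - fps_X * fps_deriv C"
    using newton_fps[of "heat s P"] assms by (simp add: C_def S_def N_def)
  have N2: "C' * S + C * S' = N * C' - fps_X * fps_deriv C'"
  proof (rule fps_ext)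
    fix k
    have eq: "(\<Sum>j=0..k. coeff (reflect_poly (heat s P)) j * psum (k - j) (heat s P)) =
        (of_nat (degree P) - of_nat k) * coeff (reflect_poly (heat s P)) k" for s
    proof -
      have "{0..k} = insert 0 {1..k}" by auto
      then show ?thesis
        using psum_recursion[of "heat s P" k] assms by (simp add: algebra_simps)
    qed
    have "((\<lambda>s. \<Sum>j=0..k. coeff (reflect_poly (heat s P)) j * psum (k - j) (heat s P))
        has_field_derivative (\<Sum>j=0..k. C' $ j * psum (k - j) (heat s P) +
          S' $ (k - j) * coeff (reflect_poly (heat s P)) j)) (at s)"
      by (intro DERIV_sum DERIV_mult DS DC)
    moreover have "((\<lambda>s. (of_nat (degree P) - of_nat k) * coeff (reflect_poly (heat s P)) k)
        has_field_derivative (of_nat (degree P) - of_nat k) * C' $ k) (at s)"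
      by (intro DERIV_cmult DC)
    ultimately have "(\<Sum>j=0..k. C' $ j * psum (k - j) (heat s P) +
          S' $ (k - j) * coeff (reflect_poly (heat s P)) j) = (of_nat (degree P) - of_nat k) * C' $ k"
      unfolding eq by (rule DERIV_unique)
    moreover have "(C' * S) $ k = (\<Sum>j=0..k. C' $ j * psum (k - j) (heat s P))"
      by (simp add: fps_mult_nth S_def)
    moreover have "(C * S') $ k = (\<Sum>j=0..k. S' $ (k - j) * coeff (reflect_poly (heat s P)) j)"
      unfolding fps_mult_nth by (intro sum.cong) (simp_all add: C_def)
    moreover have "(N * C' - fps_X * fps_deriv C') $ k = (of_nat (degree P) - of_nat k) * C' $ k"
      unfolding N_def by (rule fps_const_minus_euler_nth)
    ultimately show "(C' * S + C * S') $ k = (N * C' - fps_X * fps_deriv C') $ k"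
      by (simp only: fps_add_nth sum.distrib)
  qed
  \<comment> \<open>\<open>K\<close> is the time derivative of log C. With E the operator X d/dX,
    the heat equation reads C' = X^2 (N - 1 - E) (N - E) C, and (N - E) C = C S by Newton's identity
    \<open>N1\<close>.\<close>
  define K where "K = fps_X\<^sup>2 * (S * S - S - fps_X * fps_deriv S)"
  have C': "C' = C * K"
  proof -
    have "C' = fps_X\<^sup>2 * ((N - 1) * (C * S) - fps_X * fps_deriv (C * S))"
    proof (rule fps_ext)
      fix k
      show "C' $ k = (fps_X\<^sup>2 * ((N - 1) * (C * S) - fps_X * fps_deriv (C * S))) $ k"
      proof (cases "k < 2")
        case True
        then show ?thesis by (simp add: C'_def fps_X_power_mult_nth)
      next
        case False
        then obtain j where j: "k = j + 2" by (metis add.commute le_Suc_ex not_less)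
        have CS: "(C * S) $ j = (of_nat (degree P) - of_nat j) * C $ j" for j
          unfolding N1 N_def by (rule fps_const_minus_euler_nth)
        have "((N - 1) * (C * S) - fps_X * fps_deriv (C * S)) $ j =
            (of_nat (degree P) - 1 - of_nat j) * (C * S) $ j"
        proof -
          have "(N - 1) * F - fps_X * fps_deriv F = (N * F - fps_X * fps_deriv F) - F" for F
            by (simp add: algebra_simps)
          then have "((N - 1) * F - fps_X * fps_deriv F) $ j = (of_nat (degree P) - of_nat j) * F $ j - F $ j" for F
            unfolding N_def by (metis fps_sub_nth fps_const_minus_euler_nth)
          then show ?thesis by (simp only:) (simp add: algebra_simps)
        qed
        moreover have "(fps_X\<^sup>2 * F) $ k = F $ j" for F :: "complex fps"
          by (simp add: j fps_X_power_mult_nth)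
        moreover have "C' $ k = (of_nat (degree P) - 1 - of_nat j) * ((of_nat (degree P) - of_nat j) * C $ j)"
          by (simp add: C'_def j algebra_simps)
        ultimately show ?thesis by (simp only: CS)
      qed
    qed
    also have "fps_X * fps_deriv (C * S) = fps_X * fps_deriv C * S + C * (fps_X * fps_deriv S)"
      by (simp add: algebra_simps)
    also have "(N - 1) * (C * S) - (fps_X * fps_deriv C * S + C * (fps_X * fps_deriv S)) =
        (N * C - fps_X * fps_deriv C) * S - C * S - C * (fps_X * fps_deriv S)"
      by (simp add: algebra_simps)
    also have "N * C - fps_X * fps_deriv C = C * S" using N1 by simp
    finally show ?thesis by (simp add: K_def algebra_simps)
  qed
  \<comment> \<open>Inserting C' = C K into the differentiated identity \<open>N2\<close> and
    cancelling the nonzero series C leaves S' = - E K.\<close>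
  have "C * S' = (N * C - fps_X * fps_deriv C) * K - C * S * K - C * (fps_X * fps_deriv K)"
    using N2 unfolding C' by (simp add: algebra_simps)
  also have "N * C - fps_X * fps_deriv C = C * S" using N1 by simp
  finally have "C * S' = C * (- (fps_X * fps_deriv K))" by simp
  moreover have "C \<noteq> 0"
  proof
    assume "C = 0"
    moreover have "C $ 0 = 1" using assms by (simp add: C_def)
    ultimately show False by simp
  qed
  ultimately have "S' = - (fps_X * fps_deriv K)" by (metis mult_left_cancel)
  then have "S' $ k = - of_nat k * K $ k" by (simp only: fps_neg_nth fps_euler_nth mult_minus_left)
  also have "\<dots> = (if k < 2 then 0 else of_nat k * (of_nat (k - 1) * psum (k - 2) (heat s P) -
       (\<Sum>i=0..k-2. psum i (heat s P) * psum (k - 2 - i) (heat s P))))"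
  proof (cases "k < 2")
    case False
    then obtain j where j: "k = j + 2" by (metis add.commute le_Suc_ex not_less)
    have "(fps_X * fps_deriv S) $ j = of_nat j * psum j (heat s P)"
      unfolding fps_euler_nth by (simp add: S_def)
    moreover have "(fps_X\<^sup>2 * F) $ k = F $ j" for F :: "complex fps"
      by (simp add: j fps_X_power_mult_nth)
    moreover have "(S * S) $ j = (\<Sum>i=0..j. psum i (heat s P) * psum (j - i) (heat s P))"
      by (simp add: fps_mult_nth S_def)
    moreover have "S $ j = psum j (heat s P)" by (simp add: S_def)
    ultimately have "K $ k = (\<Sum>i=0..j. psum i (heat s P) * psum (j - i) (heat s P)) - psum j (heat s P) - of_nat j * psum j (heat s P)"
      by (simp only: K_def fps_sub_nth)
    then show ?thesis unfolding j by (simp only:) (simp add: algebra_simps)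
  qed (simp add: K_def fps_X_power_mult_nth)
  finally show ?thesis using DS[of k] by simp
qed

section \<open>Normalized power sums as polynomials in time\<close>

definition poly_antideriv :: "'a::field_char_0 poly \<Rightarrow> 'a poly" where
  "poly_antideriv B = (\<Sum>i\<le>degree B. monom (coeff B i / of_nat (Suc i)) (Suc i))"

lemma coeff_poly_antideriv:
  "coeff (poly_antideriv B) j = (case j of 0 \<Rightarrow> 0 | Suc i \<Rightarrow> coeff B i / of_nat (Suc i))"
proof (cases j)
  case (Suc i)
  have "coeff (poly_antideriv B) j = (\<Sum>l\<le>degree B. if l = i then coeff B i / of_nat (Suc i) else 0)"
    unfolding poly_antideriv_def coeff_sum Suc by (intro sum.cong) (auto simp: coeff_monom)
  also have "\<dots> = coeff B i / of_nat (Suc i)"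
    by (auto simp: coeff_eq_0)
  finally show ?thesis using Suc by simp
qed (simp add: poly_antideriv_def coeff_sum)

lemma pderiv_poly_antideriv: "pderiv (poly_antideriv B) = B"
  by (rule poly_eqI) (simp add: coeff_pderiv coeff_poly_antideriv del: of_nat_Suc)

lemma degree_poly_antideriv: "degree (poly_antideriv B) \<le> Suc (degree B)"
  by (rule degree_le) (auto simp: coeff_poly_antideriv coeff_eq_0 split: nat.split)

lemma eq_poly_if_DERIV_eq:
  fixes f :: "complex \<Rightarrow> complex"
  assumes "\<And>s. (f has_field_derivative poly B s) (at s)"
  shows "f s = poly ([:f 0:] + poly_antideriv B) s"
proof -
  have "((\<lambda>s. f s - poly (poly_antideriv B) s) has_field_derivative 0) (at s)" for s
    using DERIV_diff[OF assms poly_DERIV[of "poly_antideriv B"]] by (simp add: pderiv_poly_antideriv)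
  then obtain c where c: "\<And>s. f s - poly (poly_antideriv B) s = c"
    using has_field_derivative_zero_constant[of UNIV "\<lambda>s. f s - poly (poly_antideriv B) s"] by auto
  have "poly (poly_antideriv B) 0 = 0"
    by (simp add: poly_0_coeff_0 coeff_poly_antideriv)
  then show ?thesis using c[of 0] c[of s] by (simp add: algebra_simps)
qed

text \<open>
  The power sums along the heat flow are polynomials in the time parameter; their coefficients
  inherit convergence from the initial power sums because the flow of the normalized power sums
  is triangular with coefficients that converge as the degree tends to infinity.
\<close>

lemma psum_heat_polynomial_in_time:
  fixes P :: "nat \<Rightarrow> complex poly"
  assumes P: "\<And>n. lead_coeff (P n) = 1"
    and conv: "\<And>k. convergent (\<lambda>n. psum k (P n) / of_nat n)"
  shows "\<exists>A D. (\<forall>n\<ge>1. \<forall>s. psum k (heat (- (s / (2 * of_nat n))) (P n)) / of_nat n = poly (A n) s) \<and>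
    (\<forall>n. degree (A n) \<le> D) \<and> (\<forall>i. convergent (\<lambda>n. coeff (A n) i))"
proof (induction k rule: less_induct)
  case (less k)
  \<comment> \<open>Time is measured in units of -1 / (2 n) and power sums in units of n: this
    removes \<open>n\<close> from the quadratic term of the flow and leaves the linear term with a
    factor 1 / n.\<close>
  define M where "M = (\<lambda>n k s. psum k (heat (- (s / (2 * of_nat n))) (P n)) / complex_of_nat n)"
  have conv0: "convergent (\<lambda>n. M n k 0)"
    unfolding M_def using conv by simp
  have DM: "(M n k has_field_derivative
      (if k < 2 then 0 else of_nat k / 2 * ((\<Sum>i=0..k-2. M n i s * M n (k - 2 - i) s) -
        of_nat (k - 1) / of_nat n * M n (k - 2) s))) (at s)" if "n \<ge> 1" for n s
  proof -
    let ?S = "\<lambda>k. psum k (heat (- (s / (2 * of_nat n))) (P n))"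
    let ?d = "if k < 2 then 0 else of_nat k * (of_nat (k - 1) * ?S (k - 2) - (\<Sum>i=0..k-2. ?S i * ?S (k - 2 - i)))"
    have "((\<lambda>s. - (s / (2 * of_nat n))) has_field_derivative - (1 / (2 * of_nat n))) (at s)"
      by (intro DERIV_minus DERIV_cdivide DERIV_ident)
    from DERIV_chain2[OF psum_heat_has_derivative[OF P] this]
    have "((\<lambda>s. psum k (heat (- (s / (2 * of_nat n))) (P n))) has_field_derivative
        ?d * - (1 / (2 * of_nat n))) (at s)" .
    from DERIV_cdivide[OF this, of "of_nat n"]
    have "(M n k has_field_derivative ?d * - (1 / (2 * of_nat n)) / of_nat n) (at s)"
      unfolding M_def .
    moreover have "?d * - (1 / (2 * of_nat n)) / of_nat n =
      (if k < 2 then 0 else of_nat k / 2 * ((\<Sum>i=0..k-2. M n i s * M n (k - 2 - i) s) -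
        of_nat (k - 1) / of_nat n * M n (k - 2) s))"
    proof -
      have "(\<Sum>i=0..k-2. M n i s * M n (k - 2 - i) s) = (\<Sum>i=0..k-2. ?S i * ?S (k - 2 - i)) / (of_nat n * of_nat n)"
        unfolding M_def sum_divide_distrib by simp
      moreover have "M n (k - 2) s = ?S (k - 2) / of_nat n" by (simp add: M_def)
      moreover have "a * (b * x - T) * - (1 / (2 * c)) / c = a / 2 * (T / (c * c) - b / c * (x / c))"
        for a b x T c :: complex
        by (simp add: divide_simps) (simp add: algebra_simps)
      ultimately show ?thesis by (simp only: if_distrib) simp
    qed
    ultimately show ?thesis by simp
  qed
  show ?case
  proof (cases "k < 2")
    case True
    have "M n k s = M n k 0" if "n \<ge> 1" for n s
      using eq_poly_if_DERIV_eq[of "M n k" 0 s] DM[OF that] True by (simp add: poly_antideriv_def)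
    then have 1: "\<forall>n\<ge>1. \<forall>s. M n k s = poly [:M n k 0:] s"
      unfolding poly_pCons poly_0 mult_zero_right add_0_right by blast
    have 2: "convergent (\<lambda>n. coeff [:M n k 0:] i)" for i
      by (cases i) (simp_all add: conv0 convergent_const)
    have "\<exists>A D. (\<forall>n\<ge>1. \<forall>s. M n k s = poly (A n) s) \<and> (\<forall>n. degree (A n) \<le> D) \<and>
        (\<forall>i. convergent (\<lambda>n. coeff (A n) i))"
      by (rule exI[of _ "\<lambda>n. [:M n k 0:]"], rule exI[of _ 0], intro conjI allI 1 2) simp
    then show ?thesis unfolding M_def .
  next
    case False
    define Q where "Q = (\<lambda>i A D. (\<forall>n\<ge>1. \<forall>s. M n i s = poly (A n) s) \<and> (\<forall>n. degree (A n) \<le> D) \<and>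
        (\<forall>j. convergent (\<lambda>n. coeff (A n) j)))"
    have "\<exists>X. Q i (fst X) (snd X)" if i: "i < k" for i
    proof -
      obtain A D where "Q i A D" using less[OF i] unfolding Q_def M_def by blast
      then show ?thesis by (intro exI[of _ "(A, D)"]) (simp only: fst_conv snd_conv)
    qed
    then obtain X where X: "\<And>i. i < k \<Longrightarrow> Q i (fst (X i)) (snd (X i))"
      by metis
    define A D where "A = (\<lambda>i. fst (X i))" and "D = (\<lambda>i. snd (X i))"
    have A: "\<And>i n s. i < k \<Longrightarrow> n \<ge> 1 \<Longrightarrow> M n i s = poly (A i n) s"
      and D: "\<And>i n. i < k \<Longrightarrow> degree (A i n) \<le> D i"
      and cA: "\<And>i j. i < k \<Longrightarrow> convergent (\<lambda>n. coeff (A i n) j)"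
      using X unfolding Q_def A_def D_def by auto
    define B where "B = (\<lambda>n. smult (of_nat k / 2) ((\<Sum>i=0..k-2. A i n * A (k - 2 - i) n) -
        smult (of_nat (k - 1) / of_nat n) (A (k - 2) n)))"
    define E where "E = (\<Sum>i<k. D i)"
    have DE: "degree (A i n) \<le> E" if "i < k" for i n
      using D[OF that] member_le_sum[of i "{..<k}" D] that unfolding E_def by (meson finite_lessThan le_trans lessThan_iff zero_le)
    have degB: "degree (B n) \<le> E + E" for n
    proof -
      have "degree (\<Sum>i=0..k-2. A i n * A (k - 2 - i) n) \<le> E + E"
        using False by (intro degree_sum_le order.trans[OF degree_mult_le] add_mono DE) auto
      moreover have "degree (smult (of_nat (k - 1) / of_nat n) (A (k - 2) n)) \<le> E + E"
        using DE[of "k - 2" n] degree_smult_le[of "of_nat (k - 1) / of_nat n" "A (k - 2) n"] False by simp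
      ultimately show ?thesis unfolding B_def
        by - (rule order.trans[OF degree_smult_le], rule degree_diff_le)
    qed
    have cB: "convergent (\<lambda>n. coeff (B n) j)" for j
    proof -
      have c1: "convergent (\<lambda>n. of_nat (k - 1) / of_nat n :: complex)"
        using tendsto_divide_0[OF tendsto_const tendsto_of_nat] convergentI by blast
      have "convergent (\<lambda>n. of_nat k / 2 * ((\<Sum>i=0..k-2. \<Sum>l\<le>j. coeff (A i n) l * coeff (A (k - 2 - i) n) (j - l)) -
        (of_nat (k - 1) / of_nat n) * coeff (A (k - 2) n) j))"
        using False by (intro convergent_mult convergent_const convergent_diff convergent_sum cA c1) auto
      then show ?thesis by (simp add: B_def coeff_sum coeff_mult)
    qed
    have "(M n k has_field_derivative poly (B n) s) (at s)" if "n \<ge> 1" for n s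
      using DM[OF that, of s] A[OF _ that] False by (simp add: B_def poly_sum)
    then have e1: "M n k s = poly ([:M n k 0:] + poly_antideriv (B n)) s" if "n \<ge> 1" for n s
      using that by (intro eq_poly_if_DERIV_eq)
    have e2: "degree ([:M n k 0:] + poly_antideriv (B n)) \<le> Suc (E + E)" for n
      using degree_poly_antideriv[of "B n"] degB[of n] by (intro degree_add_le) auto
    have e3: "convergent (\<lambda>n. coeff ([:M n k 0:] + poly_antideriv (B n)) j)" for j
    proof (cases j)
      case 0
      then show ?thesis by (simp add: coeff_poly_antideriv conv0)
    next
      case (Suc i)
      have "convergent (\<lambda>n. coeff (B n) i * (1 / of_nat (Suc i)))"
        by (intro convergent_mult cB convergent_const)
      then show ?thesis by (simp add: Suc coeff_poly_antideriv del: of_nat_Suc)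
    qed
    have "\<exists>A D. (\<forall>n\<ge>1. \<forall>s. M n k s = poly (A n) s) \<and> (\<forall>n. degree (A n) \<le> D) \<and>
        (\<forall>i. convergent (\<lambda>n. coeff (A n) i))"
      by (rule exI[of _ "\<lambda>n. [:M n k 0:] + poly_antideriv (B n)"], rule exI[of _ "Suc (E + E)"],
          intro conjI allI impI e1 e2 e3)
    then show ?thesis unfolding M_def .
  qed
qed

text \<open>The degree bound is uniform in \<open>n\<close>, so evaluation at s = 1 is a sum of a
  fixed number of convergent sequences.\<close>

lemma convergent_psum_heat:
  fixes P :: "nat \<Rightarrow> complex poly"
  assumes P: "\<And>n. lead_coeff (P n) = 1"
    and conv: "\<And>k. convergent (\<lambda>n. psum k (P n) / of_nat n)"
  shows "convergent (\<lambda>n. psum k (heat (- (1 / (2 * of_nat n))) (P n)) / of_nat n)"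
proof -
  obtain A D where A: "\<And>n s. n \<ge> 1 \<Longrightarrow> psum k (heat (- (s / (2 * of_nat n))) (P n)) / of_nat n = poly (A n) s"
    and D: "\<And>n. degree (A n) \<le> D" and cA: "\<And>i. convergent (\<lambda>n. coeff (A n) i)"
    using psum_heat_polynomial_in_time[OF assms] by blast
  have "poly (A n) 1 = (\<Sum>i\<le>D. coeff (A n) i)" for n
    using D unfolding poly_altdef by (auto intro!: sum.mono_neutral_cong_left intro: le_degree)
  then have "convergent (\<lambda>n. poly (A n) 1)"
    using cA by (simp add: convergent_sum)
  moreover have "\<forall>\<^sub>F n in sequentially. psum k (heat (- (1 / (2 * of_nat n))) (P n)) / of_nat n = poly (A n) 1"
    using A[of _ 1] by (auto simp: eventually_sequentially)
  ultimately show ?thesis using convergent_cong by fast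
qed

section \<open>Weak convergence from convergent moments\<close>

lemma sets_zero_counting_measure [simp]: "sets (zero_counting_measure P) = sets borel"
  using sets.sigma_sets_eq[of "borel :: complex measure"] by (simp add: zero_counting_measure_def)

text \<open>As a finitely supported probability mass function, the measure has integrals that are
  finite sums. A positive degree makes the multiset of zeros nonempty.\<close>

lemma zero_counting_measure_eq_distr:
  assumes "degree P > 0"
  shows "zero_counting_measure P = distr (measure_pmf (pmf_of_multiset (proots P))) borel (\<lambda>x. x)"
proof (rule measure_eqI)
  have P0: "P \<noteq> 0" using assms by auto
  have ne: "proots P \<noteq> {#}" using assms size_proots_complex[of P] by auto
  show "sets (zero_counting_measure P) = sets (distr (measure_pmf (pmf_of_multiset (proots P))) borel (\<lambda>x. x))"
    by simp
  fix A assume "A \<in> sets (zero_counting_measure P)"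
  then have A: "A \<in> sets borel" by simp
  let ?M = "measure_pmf (pmf_of_multiset (proots P))"
  have "emeasure (distr ?M borel (\<lambda>x. x)) A = emeasure ?M A"
    using A by (simp add: emeasure_distr)
  also have "\<dots> = emeasure ?M (A \<inter> {x. poly P x = 0})"
    using emeasure_Int_set_pmf[of "pmf_of_multiset (proots P)" A] ne P0 by simp
  also have "\<dots> = (\<Sum>x\<in>A \<inter> {x. poly P x = 0}. ennreal (pmf (pmf_of_multiset (proots P)) x))"
    by (subst emeasure_measure_pmf_finite) (use P0 poly_roots_finite in \<open>auto simp: sum_ennreal\<close>)
  also have "\<dots> = (\<Sum>x | poly P x = 0. ennreal (real (order x P) / real (degree P)) * indicator A x)"
    using P0 poly_roots_finite[OF P0] ne
    by (intro sum.mono_neutral_cong_left) (auto simp: size_proots_complex indicator_def)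
  also have "\<dots> = (\<Sum>x | poly P x = 0. of_nat (order x P) * indicator A x) / of_nat (degree P)"
  proof -
    have "ennreal (real (order x P) / real (degree P)) * indicator A x =
        of_nat (order x P) * indicator A x * inverse (of_nat (degree P))" for x
      using assms by (simp add: divide_ennreal[symmetric] divide_ennreal_def ennreal_of_nat_eq_real_of_nat mult_ac)
    then show ?thesis by (simp add: divide_ennreal_def sum_distrib_right)
  qed
  finally show "emeasure (zero_counting_measure P) A = emeasure (distr ?M borel (\<lambda>x. x)) A"
    using emeasure_zero_counting_measure[OF A] by simp
qed

lemma sum_mset_image_eq_sum_count:
  "(\<Sum>x\<in>#A. f x) = (\<Sum>x\<in>set_mset A. real (count A x) * f x)"
proof (induction A)
  case (add b A)
  have "(\<Sum>x\<in>set_mset A. real (count A x) * f x) = (\<Sum>x\<in>insert b (set_mset A). real (count A x) * f x)"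
    by (intro sum.mono_neutral_left) (auto simp: not_in_iff)
  moreover have "(\<Sum>x\<in>insert b (set_mset A). real (count (add_mset b A) x) * f x) =
     (\<Sum>x\<in>insert b (set_mset A). real (count A x) * f x + (if x = b then f b else 0))"
    by (intro sum.cong) (auto simp: algebra_simps)
  ultimately show ?case using add by (simp add: sum.distrib)
qed simp

lemma integral_pmf_proots:
  fixes f :: "complex \<Rightarrow> real"
  assumes "degree P > 0"
  shows "(LINT x|measure_pmf (pmf_of_multiset (proots P)). f x) = (\<Sum>x\<in>#proots P. f x) / degree P"
proof -
  have P0: "P \<noteq> 0" using assms by auto
  have ne: "proots P \<noteq> {#}" using assms size_proots_complex[of P] by auto
  have "(LINT x|measure_pmf (pmf_of_multiset (proots P)). f x) =
      (\<Sum>x\<in>set_mset (proots P). pmf (pmf_of_multiset (proots P)) x *\<^sub>R f x)"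
    by (rule integral_measure_pmf) (use ne in auto)
  also have "\<dots> = (\<Sum>x\<in>set_mset (proots P). real (count (proots P) x) * f x) / degree P"
    using ne by (simp add: size_proots_complex sum_divide_distrib del: set_count_proots)
  also have "(\<Sum>x\<in>set_mset (proots P). real (count (proots P) x) * f x) = (\<Sum>x\<in>#proots P. f x)"
    by (simp only: sum_mset_image_eq_sum_count)
  finally show ?thesis .
qed

lemma norm_sum_mset_le:
  fixes f :: "complex \<Rightarrow> 'a::real_normed_vector"
  assumes "\<And>x. x \<in># A \<Longrightarrow> norm (f x) \<le> c"
  shows "norm (\<Sum>x\<in>#A. f x) \<le> real (size A) * c"
  using assms
proof (induction A)
  case (add b A)
  have "norm (f b + (\<Sum>x\<in>#A. f x)) \<le> c + real (size A) * c"
    using add by (intro norm_triangle_mono) auto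
  then show ?case by (simp add: algebra_simps)
qed simp

lemma of_real_sum_mset: "of_real (\<Sum>x\<in>#A. f x) = (\<Sum>x\<in>#A. (of_real (f x) :: complex))"
  by (induction A) simp_all

lemma sum_mset_distrib_sum: "(\<Sum>x\<in>#A. \<Sum>i\<in>I. f i x) = (\<Sum>i\<in>I. \<Sum>x\<in>#A. (f i x :: real))"
  by (induction A) (simp_all add: sum.distrib)

lemma sum_mset_diff: "(\<Sum>x\<in>#A. f x - g x) = (\<Sum>x\<in>#A. f x) - (\<Sum>x\<in>#A. (g x :: real))"
  by (induction A) simp_all

text \<open>The zeros are real and lie in a fixed interval, so Weierstrass approximation turns
  convergent moments into convergent averages of every continuous function. Tightness is used only
  to find a measure that represents these limits: it does so along a subsequence, and the whole
  sequence has the same limits.\<close>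

lemma zero_counting_measures_converge:
  fixes P :: "nat \<Rightarrow> complex poly"
  assumes lc: "\<And>n. lead_coeff (P n) = 1" and deg: "\<And>n. degree (P n) = n"
    and rr: "\<And>n. n \<ge> 1 \<Longrightarrow> real_rooted (P n)"
    and M: "\<And>n z. n \<ge> 1 \<Longrightarrow> poly (P n) z = 0 \<Longrightarrow> cmod z \<le> M"
    and conv: "\<And>k. convergent (\<lambda>n. psum k (P n) / of_nat n)"
  shows "\<exists>\<nu> :: complex measure. prob_space \<nu> \<and> sets \<nu> = sets borel \<and> measure_support \<nu> \<subseteq> \<real> \<and>
    converges_weakly (\<lambda>n. zero_counting_measure (P n)) \<nu>"
proof -
  have nz: "P n \<noteq> 0" for n using lc[of n] by auto
  have size: "size (proots (P n)) = n" for n using size_proots_complex[of "P n"] deg by simp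
  have root_real: "complex_of_real (Re x) = x" if "n \<ge> 1" "x \<in># proots (P n)" for n x
    using rr[of n] that nz[of n] by (auto simp: real_rooted_def complex_eq_iff)
  have root_le: "Re x \<in> {-M..M}" if "n \<ge> 1" "x \<in># proots (P n)" for n x
    using M[of n x] that nz[of n] abs_Re_le_cmod[of x] by auto
  define E where "E = (\<lambda>n (f :: real \<Rightarrow> real). (\<Sum>x\<in>#proots (P n). f (Re x)) / real n)"
  define X where "X = (\<lambda>n. pmf_of_multiset (proots (P n)))"
  have intX: "(LINT x|measure_pmf (X n). f x) = (\<Sum>x\<in>#proots (P n). f x) / real n" if "n \<ge> 1" for n and f :: "complex \<Rightarrow> real"
    using integral_pmf_proots[of "P n" f] that by (simp add: X_def deg)
  have Epow: "convergent (\<lambda>n. E n (\<lambda>x. x ^ k))" for k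
  proof -
    have "E n (\<lambda>x. x ^ k) = Re (psum k (P n) / of_nat n)" for n
    proof (cases "n \<ge> 1")
      case True
      have "psum k (P n) = (\<Sum>x\<in>#proots (P n). complex_of_real (Re x ^ k))"
        unfolding psum_def
        by (intro arg_cong[of _ _ sum_mset] image_mset_cong) (metis True root_real of_real_power)
      also have "\<dots> = complex_of_real (\<Sum>x\<in>#proots (P n). Re x ^ k)"
        by (simp only: of_real_sum_mset)
      finally show ?thesis by (simp add: E_def)
    qed (simp add: E_def)
    moreover obtain L where L: "(\<lambda>n. psum k (P n) / of_nat n) \<longlonglongrightarrow> L"
      using conv[of k] convergent_def by blast
    have "convergent (\<lambda>n. Re (psum k (P n) / of_nat n))"
      using convergentI[OF tendsto_Re[OF L]] .
    ultimately show ?thesis by simp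
  qed
  have Epoly: "convergent (\<lambda>n. E n (\<lambda>x. \<Sum>i\<le>m. a i * x ^ i))" for a :: "nat \<Rightarrow> real" and m
  proof -
    have "E n (\<lambda>x. \<Sum>i\<le>m. a i * x ^ i) = (\<Sum>i\<le>m. a i * E n (\<lambda>x. x ^ i))" for n
      by (simp add: E_def sum_mset_distrib_sum sum_divide_distrib sum_mset_distrib_left)
    then show ?thesis by (simp add: convergent_sum convergent_mult convergent_const Epow)
  qed
  have Econv: "convergent (\<lambda>n. E n f)" if f: "continuous_on UNIV f" for f
  proof -
    have "Cauchy (\<lambda>n. E n f)"
    proof (rule metric_CauchyI)
      fix \<epsilon> :: real assume eps: "\<epsilon> > 0"
      obtain g where g: "real_polynomial_function g" "\<And>x. x \<in> {-M..M} \<Longrightarrow> \<bar>f x - g x\<bar> < \<epsilon> / 4"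
        using Stone_Weierstrass_real_polynomial_function[of "{-M..M}" f "\<epsilon> / 4"] eps f
          continuous_on_subset[OF f] by auto
      obtain a m where am: "g = (\<lambda>x. \<Sum>i\<le>m. a i * x ^ i)"
        using g(1) unfolding real_polynomial_function_iff_sum by auto
      have "Cauchy (\<lambda>n. E n g)" using Epoly[of a m] by (simp add: am convergent_Cauchy)
      then obtain N where N: "\<forall>m\<ge>N. \<forall>n\<ge>N. dist (E m g) (E n g) < \<epsilon> / 2"
        using eps unfolding Cauchy_def by (meson half_gt_zero)
      have fg: "\<bar>E n f - E n g\<bar> \<le> \<epsilon> / 4" if n: "n \<ge> 1" for n
      proof -
        have "norm (\<Sum>x\<in>#proots (P n). f (Re x) - g (Re x)) \<le> real (size (proots (P n))) * (\<epsilon> / 4)"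
          using g(2) root_le[OF n] by (intro norm_sum_mset_le) (auto simp: less_imp_le)
        then have "\<bar>\<Sum>x\<in>#proots (P n). f (Re x) - g (Re x)\<bar> \<le> real n * (\<epsilon> / 4)"
          unfolding size by simp
        moreover have "E n f - E n g = (\<Sum>x\<in>#proots (P n). f (Re x) - g (Re x)) / real n"
          by (simp add: E_def sum_mset_diff diff_divide_distrib)
        ultimately show ?thesis using n by (simp add: abs_divide pos_divide_le_eq mult.commute)
      qed
      have "dist (E m f) (E n f) < \<epsilon>" if "m \<ge> max 1 N" "n \<ge> max 1 N" for m n
      proof -
        have "\<bar>E m f - E m g\<bar> \<le> \<epsilon> / 4" "\<bar>E n f - E n g\<bar> \<le> \<epsilon> / 4" "\<bar>E m g - E n g\<bar> < \<epsilon> / 2"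
          using fg that N[rule_format, of m n] by (auto simp: dist_real_def)
        then show ?thesis using eps unfolding dist_real_def by linarith
      qed
      then show "\<exists>N. \<forall>m\<ge>N. \<forall>n\<ge>N. dist (E m f) (E n f) < \<epsilon>" by blast
    qed
    then show ?thesis by (simp add: Cauchy_convergent_iff)
  qed
  \<comment> \<open>Shifted by one because a polynomial of degree 0 has no zeros to
    distribute.\<close>
  define \<mu> where "\<mu> = (\<lambda>n. distr (measure_pmf (X (Suc n))) borel Re)"
  have rd: "real_distribution (\<mu> n)" for n
    unfolding \<mu>_def real_distribution_def real_distribution_axioms_def
    by (simp add: prob_space.prob_space_distr measure_pmf.prob_space_axioms)
  have int\<mu>: "(LINT x|\<mu> n. f x) = E (Suc n) f" if "continuous_on UNIV f" for n f
  proof -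
    have "f \<in> borel_measurable borel" using that by (rule borel_measurable_continuous_onI)
    then have "(LINT x|\<mu> n. f x) = (LINT x|measure_pmf (X (Suc n)). f (Re x))"
      unfolding \<mu>_def by (subst integral_distr) auto
    then show ?thesis by (simp add: intX E_def)
  qed
  have "tight \<mu>"
    unfolding tight_def
  proof (intro conjI allI impI rd)
    fix \<epsilon> :: real assume "\<epsilon> > 0"
    \<comment> \<open>The margin 1 puts [-M, M] inside a half-open interval of positive length,
      whatever the sign of \<open>M\<close>.\<close>
    have "measure (\<mu> n) {- \<bar>M\<bar> - 1<..\<bar>M\<bar> + 1} = 1" for n
    proof -
      have ne: "proots (P (Suc n)) \<noteq> {#}" using size[of "Suc n"] by auto
      have "measure (\<mu> n) {- \<bar>M\<bar> - 1<..\<bar>M\<bar> + 1} = measure (measure_pmf (X (Suc n))) (Re -` {- \<bar>M\<bar> - 1<..\<bar>M\<bar> + 1})"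
        unfolding \<mu>_def by (subst measure_distr) auto
      also have "\<dots> = 1"
      proof (rule measure_pmf.prob_eq_1[THEN iffD2])
        show "AE x in measure_pmf (X (Suc n)). x \<in> Re -` {- \<bar>M\<bar> - 1<..\<bar>M\<bar> + 1}"
          using root_le[of "Suc n"] ne unfolding X_def by (fastforce simp: AE_measure_pmf_iff simp del: set_count_proots)
      qed simp
      finally show ?thesis .
    qed
    then show "\<exists>a b. a < b \<and> (\<forall>n. 1 - \<epsilon> < measure (\<mu> n) {a<..b})"
      using \<open>\<epsilon> > 0\<close> by (intro exI[of _ "- \<bar>M\<bar> - 1"] exI[of _ "\<bar>M\<bar> + 1"]) auto
  qed
  then obtain r N where r: "strict_mono r" and N: "real_distribution N" "weak_conv_m (\<mu> \<circ> id \<circ> r) N"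
    using tight_imp_convergent_subsubsequence[of \<mu> id] strict_mono_id by blast
  interpret N: real_distribution N by fact
  have lim: "(\<lambda>n. E n f) \<longlonglongrightarrow> (LINT x|N. f x)"
    if f: "continuous_on UNIV f" and b: "\<And>x. \<bar>f x\<bar> \<le> b" for f b
  proof -
    have "(\<lambda>n. integral\<^sup>L ((\<mu> \<circ> id \<circ> r) n) f) \<longlonglongrightarrow> integral\<^sup>L N f"
      using weak_conv_imp_integral_bdd_continuous_conv[of "\<mu> \<circ> id \<circ> r" N f b] rd N f b
      by (auto simp: continuous_on_eq_continuous_at comp_def)
    then have 1: "(\<lambda>n. E (Suc (r n)) f) \<longlonglongrightarrow> integral\<^sup>L N f"
      by (simp add: int\<mu>[OF f])
    obtain l where l: "(\<lambda>n. E n f) \<longlonglongrightarrow> l" using Econv[OF f] convergent_def by blast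
    have "strict_mono (\<lambda>n. Suc (r n))" using r by (simp add: strict_mono_def)
    then have "(\<lambda>n. E (Suc (r n)) f) \<longlonglongrightarrow> l"
      using LIMSEQ_subseq_LIMSEQ[OF l] by (simp add: comp_def)
    then show ?thesis using 1 l LIMSEQ_unique by blast
  qed
  define \<nu> where "\<nu> = distr N borel complex_of_real"
  have "prob_space \<nu>" unfolding \<nu>_def by (intro N.prob_space_distr) simp
  moreover have "sets \<nu> = sets borel" by (simp add: \<nu>_def)
  moreover have "measure_support \<nu> \<subseteq> \<real>"
  proof
    fix x assume x: "x \<in> measure_support \<nu>"
    show "x \<in> \<real>"
    proof (rule ccontr)
      assume "x \<notin> \<real>"
      moreover have "open (- \<real> :: complex set)" by (simp add: closed_complex_Reals open_Compl)
      ultimately have "emeasure \<nu> (- \<real>) > 0" using x by (auto simp: measure_support_def)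
      moreover have "emeasure \<nu> (- \<real>) = emeasure N (complex_of_real -` (- \<real>) \<inter> space N)"
        unfolding \<nu>_def by (rule emeasure_distr) (auto simp: closed_complex_Reals)
      moreover have "complex_of_real -` (- \<real>) \<inter> space N = {}" by auto
      ultimately show False by simp
    qed
  qed
  moreover have "converges_weakly (\<lambda>n. zero_counting_measure (P n)) \<nu>"
    unfolding converges_weakly_def
  proof (intro allI impI)
    fix f :: "complex \<Rightarrow> real" assume f: "continuous_on UNIV f" "bounded (range f)"
    then obtain b where b: "\<And>x. \<bar>f x\<bar> \<le> b" unfolding bounded_iff by auto
    have fm: "f \<in> borel_measurable borel" using f(1) by (rule borel_measurable_continuous_onI)
    have fr: "continuous_on UNIV (\<lambda>x. f (complex_of_real x))"
      using continuous_on_compose2[OF f(1)] by (intro continuous_intros continuous_on_compose2[OF f(1)]) auto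
    have "(LINT x|\<nu>. f x) = (LINT x|N. f (complex_of_real x))"
      unfolding \<nu>_def using fm by (subst integral_distr) auto
    moreover have "(LINT x|zero_counting_measure (P n). f x) = E n (\<lambda>x. f (complex_of_real x))" if "n \<ge> 1" for n
    proof -
      have "(LINT x|zero_counting_measure (P n). f x) = (LINT x|measure_pmf (X n). f x)"
        unfolding X_def using that fm by (subst zero_counting_measure_eq_distr) (auto simp: deg integral_distr)
      also have "\<dots> = (\<Sum>x\<in>#proots (P n). f x) / real n" by (rule intX[OF that])
      also have "(\<Sum>x\<in>#proots (P n). f x) = (\<Sum>x\<in>#proots (P n). f (complex_of_real (Re x)))"
        by (intro arg_cong[of _ _ sum_mset] image_mset_cong) (simp only: root_real[OF that])
      finally show ?thesis by (simp add: E_def)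
    qed
    then have "\<forall>\<^sub>F n in sequentially. E n (\<lambda>x. f (complex_of_real x)) = (LINT x|zero_counting_measure (P n). f x)"
      by (auto simp: eventually_sequentially intro!: exI[of _ 1])
    ultimately show "(\<lambda>n. LINT x|zero_counting_measure (P n). f x) \<longlonglongrightarrow> (LINT x|\<nu>. f x)"
      using Lim_transform_eventually[OF lim[OF fr b]] by simp
  qed
  ultimately show ?thesis by blast
qed

section \<open>Convergence in the loop equation\<close>

text \<open>Since \<open>e n\<close> enters as an additive constant, the discriminants belonging to
  two indices differ by a constant in \<open>x\<close>, up to small errors. The bounds
  \<open>g0\<close> and \<open>g1\<close> are what positivity of the zero measure provides.\<close>

lemma loop_equation_convergent:
  fixes g :: "nat \<Rightarrow> real \<Rightarrow> real" and e :: "nat \<Rightarrow> real" and A B K :: real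
  assumes A: "A > 0" and K: "K \<ge> 0"
    and cont: "\<And>n. n \<ge> 1 \<Longrightarrow> continuous_on {0<..} (g n)"
    and g0: "\<And>n x. n \<ge> 1 \<Longrightarrow> x > 0 \<Longrightarrow> 0 \<le> g n x"
    and g1: "\<And>n x. n \<ge> 1 \<Longrightarrow> x > 0 \<Longrightarrow> x * g n x \<le> 1"
    and eq: "\<And>n x. n \<ge> 1 \<Longrightarrow> x > 0 \<Longrightarrow>
      \<bar>(g n x)\<^sup>2 - x * (A * x\<^sup>2 - B) * g n x + A * x\<^sup>2 - e n\<bar> \<le> K * (1 + 1 / x\<^sup>2) / n"
  shows "\<exists>X. \<forall>x\<ge>X. convergent (\<lambda>n. g n x)"
proof -
  define u where "u = (\<lambda>x. x * (A * x\<^sup>2 - B))"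
  define err where "err = (\<lambda>n x. (g n x)\<^sup>2 - u x * g n x + A * x\<^sup>2 - e n)"
  have errb: "\<bar>err n x\<bar> \<le> K * (1 + 1 / x\<^sup>2) / n" if "n \<ge> 1" "x > 0" for n x
    using eq[OF that] by (simp add: err_def u_def)
  have sq: "(u x - 2 * g n x)\<^sup>2 = (u x)\<^sup>2 - 4 * A * x\<^sup>2 + 4 * e n + 4 * err n x" for n x
    by (simp add: err_def power2_eq_square algebra_simps)
  \<comment> \<open>Beyond \<open>x1\<close> one has A x^2 - B >= 2, so u x >= 2 x >= 2, while g <=
    1 by \<open>g1\<close>: there the smaller root of the quadratic is taken.\<close>
  define x1 where "x1 = 1 + (\<bar>B\<bar> + 2) / A"
  have x1: "x1 \<ge> 1" using A by (simp add: x1_def)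
  have ux: "u x \<ge> 2 * g n x" if "x \<ge> x1" "n \<ge> 1" for x n
  proof -
    have x: "x \<ge> 1" using that x1 by simp
    have "A * x1 \<le> A * x\<^sup>2"
      using A that x self_le_power[of x 2] by (intro mult_left_mono) auto
    moreover have "A * x1 = A + (\<bar>B\<bar> + 2)" using A by (simp add: x1_def field_simps)
    ultimately have "A * x\<^sup>2 - B \<ge> 2" using A by linarith
    then have "x * 2 \<le> u x" unfolding u_def using x by (intro mult_left_mono) auto
    moreover have "1 * g n x \<le> x * g n x" using g0[of n x] x that by (intro mult_right_mono) auto
    ultimately show ?thesis using g1[of n x] x that by linarith
  qed
  have key: "\<exists>M\<ge>1. \<forall>n\<ge>M. \<forall>m\<ge>M. e m \<le> e n + \<epsilon>" if eps: "\<epsilon> > 0" for \<epsilon> :: real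
  proof -
    define c where "c = A + \<bar>B\<bar>"
    have c: "c > 0" using A by (simp add: c_def)
    \<comment> \<open>Chosen to give |u x0| <= sqrt \<epsilon>. It is fixed before the index
      \<open>M\<close> because the error bound blows up at 0.\<close>
    define x0 where "x0 = min 1 (sqrt \<epsilon> / c)"
    have x0: "x0 > 0" "x0 \<le> 1" "x0 \<le> sqrt \<epsilon> / c" using eps c by (auto simp: x0_def)
    have u0: "(u x0)\<^sup>2 \<le> \<epsilon>"
    proof -
      have "x0\<^sup>2 \<le> 1" using x0 by (simp add: power_le_one)
      then have "A * x0\<^sup>2 \<le> A * 1" using A by (intro mult_left_mono) auto
      moreover have "0 \<le> A * x0\<^sup>2" using A by simp
      ultimately have "\<bar>A * x0\<^sup>2 - B\<bar> \<le> c" unfolding c_def by linarith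
      then have "\<bar>u x0\<bar> \<le> x0 * c" unfolding u_def abs_mult using x0 by (intro mult_mono) auto
      also have "\<dots> \<le> sqrt \<epsilon>" using x0 c by (simp add: pos_le_divide_eq)
      finally have "\<bar>u x0\<bar>\<^sup>2 \<le> (sqrt \<epsilon>)\<^sup>2" by (intro power_mono) auto
      then show ?thesis using eps by simp
    qed
    obtain M :: nat where M: "real M > 8 * (K * (1 + 1 / x0\<^sup>2)) / \<epsilon>"
      using reals_Archimedean2 by blast
    have small: "\<bar>err n x\<bar> \<le> \<epsilon> / 8" if "n \<ge> max 1 M" "x \<ge> x0" for n x
    proof -
      have n: "n \<ge> 1" "real n \<ge> real M" using that by auto
      have "x0\<^sup>2 \<le> x\<^sup>2" using that x0 by (intro power_mono) auto
      then have "1 / x\<^sup>2 \<le> 1 / x0\<^sup>2" using x0 \<open>x \<ge> x0\<close> by (intro divide_left_mono mult_pos_pos zero_less_power) auto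
      then have "K * (1 + 1 / x\<^sup>2) \<le> K * (1 + 1 / x0\<^sup>2)" using K by (intro mult_left_mono) auto
      also have "\<dots> \<le> \<epsilon> / 8 * real n"
      proof -
        have "8 * (K * (1 + 1 / x0\<^sup>2)) \<le> real M * \<epsilon>"
          using M eps by (simp add: pos_divide_less_eq less_imp_le)
        also have "\<dots> \<le> real n * \<epsilon>" using n eps by (intro mult_right_mono) auto
        finally show ?thesis by (simp add: mult.commute)
      qed
      finally have "K * (1 + 1 / x\<^sup>2) / n \<le> \<epsilon> / 8"
        using n by (simp add: pos_divide_le_eq)
      moreover have "x > 0" using that x0 by simp
      ultimately show ?thesis using errb[of n x] n by linarith
    qed
    have "e m \<le> e n + \<epsilon>" if nm: "n \<ge> max 1 M" "m \<ge> max 1 M" for n m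
    proof (rule ccontr)
      assume "\<not> e m \<le> e n + \<epsilon>"
      then have em: "e m > e n + \<epsilon>" by simp
      \<comment> \<open>The discriminant for \<open>n\<close> is a square; passing to
        \<open>m\<close> adds more than 4 \<epsilon>, and the two errors cost at most 4 *
        (\<epsilon> / 8) each.\<close>
      have disc: "(u x - 2 * g m x)\<^sup>2 > 3 * \<epsilon>" if "x \<ge> x0" for x
      proof -
        have "0 \<le> (u x)\<^sup>2 - 4 * A * x\<^sup>2 + 4 * e n + 4 * err n x"
          unfolding sq[symmetric] by simp
        then show ?thesis
          unfolding sq using small[OF nm(1) that] small[OF nm(2) that] em by linarith
      qed
      \<comment> \<open>Because g >= 0, a nonnegative value could not exceed u x0, and its square
        would be at most \<epsilon>. So the larger root is taken at \<open>x0\<close> and the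
        smaller one at \<open>x1\<close>, and the discriminant would have to vanish in
        between.\<close>
      have "u x0 - 2 * g m x0 < 0"
      proof (rule ccontr)
        assume "\<not> u x0 - 2 * g m x0 < 0"
        moreover have "g m x0 \<ge> 0" using g0[of m x0] nm x0 by auto
        ultimately have "(u x0 - 2 * g m x0)\<^sup>2 \<le> (u x0)\<^sup>2" by (intro power_mono) auto
        then show False using disc[of x0] u0 eps by linarith
      qed
      moreover have "u x1 - 2 * g m x1 \<ge> 0" using ux[of x1 m] nm by auto
      moreover have "continuous_on {x0..x1} (\<lambda>x. u x - 2 * g m x)"
        unfolding u_def using cont[of m] nm x0
        by (intro continuous_intros continuous_on_subset[OF cont[of m]]) auto
      ultimately obtain x where "x0 \<le> x" "u x - 2 * g m x = 0"
        using IVT'[of "\<lambda>x. u x - 2 * g m x" x0 0 x1] x0 x1 by force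
      then show False using disc[of x] eps by simp
    qed
    then show ?thesis by (intro exI[of _ "max 1 M"]) auto
  qed
  have "Cauchy e"
  proof (rule metric_CauchyI)
    fix \<epsilon> :: real assume "\<epsilon> > 0"
    then have half: "\<epsilon> / 2 < \<epsilon>" by simp
    obtain M where "\<forall>n\<ge>M. \<forall>m\<ge>M. e m \<le> e n + \<epsilon> / 2" using key[of "\<epsilon> / 2"] \<open>\<epsilon> > 0\<close> by auto
    then have "\<forall>m\<ge>M. \<forall>n\<ge>M. dist (e m) (e n) \<le> \<epsilon> / 2"
      unfolding dist_real_def abs_le_iff by (metis add.commute diff_le_eq minus_diff_eq)
    then show "\<exists>M. \<forall>m\<ge>M. \<forall>n\<ge>M. dist (e m) (e n) < \<epsilon>"
      by (meson le_less_trans half)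
  qed
  then obtain l where l: "e \<longlonglongrightarrow> l" using real_Cauchy_convergent convergent_def by blast
  \<comment> \<open>Here the branch is known, so \<open>g\<close> is an explicit continuous function
    of \<open>e n\<close> and the error.\<close>
  have "convergent (\<lambda>n. g n x)" if "x \<ge> x1" for x
  proof -
    have x: "x > 0" using that x1 by simp
    have "(\<lambda>n. err n x) \<longlonglongrightarrow> 0"
    proof (rule tendsto_rabs_zero_cancel, rule tendsto_sandwich[OF _ _ tendsto_const])
      show "(\<lambda>n. K * (1 + 1 / x\<^sup>2) / real n) \<longlonglongrightarrow> 0"
        by (intro tendsto_divide_0[OF tendsto_const] tendsto_of_nat filterlim_real_at_infinity_sequentially)
      show "\<forall>\<^sub>F n in sequentially. \<bar>err n x\<bar> \<le> K * (1 + 1 / x\<^sup>2) / real n"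
        using errb x by (auto simp: eventually_sequentially)
    qed auto
    then have "(\<lambda>n. (u x - sqrt ((u x)\<^sup>2 - 4 * A * x\<^sup>2 + 4 * e n + 4 * err n x)) / 2) \<longlonglongrightarrow>
        (u x - sqrt ((u x)\<^sup>2 - 4 * A * x\<^sup>2 + 4 * l + 4 * 0)) / 2"
      by (intro tendsto_intros l) auto
    moreover have "(u x - sqrt ((u x)\<^sup>2 - 4 * A * x\<^sup>2 + 4 * e n + 4 * err n x)) / 2 = g n x" if "n \<ge> 1" for n
      unfolding sq[symmetric] using ux[OF \<open>x \<ge> x1\<close> that] by simp
    then have "\<forall>\<^sub>F n in sequentially. (u x - sqrt ((u x)\<^sup>2 - 4 * A * x\<^sup>2 + 4 * e n + 4 * err n x)) / 2 = g n x"
      by (auto simp: eventually_sequentially)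
    ultimately have "(\<lambda>n. g n x) \<longlonglongrightarrow> (u x - sqrt ((u x)\<^sup>2 - 4 * A * x\<^sup>2 + 4 * l + 4 * 0)) / 2"
      by (rule Lim_transform_eventually)
    then show ?thesis by (rule convergentI)
  qed
  then show ?thesis by blast
qed

text \<open>The remainder after the constant term is dominated by a geometric series of ratio at
  most 1/2. Its bound involves only \<open>C\<close> and \<open>R\<close>, so it will be uniform
  over a family of series.\<close>

lemma power_series_shift:
  fixes a :: "nat \<Rightarrow> complex"
  assumes R: "R > 0" and bound: "\<And>k. cmod (a k) \<le> C * R ^ k" and x: "0 < x" "R * x \<le> 1 / 2"
  shows "(\<Sum>k. a k * of_real x ^ k) = a 0 + of_real x * (\<Sum>k. a (Suc k) * of_real x ^ k)"
    and "cmod (\<Sum>k. a (Suc k) * of_real x ^ k) \<le> 2 * C * R"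
proof -
  have C: "C \<ge> 0" using order.trans[OF norm_ge_zero bound[of 0]] by simp
  have geo: "summable (\<lambda>k. D * (R * x) ^ k)" "(\<Sum>k. D * (R * x) ^ k) = D * (1 / (1 - R * x))" for D
    using R x by (auto simp: suminf_mult suminf_geometric summable_geometric intro!: summable_mult)
  have le: "cmod (a k * of_real x ^ k) \<le> C * (R * x) ^ k" for k
    using mult_right_mono[OF bound[of k], of "x ^ k"] x
    by (simp add: norm_mult norm_power power_mult_distrib mult.assoc)
  have s: "summable (\<lambda>k. a k * of_real x ^ k)"
    by (rule summable_comparison_test'[OF geo(1)[of C], of 0]) (use le in auto)
  have le': "cmod (a (Suc k) * of_real x ^ k) \<le> C * R * (R * x) ^ k" for k
    using mult_right_mono[OF bound[of "Suc k"], of "x ^ k"] x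
    by (simp add: norm_mult norm_power power_mult_distrib mult_ac)
  have s': "summable (\<lambda>k. cmod (a (Suc k) * of_real x ^ k))"
    by (rule summable_comparison_test'[OF geo(1)[of "C * R"], of 0]) (use le' in auto)
  have "(\<Sum>k. a k * of_real x ^ k) = a 0 + (\<Sum>k. a (Suc k) * of_real x ^ Suc k)"
    using suminf_split_head[OF s] by simp
  also have "(\<Sum>k. a (Suc k) * of_real x ^ Suc k) = (\<Sum>k. of_real x * (a (Suc k) * of_real x ^ k))"
    by (simp add: mult_ac)
  also have "\<dots> = of_real x * (\<Sum>k. a (Suc k) * of_real x ^ k)"
    by (rule suminf_mult[OF summable_norm_cancel[OF s']])
  finally show "(\<Sum>k. a k * of_real x ^ k) = a 0 + of_real x * (\<Sum>k. a (Suc k) * of_real x ^ k)" .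
  have "cmod (\<Sum>k. a (Suc k) * of_real x ^ k) \<le> (\<Sum>k. cmod (a (Suc k) * of_real x ^ k))"
    by (rule summable_norm[OF s'])
  also have "\<dots> \<le> (\<Sum>k. C * R * (R * x) ^ k)"
    by (rule suminf_le[OF le' s' geo(1)])
  also have "\<dots> = C * R * (1 / (1 - R * x))" by (rule geo(2))
  also have "\<dots> \<le> C * R * 2"
    using x R C by (intro mult_left_mono) (auto simp: divide_simps)
  finally show "cmod (\<Sum>k. a (Suc k) * of_real x ^ k) \<le> 2 * C * R" by simp
qed

text \<open>The value at x differs from the constant term by at most a fixed multiple of x,
  uniformly in \<open>n\<close>; a small x makes the constant terms Cauchy.\<close>

lemma convergent_power_series_constant_term:
  fixes a :: "nat \<Rightarrow> nat \<Rightarrow> complex"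
  assumes R: "R > 0" and bound: "\<And>n k. cmod (a n k) \<le> C * R ^ k"
    and d: "0 < \<delta>" "R * \<delta> \<le> 1 / 2"
    and conv: "\<And>x::real. 0 < x \<Longrightarrow> x < \<delta> \<Longrightarrow> convergent (\<lambda>n. \<Sum>k. a n k * of_real x ^ k)"
  shows "convergent (\<lambda>n. a n 0)"
proof -
  have C: "C \<ge> 0" using order.trans[OF norm_ge_zero bound[of 0 0]] by simp
  have "Cauchy (\<lambda>n. a n 0)"
  proof (rule metric_CauchyI)
    fix \<epsilon> :: real assume eps: "\<epsilon> > 0"
    define c where "c = 2 * C * R + 1"
    have c: "c > 0" using C R by (simp add: c_def add_nonneg_pos)
    define x where "x = min (\<delta> / 2) (\<epsilon> / (4 * c))"
    have x: "0 < x" "x < \<delta>" "x \<le> \<epsilon> / (4 * c)" using d eps c by (auto simp: x_def)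
    have "R * x \<le> R * \<delta>" using R x by (intro mult_left_mono) auto
    then have Rx: "R * x \<le> 1 / 2" using d by simp
    define f where "f = (\<lambda>n. \<Sum>k. a n k * complex_of_real x ^ k)"
    have dist: "cmod (f n - a n 0) \<le> \<epsilon> / 4" for n
    proof -
      let ?h = "\<Sum>k. a n (Suc k) * complex_of_real x ^ k"
      have "cmod (f n - a n 0) = x * cmod ?h"
        using power_series_shift(1)[of R "a n" C x, OF R bound x(1) Rx] x by (simp add: f_def norm_mult)
      also have "\<dots> \<le> x * c"
        using power_series_shift(2)[of R "a n" C x, OF R bound x(1) Rx] x by (intro mult_left_mono) (auto simp: c_def)
      also have "\<dots> \<le> \<epsilon> / 4" using x(3) c by (simp add: field_simps)
      finally show ?thesis .
    qed
    have "Cauchy f" using conv[OF x(1,2)] by (simp add: f_def convergent_Cauchy)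
    then obtain M where M: "\<forall>m\<ge>M. \<forall>n\<ge>M. dist (f m) (f n) < \<epsilon> / 2"
      using eps unfolding Cauchy_def by (meson half_gt_zero)
    have "dist (a m 0) (a n 0) < \<epsilon>" if "m \<ge> M" "n \<ge> M" for m n
    proof -
      have "dist (a m 0) (a n 0) \<le> cmod (f m - a m 0) + cmod (f m - f n) + cmod (f n - a n 0)"
      proof -
        have "a m 0 - a n 0 = (f m - f n) + (f n - a n 0) - (f m - a m 0)" by simp
        then have "cmod (a m 0 - a n 0) \<le> cmod ((f m - f n) + (f n - a n 0)) + cmod (f m - a m 0)"
          using norm_triangle_ineq4[of "(f m - f n) + (f n - a n 0)" "f m - a m 0"] by simp
        moreover have "cmod ((f m - f n) + (f n - a n 0)) \<le> cmod (f m - f n) + cmod (f n - a n 0)"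
          by (rule norm_triangle_ineq)
        ultimately show ?thesis unfolding dist_norm by linarith
      qed
      then show ?thesis using dist[of m] dist[of n] M[rule_format, OF that] unfolding dist_norm by linarith
    qed
    then show "\<exists>M. \<forall>m\<ge>M. \<forall>n\<ge>M. dist (a m 0) (a n 0) < \<epsilon>" by blast
  qed
  then show ?thesis by (simp add: Cauchy_convergent_iff)
qed

text \<open>Subtract the constant term and divide by x. The shifted coefficients obey the same bound
  with C * R for C, which is why the induction generalizes over \<open>C\<close> while
  \<open>R\<close> and \<delta> stay fixed.\<close>

lemma convergent_power_series_coefficients:
  fixes a :: "nat \<Rightarrow> nat \<Rightarrow> complex"
  assumes R: "R > 0" and bound: "\<And>n k. cmod (a n k) \<le> C * R ^ k"
    and d: "0 < \<delta>" "R * \<delta> \<le> 1 / 2"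
    and conv: "\<And>x::real. 0 < x \<Longrightarrow> x < \<delta> \<Longrightarrow> convergent (\<lambda>n. \<Sum>k. a n k * of_real x ^ k)"
  shows "convergent (\<lambda>n. a n k)"
  using bound conv
proof (induction k arbitrary: a C)
  case (0 a C)
  show ?case by (rule convergent_power_series_constant_term[OF R 0(1) d 0(2)])
next
  case (Suc k a C)
  have b: "cmod (a n (Suc j)) \<le> C * R * R ^ j" for n j
    using Suc.prems(1)[of n "Suc j"] by (simp add: mult.assoc)
  have "convergent (\<lambda>n. \<Sum>k. a n (Suc k) * complex_of_real x ^ k)" if x: "0 < x" "x < \<delta>" for x
  proof -
    have "R * x \<le> R * \<delta>" using R x by (intro mult_left_mono) auto
    then have Rx: "R * x \<le> 1 / 2" using d by simp
    have "(\<Sum>k. a n (Suc k) * complex_of_real x ^ k) =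
        ((\<Sum>k. a n k * complex_of_real x ^ k) - a n 0) * (1 / complex_of_real x)" for n
      using power_series_shift(1)[of R "a n" C x, OF R Suc.prems(1) x(1) Rx] x by simp
    moreover have "convergent (\<lambda>n. ((\<Sum>k. a n k * complex_of_real x ^ k) - a n 0) * (1 / complex_of_real x))"
      using convergent_power_series_constant_term[OF R Suc.prems(1) d Suc.prems(2)] Suc.prems(2)[OF x]
      by (intro convergent_mult convergent_diff convergent_const)
    ultimately show ?thesis by simp
  qed
  from Suc.IH[OF b this] show ?case .
qed

section \<open>Orthogonality with respect to the quartic weight\<close>

lemma pderiv_pcompose_shift:
  "(pderiv ^^ j) (pcompose P [:m, 1:]) = pcompose ((pderiv ^^ j) P) [:m, 1:]"
  by (induction j) (simp_all add: pderiv_pcompose pderiv_pCons)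

lemma poly_higher_pderiv_eq_coeff_shift:
  fixes P :: "'a::field_char_0 poly"
  shows "poly ((pderiv ^^ j) P) m = fact j * coeff (pcompose P [:m, 1:]) j"
proof -
  have "poly ((pderiv ^^ j) P) m = coeff ((pderiv ^^ j) (pcompose P [:m, 1:])) 0"
    by (simp add: pderiv_pcompose_shift poly_0_coeff_0[symmetric] poly_pcompose)
  also have "\<dots> = fact j * coeff (pcompose P [:m, 1:]) j"
    by (simp add: coeff_higher_pderiv pochhammer_fact)
  finally show ?thesis .
qed

lemma normal_moment_complex:
  assumes "\<sigma> > 0"
  shows "has_bochner_integral lborel (\<lambda>x. complex_of_real (normal_density \<mu> \<sigma> x * (x - \<mu>) ^ j))
    (if even j then (complex_of_real (\<sigma>\<^sup>2 / 2)) ^ (j div 2) / fact (j div 2) * fact j else 0)"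
proof (cases "even j")
  case True
  then obtain k where k: "j = 2 * k" by blast
  have "has_bochner_integral lborel (\<lambda>x. complex_of_real (normal_density \<mu> \<sigma> x * (x - \<mu>) ^ (2 * k)))
      (complex_of_real (fact (2 * k) / ((2 / \<sigma>\<^sup>2) ^ k * fact k)))"
    by (rule has_bochner_integral_of_real[OF normal_moment_even[OF assms]])
  moreover have "fact (2 * k) / ((2 / \<sigma>\<^sup>2) ^ k * fact k) = (\<sigma>\<^sup>2 / 2) ^ k / fact k * (fact (2 * k) :: real)"
    using assms by (simp add: power_divide field_simps)
  ultimately show ?thesis by (simp add: k)
next
  case False
  then obtain k where k: "j = 2 * k + 1" using oddE by blast
  have "has_bochner_integral lborel (\<lambda>x. complex_of_real (normal_density \<mu> \<sigma> x * (x - \<mu>) ^ (2 * k + 1)))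
      (complex_of_real 0)"
    by (rule has_bochner_integral_of_real[OF normal_moment_odd[OF assms]])
  then show ?thesis by (simp add: k)
qed

text \<open>Taylor expansion at the mean: odd moments vanish, and the moment of order 2k is (2k)! /
  k! times (\<sigma>^2 / 2)^k, whose (2k)! is absorbed by the Taylor coefficient.\<close>

lemma gaussian_average_poly:
  fixes P :: "complex poly"
  assumes "\<sigma> > 0"
  shows "has_bochner_integral lborel
    (\<lambda>x. poly P (complex_of_real x) * complex_of_real (normal_density \<mu> \<sigma> x))
    (poly (heat (complex_of_real (\<sigma>\<^sup>2 / 2)) P) (complex_of_real \<mu>))"
proof -
  define a where "a = complex_of_real (\<sigma>\<^sup>2 / 2)"
  define R where "R = pcompose P [:complex_of_real \<mu>, 1:]"
  define d where "d = degree P"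
  have dR: "degree R = d" by (simp add: R_def d_def degree_pcompose)
  \<comment> \<open>The range is padded to \<open>2 * d\<close> so that its even indices are exactly
    twice the indices in \<open>heat\<close>.\<close>
  have P: "poly P (complex_of_real x) = (\<Sum>j\<le>2 * d. coeff R j * complex_of_real ((x - \<mu>) ^ j))" for x
  proof -
    have "poly P (complex_of_real x) = poly R (complex_of_real (x - \<mu>))"
      by (simp add: R_def poly_pcompose)
    also have "\<dots> = (\<Sum>j\<le>2 * d. coeff R j * complex_of_real ((x - \<mu>) ^ j))"
      unfolding poly_altdef dR of_real_power
      by (rule sum.mono_neutral_left) (auto simp: coeff_eq_0 dR)
    finally show ?thesis .
  qed
  let ?m = "\<lambda>j. if even j then a ^ (j div 2) / fact (j div 2) * fact j else 0"
  have "has_bochner_integral lborel (\<lambda>x. \<Sum>j\<le>2 * d. coeff R j * complex_of_real (normal_density \<mu> \<sigma> x * (x - \<mu>) ^ j))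
      (\<Sum>j\<le>2 * d. coeff R j * ?m j)"
    unfolding a_def
    by (intro has_bochner_integral_sum has_bochner_integral_mult_right normal_moment_complex assms)
  also have "(\<lambda>x. \<Sum>j\<le>2 * d. coeff R j * complex_of_real (normal_density \<mu> \<sigma> x * (x - \<mu>) ^ j)) =
      (\<lambda>x. poly P (complex_of_real x) * complex_of_real (normal_density \<mu> \<sigma> x))"
    unfolding P sum_distrib_right by (simp add: mult_ac)
  also have "(\<Sum>j\<le>2 * d. coeff R j * ?m j) = (\<Sum>j\<in>(*) 2 ` {..d}. coeff R j * ?m j)"
  proof (rule sum.mono_neutral_right)
    show "\<forall>i\<in>{..2 * d} - (*) 2 ` {..d}. coeff R i * ?m i = 0"
      by (auto elim!: evenE)
  qed auto
  also have "\<dots> = (\<Sum>k\<le>d. coeff R (2 * k) * ?m (2 * k))"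
    by (subst sum.reindex) (auto simp: inj_on_def)
  also have "\<dots> = poly (heat a P) (complex_of_real \<mu>)"
    by (simp add: heat_def poly_sum poly_higher_pderiv_eq_coeff_shift R_def d_def mult_ac)
  finally show ?thesis by (simp add: a_def)
qed

text \<open>Completing the square, x^2 / 2 - \<tau> x y = (x - \<tau> y)^2 / 2 - \<tau>^2 y^2 / 2: a
  Gaussian of variance 1 / n remains, and \<open>t\<close> becomes
  \<open>t - \<tau>^2\<close>.\<close>

lemma inner_integral_biorth:
  fixes P :: "complex poly"
  assumes n: "n \<ge> 1"
  shows "(LINT x|lborel. poly P (complex_of_real x) * w * complex_of_real (biorth_weight \<tau> t n x y)) =
    of_real (sqrt (2 * pi / n)) * (poly (heat (1 / (2 * of_nat n)) P) (complex_of_real (\<tau> * y)) * w *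
      of_real (exp (- (real n * (y ^ 4 / 4 + (t - \<tau>\<^sup>2) * y\<^sup>2 / 2)))))"
proof -
  define \<sigma> where "\<sigma> = 1 / sqrt (real n)"
  have s: "\<sigma> > 0" "\<sigma>\<^sup>2 = 1 / n" using n by (auto simp: \<sigma>_def power_divide)
  define E where "E = exp (- (real n * (y ^ 4 / 4 + (t - \<tau>\<^sup>2) * y\<^sup>2 / 2)))"
  have w: "biorth_weight \<tau> t n x y = sqrt (2 * pi / n) * E * normal_density (\<tau> * y) \<sigma> x" for x
  proof -
    have "biorth_weight \<tau> t n x y = E * exp (- (x - \<tau> * y)\<^sup>2 / (2 * \<sigma>\<^sup>2))"
      unfolding biorth_weight_def E_def exp_add[symmetric] s(2) using n
      by (intro arg_cong[of _ _ exp]) (simp add: field_simps power2_eq_square)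
    moreover have "sqrt (2 * pi / n) * normal_density (\<tau> * y) \<sigma> x = exp (- (x - \<tau> * y)\<^sup>2 / (2 * \<sigma>\<^sup>2))"
      using n by (simp add: normal_density_def s(2))
    ultimately show ?thesis by (simp add: mult_ac)
  qed
  have "(LINT x|lborel. poly P (complex_of_real x) * w * complex_of_real (biorth_weight \<tau> t n x y)) =
      (LINT x|lborel. (of_real (sqrt (2 * pi / n) * E) * w) *
        (poly P (complex_of_real x) * complex_of_real (normal_density (\<tau> * y) \<sigma> x)))"
    unfolding w by (intro Bochner_Integration.integral_cong) (simp_all add: mult_ac)
  also have "\<dots> = (of_real (sqrt (2 * pi / n) * E) * w) *
        poly (heat (complex_of_real (\<sigma>\<^sup>2 / 2)) P) (complex_of_real (\<tau> * y))"
    by (intro has_bochner_integral_integral_eq has_bochner_integral_mult_right gaussian_average_poly s)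
  also have "complex_of_real (\<sigma>\<^sup>2 / 2) = 1 / (2 * of_nat n)"
    by (simp add: s(2))
  finally show ?thesis by (simp add: E_def mult_ac)
qed

section \<open>Orthogonal polynomials of an abstract even quartic functional\<close>

lemma coeff_pcompose_uminus: "coeff (pcompose p [:0, - 1:]) j = (- 1) ^ j * coeff (p :: real poly) j"
proof (induction p arbitrary: j)
  case (pCons a p)
  then show ?case by (cases j) (simp_all add: pcompose_pCons)
qed simp

text \<open>\<Lambda> abstracts integration against exp (- V) with V' = a x^3 + b x. Coefficients
  are real so that \<open>pos\<close> is available: polynomial identities follow by showing that a
  difference is orthogonal to itself.\<close>

locale quartic_functional =
  fixes \<Lambda> :: "real poly \<Rightarrow> real" and a b :: real and R :: "nat \<Rightarrow> real poly"
  assumes add: "\<Lambda> (f + g) = \<Lambda> f + \<Lambda> g"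
    and smult: "\<Lambda> (smult c f) = c * \<Lambda> f"
    and pos: "f \<noteq> 0 \<Longrightarrow> \<Lambda> (f * f) > 0"
    and even: "\<Lambda> (pcompose f [:0, - 1:]) = \<Lambda> f"
    and ibp: "\<Lambda> (pderiv f) = \<Lambda> ([:0, b, 0, a:] * f)"
    and degree_R: "degree (R k) = k"
    and monic_R: "coeff (R k) k = 1"
    and orth: "degree f < k \<Longrightarrow> \<Lambda> (R k * f) = 0"
begin

lemma diff: "\<Lambda> (f - g) = \<Lambda> f - \<Lambda> g"
  using add[of f "smult (- 1) g"] smult[of "- 1" g] by simp

lemma zero [simp]: "\<Lambda> 0 = 0"
  using smult[of 0 0] by simp

lemma eq_0: "\<Lambda> (f * f) = 0 \<Longrightarrow> f = 0"
  using pos[of f] by auto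

lemma R_neq_0: "R k \<noteq> 0"
  using monic_R[of k] by auto

definition h :: "nat \<Rightarrow> real" where "h k = \<Lambda> (R k * R k)"

lemma h_pos: "h k > 0"
  unfolding h_def by (rule pos[OF R_neq_0])

lemma orth': "(\<And>j. j \<ge> k \<Longrightarrow> coeff f j = 0) \<Longrightarrow> \<Lambda> (R k * f) = 0"
proof (cases "f = 0")
  case False
  assume "\<And>j. j \<ge> k \<Longrightarrow> coeff f j = 0"
  then have "degree f < k" using False by (meson leading_coeff_0_iff not_le)
  then show ?thesis by (rule orth)
qed simp

lemma inner_lead:
  assumes "\<And>j. j > k \<Longrightarrow> coeff f j = 0"
  shows "\<Lambda> (R k * f) = coeff f k * h k"
proof -
  define g where "g = f - smult (coeff f k) (R k)"
  have "coeff g j = 0" if "j \<ge> k" for j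
    using assms[of j] that by (cases "j = k") (auto simp: g_def monic_R degree_R coeff_eq_0)
  then have "\<Lambda> (R k * g) = 0" by (rule orth')
  moreover have "R k * g = R k * f - smult (coeff f k) (R k * R k)"
    by (simp add: g_def algebra_simps)
  ultimately show ?thesis by (simp add: diff smult h_def)
qed

text \<open>The difference of the two sides has degree below \<open>k\<close> and, by evenness, is
  orthogonal to both of them, hence to itself.\<close>

lemma R_reflect: "pcompose (R k) [:0, - 1:] = smult ((- 1) ^ k) (R k)"
proof -
  let ?r = "\<lambda>p. pcompose p [:0, - 1 :: real:]"
  define d where "d = ?r (R k) - smult ((- 1) ^ k) (R k)"
  have d: "coeff d j = 0" if "j \<ge> k" for j
    using that by (cases "j = k") (auto simp: d_def coeff_pcompose_uminus monic_R degree_R coeff_eq_0)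
  have rr: "?r (?r p) = p" for p :: "real poly"
    by (rule poly_eqI) (simp add: coeff_pcompose_uminus flip: mult.assoc power_add)
  have "\<Lambda> (?r (R k) * d) = \<Lambda> (?r (?r (R k) * d))" by (rule even[symmetric])
  also have "?r (?r (R k) * d) = R k * ?r d" by (simp only: pcompose_mult rr)
  also have "\<Lambda> (R k * ?r d) = 0" by (rule orth') (simp add: coeff_pcompose_uminus d)
  finally have "\<Lambda> (?r (R k) * d) = 0" .
  moreover have "\<Lambda> (R k * d) = 0" by (rule orth'[OF d])
  moreover have "d * d = ?r (R k) * d - smult ((- 1) ^ k) (R k * d)"
    by (subst (1) d_def) (simp add: left_diff_distrib)
  ultimately have "\<Lambda> (d * d) = 0" by (simp add: diff smult)
  then have "d = 0" by (rule eq_0)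
  then show ?thesis by (simp add: d_def)
qed

lemma X_R_R: "\<Lambda> (R k * pCons 0 (R k)) = 0"
proof -
  define X where "X = R k * pCons 0 (R k)"
  have "smult ((- 1) ^ k) (smult ((- 1) ^ k) p) = p" for p :: "real poly"
    by (simp flip: power_add)
  then have "pcompose X [:0, - 1:] = smult (- 1) X"
    by (simp add: X_def pcompose_mult pcompose_pCons R_reflect)
  then have "\<Lambda> X = - 1 * \<Lambda> X"
    using even[of X] by (simp only: smult)
  then have "\<Lambda> X = 0" by linarith
  then show ?thesis by (simp only: X_def)
qed

text \<open>The value 0 at index 0 removes the term in which \<open>k - 1\<close> is truncated, so
  the recurrence holds from k = 0 on.\<close>

definition \<rho> :: "nat \<Rightarrow> real" where "\<rho> k = (if k = 0 then 0 else h k / h (k - 1))"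

lemma \<rho>_0: "\<rho> 0 = 0"
  by (simp add: \<rho>_def)

lemma \<rho>_pos: "k \<ge> 1 \<Longrightarrow> \<rho> k > 0"
  by (simp add: \<rho>_def h_pos)

lemma \<rho>_h: "\<rho> k * h (k - 1) = (if k = 0 then 0 else h k)"
  using h_pos[of "k - 1"] by (simp add: \<rho>_def)

lemma three_term: "pCons 0 (R k) = R (Suc k) + smult (\<rho> k) (R (k - 1))"
proof -
  define d where "d = pCons 0 (R k) - R (Suc k) - smult (\<rho> k) (R (k - 1))"
  have d: "coeff d j = 0" if "j > k" for j
    using that by (cases "j = Suc k") (auto simp: d_def coeff_pCons monic_R degree_R coeff_eq_0 split: nat.split)
  define g where "g = d - smult (coeff d k) (R k)"
  have g: "coeff g j = 0" if "j \<ge> k" for j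
    using d[of j] that by (cases "j = k") (auto simp: g_def monic_R degree_R coeff_eq_0)
  have 1: "\<Lambda> (R (Suc k) * d) = 0" by (rule orth') (simp add: d)
  have "pCons 0 (R k) * d = smult (coeff d k) (R k * pCons 0 (R k)) + R k * pCons 0 g"
    by (simp add: g_def algebra_simps smult_diff_right)
  moreover have "\<Lambda> (R k * pCons 0 g) = coeff (pCons 0 g) k * h k"
    by (rule inner_lead) (simp add: coeff_pCons g split: nat.split)
  ultimately have 2: "\<Lambda> (pCons 0 (R k) * d) = coeff (pCons 0 g) k * h k"
    by (simp only: add smult X_R_R mult_zero_right add_0)
  have 3: "\<rho> k * \<Lambda> (R (k - 1) * d) = coeff (pCons 0 g) k * h k"
  proof (cases k)
    case (Suc m)
    have "R m * d = smult (coeff d k) (R k * R m) + R m * g"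
      by (simp add: g_def algebra_simps)
    moreover have "\<Lambda> (R k * R m) = 0" by (rule orth) (simp add: degree_R Suc)
    moreover have "\<Lambda> (R m * g) = coeff g m * h m" by (rule inner_lead) (simp add: g Suc)
    ultimately have "\<Lambda> (R m * d) = coeff g m * h m" by (simp add: add smult)
    then show ?thesis using \<rho>_h[of k] Suc by (simp add: algebra_simps)
  qed (simp add: \<rho>_0)
  have "d * d = pCons 0 (R k) * d - R (Suc k) * d - smult (\<rho> k) (R (k - 1) * d)"
    by (subst (1) d_def) (simp only: left_diff_distrib mult_smult_left)
  then have "\<Lambda> (d * d) = 0" using 1 2 3 by (simp only: diff smult)
  then have "d = 0" by (rule eq_0)
  then show ?thesis by (simp add: d_def algebra_simps)
qed

lemma orth_R: "i \<noteq> j \<Longrightarrow> \<Lambda> (R i * R j) = 0"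
  using orth[of "R j" i] orth[of "R i" j] by (cases "j < i") (auto simp: degree_R mult.commute)

text \<open>\<Lambda> of the derivative of R_k R_(k-1) is computed twice: by leading coefficients it
  is k h_(k-1), and by \<open>ibp\<close> it is \<Lambda> (V' R_k R_(k-1)), which the recurrence
  expands.\<close>

lemma freud: "real k = \<rho> k * (a * (\<rho> (Suc k) + \<rho> k + \<rho> (k - 1)) + b)"
proof (cases k)
  case (Suc m)
  have R': "\<Lambda> (pderiv (R k) * R m) = real k * h m"
    using inner_lead[of m "pderiv (R k)"]
    by (simp add: coeff_pderiv monic_R degree_R coeff_eq_0 Suc mult.commute)
  have "\<Lambda> (R k * pderiv (R m)) = 0"
    by (rule orth') (simp add: coeff_pderiv degree_R coeff_eq_0 Suc)
  then have "\<Lambda> (pderiv (R k * R m)) = real k * h m"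
    using R' by (simp add: pderiv_mult add mult.commute)
  then have lhs: "real k * h m = \<Lambda> ([:0, b, 0, a:] * (R k * R m))"
    by (simp add: ibp)
  have V: "[:0, b, 0, a:] * (R k * R m) =
      smult b (R k * pCons 0 (R m)) + smult a (pCons 0 (pCons 0 (R k)) * pCons 0 (R m))"
    by (simp add: algebra_simps)
  have x1: "\<Lambda> (R k * pCons 0 (R m)) = h k"
    using inner_lead[of k "pCons 0 (R m)"]
    by (simp add: coeff_pCons monic_R degree_R coeff_eq_0 Suc split: nat.split)
  have X2: "pCons 0 (pCons 0 (R k)) = R (Suc (Suc k)) + smult (\<rho> (Suc k) + \<rho> k) (R k) +
      smult (\<rho> k * \<rho> m) (R (m - 1))"
  proof -
    have "pCons 0 (pCons 0 (R k)) = pCons 0 (R (Suc k)) + smult (\<rho> k) (pCons 0 (R m))"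
      using three_term[of k] by (simp add: Suc)
    also have "\<dots> = R (Suc (Suc k)) + smult (\<rho> (Suc k)) (R k) + smult (\<rho> k) (R k + smult (\<rho> m) (R (m - 1)))"
      using three_term[of "Suc k"] three_term[of m] by (simp add: Suc)
    finally show ?thesis by (simp add: smult_add_left smult_add_right algebra_simps)
  qed
  have X1: "pCons 0 (R m) = R k + smult (\<rho> m) (R (m - 1))"
    using three_term[of m] by (simp add: Suc)
  have o: "\<Lambda> (R (Suc (Suc k)) * R k) = 0" "\<Lambda> (R (Suc (Suc k)) * R (m - 1)) = 0"
    "\<Lambda> (R k * R (m - 1)) = 0" "\<Lambda> (R (m - 1) * R k) = 0"
    by (auto intro!: orth_R simp: Suc)
  have x3: "\<Lambda> (pCons 0 (pCons 0 (R k)) * pCons 0 (R m)) =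
      (\<rho> (Suc k) + \<rho> k) * h k + \<rho> k * \<rho> m * (\<rho> m * h (m - 1))"
    unfolding X2 X1 distrib_left distrib_right add smult mult_smult_left mult_smult_right o
    by (simp add: h_def algebra_simps)
  have hk: "h k = \<rho> k * h m" using \<rho>_h[of k] by (simp add: Suc)
  have "\<rho> k * \<rho> m * (\<rho> m * h (m - 1)) = \<rho> m * h k"
    using \<rho>_h[of m] by (cases "m = 0") (simp_all add: \<rho>_0 hk)
  then have "real k * h m = b * h k + a * ((\<rho> (Suc k) + \<rho> k) * h k + \<rho> m * h k)"
    unfolding lhs V add smult x1 x3 by simp
  then have "real k * h m = \<rho> k * (a * (\<rho> (Suc k) + \<rho> k + \<rho> (k - 1)) + b) * h m"
    by (simp only: hk) (simp add: Suc algebra_simps)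
  then show ?thesis using h_pos[of m] by simp
qed (simp add: \<rho>_0)

end

section \<open>The quartic weight: integrability and integration by parts\<close>

definition quartic_weight :: "real \<Rightarrow> real \<Rightarrow> real \<Rightarrow> real" where
  "quartic_weight N c y = exp (- (N * (y ^ 4 / 4 + c * y\<^sup>2 / 2)))"

lemma quartic_weight_pos: "quartic_weight N c y > 0"
  by (simp add: quartic_weight_def)

lemma continuous_quartic_weight: "continuous_on UNIV (quartic_weight N c)"
  unfolding quartic_weight_def by (intro continuous_intros) auto

text \<open>A power is dominated by an exponential, and the quartic term absorbs all quadratic ones
  by completing the square in y^2.\<close>

lemma quartic_weight_bound:
  assumes N: "N > 0"
  shows "\<exists>C\<ge>0. \<forall>y. \<bar>y ^ k\<bar> * quartic_weight N c y \<le> C * exp (- y\<^sup>2 / 2)"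
proof -
  \<comment> \<open>Collects the coefficients of y^2: 1 from |y| <= 1 + y^2, 1/2 to leave a Gaussian
    factor, and the rest from the quadratic part of the weight.\<close>
  define D where "D = 3 / 2 + N * \<bar>c\<bar> / 2"
  have "\<bar>y ^ k\<bar> * quartic_weight N c y \<le> fact k * exp (1 + D\<^sup>2 / N) * exp (- y\<^sup>2 / 2)" for y
  proof -
    have "\<bar>y\<bar> ^ k / fact k \<le> exp \<bar>y\<bar>"
    proof -
      have "(\<Sum>i\<in>{k}. \<bar>y\<bar> ^ i /\<^sub>R fact i) \<le> (\<Sum>i. \<bar>y\<bar> ^ i /\<^sub>R fact i)"
        by (rule sum_le_suminf[OF summable_exp_generic]) auto
      then show ?thesis by (simp add: exp_def divide_inverse mult.commute)
    qed
    then have 1: "\<bar>y ^ k\<bar> \<le> fact k * exp \<bar>y\<bar>" by (simp add: power_abs field_simps)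
    have "\<bar>y\<bar> \<le> 1 + y\<^sup>2"
      using sum_squares_ge_zero[of "\<bar>y\<bar> - 1" "\<bar>y\<bar>"] by (simp add: power2_eq_square algebra_simps abs_if split: if_splits)
    moreover have "- (N * (c * y\<^sup>2 / 2)) \<le> N * \<bar>c\<bar> / 2 * y\<^sup>2"
      using mult_right_mono[of "- c" "\<bar>c\<bar>" "N * y\<^sup>2 / 2"] N by (simp add: mult_ac)
    moreover have "D * y\<^sup>2 - N * (y ^ 4 / 4) \<le> D\<^sup>2 / N"
    proof -
      have "0 \<le> (D - N * y\<^sup>2 / 2)\<^sup>2 / N" using N by simp
      also have "\<dots> = D\<^sup>2 / N - D * y\<^sup>2 + N * (y ^ 4 / 4)"
        using N by (simp add: power2_eq_square field_simps) (simp add: power4_eq_xxxx)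
      finally show ?thesis by simp
    qed
    ultimately have "\<bar>y\<bar> - N * (y ^ 4 / 4 + c * y\<^sup>2 / 2) \<le> 1 + D\<^sup>2 / N - y\<^sup>2 / 2"
      by (simp add: D_def algebra_simps)
    then have 2: "exp \<bar>y\<bar> * quartic_weight N c y \<le> exp (1 + D\<^sup>2 / N - y\<^sup>2 / 2)"
      unfolding quartic_weight_def exp_add[symmetric] by simp
    have "\<bar>y ^ k\<bar> * quartic_weight N c y \<le> fact k * exp \<bar>y\<bar> * quartic_weight N c y"
      using 1 quartic_weight_pos[of N c y] by (intro mult_right_mono) auto
    also have "\<dots> \<le> fact k * exp (1 + D\<^sup>2 / N - y\<^sup>2 / 2)"
      using 2 by (simp add: mult.assoc)
    also have "\<dots> = fact k * exp (1 + D\<^sup>2 / N) * exp (- y\<^sup>2 / 2)"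
      by (simp add: exp_add[symmetric])
    finally show ?thesis .
  qed
  then show ?thesis by (intro exI[of _ "fact k * exp (1 + D\<^sup>2 / N)"]) auto
qed

lemma poly_quartic_weight_bound:
  fixes f :: "'a::{real_normed_field} poly"
  assumes N: "N > 0"
  shows "\<exists>C\<ge>0. \<forall>y. norm (poly f (of_real y)) * quartic_weight N c y \<le> C * exp (- y\<^sup>2 / 2)"
proof -
  obtain C where C: "\<And>k. C k \<ge> 0" "\<And>k y. \<bar>y ^ k\<bar> * quartic_weight N c y \<le> C k * exp (- y\<^sup>2 / 2)"
  proof -
    have "\<forall>k. \<exists>C\<ge>0. \<forall>y. \<bar>y ^ k\<bar> * quartic_weight N c y \<le> C * exp (- y\<^sup>2 / 2)"
      using quartic_weight_bound[OF N] by blast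
    then have "\<exists>C. \<forall>k. C k \<ge> 0 \<and> (\<forall>y. \<bar>y ^ k\<bar> * quartic_weight N c y \<le> C k * exp (- y\<^sup>2 / 2))"
      by (intro choice) blast
    then show ?thesis using that by blast
  qed
  have "norm (poly f (of_real y)) * quartic_weight N c y \<le>
      (\<Sum>i\<le>degree f. norm (coeff f i) * C i) * exp (- y\<^sup>2 / 2)" for y
  proof -
    have "norm (poly f (of_real y)) \<le> (\<Sum>i\<le>degree f. norm (coeff f i) * \<bar>y ^ i\<bar>)"
      unfolding poly_altdef by (rule order.trans[OF norm_sum]) (simp add: norm_mult norm_power power_abs)
    then have "norm (poly f (of_real y)) * quartic_weight N c y \<le>
        (\<Sum>i\<le>degree f. norm (coeff f i) * \<bar>y ^ i\<bar>) * quartic_weight N c y"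
      using quartic_weight_pos[of N c y] by (intro mult_right_mono) auto
    also have "\<dots> = (\<Sum>i\<le>degree f. norm (coeff f i) * (\<bar>y ^ i\<bar> * quartic_weight N c y))"
      by (simp add: sum_distrib_right mult.assoc)
    also have "\<dots> \<le> (\<Sum>i\<le>degree f. norm (coeff f i) * (C i * exp (- y\<^sup>2 / 2)))"
      by (intro sum_mono mult_left_mono C) auto
    finally show ?thesis by (simp add: sum_distrib_right mult.assoc)
  qed
  then show ?thesis using C(1) by (intro exI[of _ "\<Sum>i\<le>degree f. norm (coeff f i) * C i"]) (auto intro!: sum_nonneg)
qed

lemma continuous_poly_quartic_weight:
  fixes f :: "'a::{real_normed_field} poly"
  shows "continuous_on UNIV (\<lambda>y. poly f (of_real y) * of_real (quartic_weight N c y))"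
  by (intro continuous_intros continuous_on_of_real continuous_on_subset[OF continuous_quartic_weight]) auto

lemma integrable_poly_quartic_weight:
  fixes f :: "'a::{real_normed_field, banach, second_countable_topology} poly"
  assumes N: "N > 0"
  shows "integrable lborel (\<lambda>y. poly f (of_real y) * of_real (quartic_weight N c y))"
proof -
  obtain C where C: "\<And>y. norm (poly f (of_real y)) * quartic_weight N c y \<le> C * exp (- y\<^sup>2 / 2)"
    using poly_quartic_weight_bound[OF N] by blast
  have "integrable lborel (\<lambda>y. C * sqrt (2 * pi) * normal_density 0 1 y)"
    by (intro integrable_mult_right integrable_normal_density) auto
  then show ?thesis
  proof (rule Bochner_Integration.integrable_bound)
    show "(\<lambda>y. poly f (of_real y) * of_real (quartic_weight N c y)) \<in> borel_measurable lborel"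
      using borel_measurable_continuous_onI[OF continuous_poly_quartic_weight[of f N c]] by simp
    have "norm (poly f (of_real y) * of_real (quartic_weight N c y)) \<le> norm (C * sqrt (2 * pi) * normal_density 0 1 y)" for y
    proof -
      have "norm (poly f (of_real y) * of_real (quartic_weight N c y)) \<le> C * exp (- y\<^sup>2 / 2)"
        using C[of y] quartic_weight_pos[of N c y] by (simp add: norm_mult)
      also have "\<dots> = C * sqrt (2 * pi) * normal_density 0 1 y"
        by (simp add: normal_density_def)
      finally show ?thesis by simp
    qed
    then show "AE y in lborel. norm (poly f (of_real y) * of_real (quartic_weight N c y)) \<le> norm (C * sqrt (2 * pi) * normal_density 0 1 y)"
      by simp
  qed
qed

lemma poly_quartic_weight_tendsto_0:
  fixes f :: "real poly"
  assumes N: "N > 0" and F: "filterlim (\<lambda>y. y\<^sup>2) at_top F"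
  shows "((\<lambda>y. poly f y * quartic_weight N c y) \<longlongrightarrow> 0) F"
proof -
  obtain C where C: "\<And>y. norm (poly f (of_real y)) * quartic_weight N c y \<le> C * exp (- y\<^sup>2 / 2)"
    using poly_quartic_weight_bound[OF N] by blast
  have "((\<lambda>y. exp (- (y\<^sup>2 / 2))) \<longlongrightarrow> 0) F"
    by (intro filterlim_compose[OF exp_at_bot] filterlim_compose[OF filterlim_uminus_at_bot_at_top])
      (use filterlim_tendsto_pos_mult_at_top[OF tendsto_const[of "1/2"] _ F] in simp)
  then have "((\<lambda>y. C * exp (- y\<^sup>2 / 2)) \<longlongrightarrow> C * 0) F"
    by (intro tendsto_mult_left) simp
  then have "((\<lambda>y. C * exp (- y\<^sup>2 / 2)) \<longlongrightarrow> 0) F" by simp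
  then show ?thesis
  proof (rule Lim_null_comparison[rotated], intro always_eventually allI)
    fix y show "norm (poly f y * quartic_weight N c y) \<le> C * exp (- y\<^sup>2 / 2)"
      using C[of y] quartic_weight_pos[of N c y] by (simp add: abs_mult)
  qed
qed

text \<open>The integrand is the derivative of \<open>f\<close> times the weight, and the boundary
  terms vanish.\<close>

lemma integral_derivative_poly_quartic_weight:
  fixes f :: "real poly"
  assumes N: "N > 0"
  shows "(LINT y|lborel. poly (pderiv f - smult N [:0, c, 0, 1:] * f) y * quartic_weight N c y) = 0"
proof -
  let ?g = "\<lambda>y. poly (pderiv f - smult N [:0, c, 0, 1:] * f) y * quartic_weight N c y"
  let ?F = "\<lambda>y. poly f y * quartic_weight N c y"
  have D: "(?F has_vector_derivative ?g y) (at y)" for y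
  proof -
    have "(quartic_weight N c has_real_derivative - (N * (y ^ 3 + c * y)) * quartic_weight N c y) (at y)"
      unfolding quartic_weight_def
      by (auto intro!: derivative_eq_intros simp: power3_eq_cube power2_eq_square algebra_simps)
    from DERIV_mult[OF poly_DERIV[of f] this]
    have "(?F has_real_derivative ?g y) (at y)"
      by (rule DERIV_cong) (simp add: algebra_simps power3_eq_cube)
    then show ?thesis by (simp add: has_real_derivative_iff_has_vector_derivative)
  qed
  have lim: "(?F \<longlongrightarrow> 0) at_top" "(?F \<longlongrightarrow> 0) at_bot"
  proof -
    show "(?F \<longlongrightarrow> 0) at_top"
      by (rule poly_quartic_weight_tendsto_0[OF N]) (auto intro!: filterlim_pow_at_top filterlim_ident)
    show "(?F \<longlongrightarrow> 0) at_bot"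
      by (rule poly_quartic_weight_tendsto_0[OF N]) (auto intro!: filterlim_pow_at_bot_even filterlim_ident)
  qed
  have int: "integrable lborel ?g"
    using integrable_poly_quartic_weight[OF N, of "pderiv f - smult N [:0, c, 0, 1:] * f" c] by simp
  have "(LBINT y=-\<infinity>..\<infinity>. ?g y) = 0 - 0"
  proof (rule interval_integral_FTC_integrable[of "-\<infinity>" "\<infinity>" ?F])
    show "isCont ?g y" for y
      using continuous_poly_quartic_weight[of "pderiv f - smult N [:0, c, 0, 1:] * f" N c]
      by (simp add: continuous_on_eq_continuous_at)
    show "set_integrable lborel (einterval (-\<infinity>) \<infinity>) ?g"
      using int by (simp add: set_integrable_def einterval_def)
    show "((?F \<circ> real_of_ereal) \<longlongrightarrow> 0) (at_right (-\<infinity>))" "((?F \<circ> real_of_ereal) \<longlongrightarrow> 0) (at_left \<infinity>)"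
      using lim by (simp_all only: ereal_tendsto_simps)
  qed (use D in auto)
  then show ?thesis
    by (simp add: interval_lebesgue_integral_def set_lebesgue_integral_def einterval_def)
qed

text \<open>The argument is \<open>\<tau> * y\<close>, the mean of the Gaussian in \<open>x\<close>:
  the polynomials after the heat flow are orthogonal in this variable.\<close>

definition quartic_form :: "real \<Rightarrow> real \<Rightarrow> real \<Rightarrow> real poly \<Rightarrow> real" where
  "quartic_form N c \<tau> f = (LINT y|lborel. poly f (\<tau> * y) * quartic_weight N c y)"

lemma integrable_quartic_form:
  fixes f :: "'a::{real_normed_field, banach, second_countable_topology} poly"
  assumes "N > 0"
  shows "integrable lborel (\<lambda>y. poly f (of_real (\<tau> * y)) * of_real (quartic_weight N c y))"
  using integrable_poly_quartic_weight[OF assms, of "pcompose f [:0, of_real \<tau>:]" c]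
  by (simp add: poly_pcompose mult.commute)

lemma quartic_form_add:
  assumes "N > 0"
  shows "quartic_form N c \<tau> (f + g) = quartic_form N c \<tau> f + quartic_form N c \<tau> g"
  unfolding quartic_form_def
  using integrable_quartic_form[OF assms, of f \<tau> c] integrable_quartic_form[OF assms, of g \<tau> c]
  by (simp add: distrib_right)

lemma quartic_form_smult: "quartic_form N c \<tau> (smult a f) = a * quartic_form N c \<tau> f"
  unfolding quartic_form_def by (simp add: mult.assoc)

lemma quartic_form_square_pos:
  assumes "N > 0" "\<tau> > 0" "f \<noteq> 0"
  shows "quartic_form N c \<tau> (f * f) > 0"
proof -
  let ?g = "\<lambda>y. poly (f * f) (\<tau> * y) * quartic_weight N c y"
  have nn: "?g y \<ge> 0" for y using quartic_weight_pos[of N c y] by simp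
  have int: "integrable lborel ?g" using integrable_quartic_form[OF assms(1), of "f * f" \<tau> c] by simp
  have "quartic_form N c \<tau> (f * f) \<ge> 0"
    unfolding quartic_form_def by (intro integral_nonneg_AE) (use nn in simp)
  moreover have "quartic_form N c \<tau> (f * f) \<noteq> 0"
  proof
    assume "quartic_form N c \<tau> (f * f) = 0"
    then have "AE y in lborel. ?g y = 0"
      unfolding quartic_form_def using integral_nonneg_eq_0_iff_AE[OF int] nn by simp
    then have ae: "AE y in lborel. poly f (\<tau> * y) = 0"
      using quartic_weight_pos[of N c] by (auto simp: less_le)
    have "finite {y. poly (pcompose f [:0, \<tau>:]) y = 0}"
      by (rule poly_roots_finite) (use assms pcompose_eq_0[of f "[:0, \<tau>:]"] in auto)
    then have "finite {y. poly f (\<tau> * y) = 0}" by (simp add: poly_pcompose mult.commute)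
    then have "{y. poly f (\<tau> * y) = 0} \<in> null_sets lborel"
      by (rule finite_imp_null_set_lborel)
    then have "AE y in lborel. poly f (\<tau> * y) \<noteq> 0"
      by (auto dest: AE_not_in)
    with ae have "AE y::real in lborel. False" by eventually_elim simp
    then show False by (simp add: AE_iff_null null_sets_def)
  qed
  ultimately show ?thesis by simp
qed

lemma quartic_form_reflect:
  "quartic_form N c \<tau> (pcompose f [:0, - 1:]) = quartic_form N c \<tau> f"
proof -
  have "quartic_form N c \<tau> f = (LINT y|lborel. poly f (\<tau> * (0 + (- 1) * y)) * quartic_weight N c (0 + (- 1) * y))"
    unfolding quartic_form_def
    using lborel_integral_real_affine[of "- 1" "\<lambda>y. poly f (\<tau> * y) * quartic_weight N c y" 0] by simp
  then show ?thesis
    by (simp add: quartic_form_def poly_pcompose quartic_weight_def)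
qed

text \<open>The powers of \<tau> come from the chain rule: \<tau> V'(\<tau> y) = N (y^3 + c
  y).\<close>

lemma quartic_form_pderiv:
  assumes N: "N > 0" and t: "\<tau> > 0"
  shows "quartic_form N c \<tau> (pderiv f) = quartic_form N c \<tau> ([:0, N * c / \<tau>\<^sup>2, 0, N / \<tau> ^ 4:] * f)"
proof -
  let ?f = "pcompose f [:0, \<tau>:]"
  define V W where "V = [:0, N * c / \<tau>\<^sup>2, 0, N / \<tau> ^ 4:]" and "W = smult N [:0, c, 0, 1:]"
  have VW: "poly W y = \<tau> * poly V (\<tau> * y)" for y
    using t by (simp add: V_def W_def field_simps power2_eq_square power4_eq_xxxx)
  have "poly (pderiv ?f - W * ?f) y = \<tau> * poly (pderiv f + smult (- 1) (V * f)) (\<tau> * y)" for y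
    by (simp add: pderiv_pcompose pderiv_pCons poly_pcompose VW algebra_simps)
  then have "0 = (LINT y|lborel. \<tau> * (poly (pderiv f + smult (- 1) (V * f)) (\<tau> * y) * quartic_weight N c y))"
    using integral_derivative_poly_quartic_weight[OF N, of ?f c] by (simp only: W_def[symmetric] mult.assoc)
  also have "\<dots> = \<tau> * quartic_form N c \<tau> (pderiv f + smult (- 1) (V * f))"
    by (simp add: quartic_form_def)
  also have "\<dots> = \<tau> * (quartic_form N c \<tau> (pderiv f) - quartic_form N c \<tau> (V * f))"
    unfolding quartic_form_add[OF N] quartic_form_smult by simp
  finally show ?thesis using t by (simp add: V_def)
qed

lemma quartic_functional_quartic_form:
  assumes "N > 0" "\<tau> > 0" "\<And>k. degree (R k) = k" "\<And>k. coeff (R k) k = 1"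
    "\<And>k f. degree f < k \<Longrightarrow> quartic_form N c \<tau> (R k * f) = 0"
  shows "quartic_functional (quartic_form N c \<tau>) (N / \<tau> ^ 4) (N * c / \<tau>\<^sup>2) R"
  using assms
  by unfold_locales (simp_all add: quartic_form_add quartic_form_smult quartic_form_square_pos
      quartic_form_reflect quartic_form_pderiv)

text \<open>Integrating out \<open>x\<close> first turns biorthogonality into orthogonality to the
  rescaled partners Q_j (x / \<tau>). These have every degree j < k, so successive removal of
  leading coefficients reaches every \<open>f\<close> of degree below \<open>k\<close>.\<close>

lemma biorthogonal_heat_orthogonal:
  fixes P Q :: "nat \<Rightarrow> complex poly" and f :: "complex poly"
  assumes t: "\<tau> > 0" and n: "n \<ge> 1" and bi: "biorthogonal \<tau> t n P Q"
    and f: "\<And>j. j \<ge> k \<Longrightarrow> coeff f j = 0"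
  shows "(LINT y|lborel. poly (heat (1 / (2 * of_nat n)) (P k) * f) (of_real (\<tau> * y)) *
    complex_of_real (quartic_weight n (t - \<tau>\<^sup>2) y)) = 0"
proof -
  define K where "K = heat (1 / (2 * of_nat n)) (P k)"
  define c where "c = t - \<tau>\<^sup>2"
  define L where "L = (\<lambda>f. LINT y|lborel. poly (K * f) (of_real (\<tau> * y)) * complex_of_real (quartic_weight n c y))"
  have N: "real n > 0" using n by simp
  have L_add: "L (f + g) = L f + L g" for f g
    using integrable_quartic_form[OF N, of "K * f" \<tau> c] integrable_quartic_form[OF N, of "K * g" \<tau> c]
    by (simp add: L_def distrib_right distrib_left)
  have L_smult: "L (smult a f) = a * L f" for a f
    by (simp add: L_def mult.assoc mult.left_commute[of _ a])
  define G where "G = (\<lambda>j. pcompose (Q j) [:0, 1 / complex_of_real \<tau>:])"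
  have degG: "degree (G j) = j" and G0: "G j \<noteq> 0" for j
  proof -
    have Q: "degree (Q j) = j" "lead_coeff (Q j) = 1" using bi unfolding biorthogonal_def by metis+
    show "degree (G j) = j" using t Q by (simp add: G_def degree_pcompose)
    show "G j \<noteq> 0"
      using t Q(2) pcompose_eq_0[of "Q j" "[:0, 1 / complex_of_real \<tau>:]"] by (auto simp: G_def)
  qed
  have LG: "L (G j) = 0" if "j \<noteq> k" for j
  proof -
    have "0 = (LINT y|lborel. LINT x|lborel. poly (P k) (complex_of_real x) * poly (Q j) (complex_of_real y) *
           complex_of_real (biorth_weight \<tau> t n x y))"
      using bi that by (auto simp: biorthogonal_def)
    also have "\<dots> = (LINT y|lborel. complex_of_real (sqrt (2 * pi / n)) *
        (poly (K * G j) (of_real (\<tau> * y)) * complex_of_real (quartic_weight n c y)))"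
      unfolding inner_integral_biorth[OF n] using t
      by (simp add: K_def c_def quartic_weight_def G_def poly_pcompose mult.assoc)
    also have "\<dots> = complex_of_real (sqrt (2 * pi / n)) * L (G j)"
      by (simp add: L_def)
    finally show ?thesis using n by simp
  qed
  have "L f = 0" if "\<And>j. j \<ge> m \<Longrightarrow> coeff f j = 0" "m \<le> k" for f m
    using that
  proof (induction m arbitrary: f)
    case 0
    then have "f = 0" by (intro poly_eqI) simp
    then show ?case using L_smult[of 0 0] by simp
  next
    case (Suc m)
    define a where "a = coeff f m / coeff (G m) m"
    have Gm: "coeff (G m) m \<noteq> 0" using degG[of m] G0[of m] leading_coeff_0_iff by metis
    define g where "g = f + smult (- a) (G m)"
    have "coeff g j = 0" if "j \<ge> m" for j
      using that Suc.prems(1)[of j] Gm by (cases "j = m") (auto simp: g_def a_def coeff_eq_0 degG)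
    then have "L g = 0" using Suc by simp
    then show ?case using LG[of m] Suc.prems by (simp only: g_def L_add L_smult) simp
  qed
  from this[of k f] f show ?thesis by (simp add: L_def K_def c_def)
qed

lemma poly_map_poly_Re_Im:
  "poly (map_poly Re K) x = Re (poly K (of_real x))" "poly (map_poly Im K) x = Im (poly K (of_real x))"
proof -
  have *: "poly (map_poly g K) x = (\<Sum>i\<le>degree K. g (coeff K i) * x ^ i)" if "g 0 = 0" for g :: "complex \<Rightarrow> real"
  proof -
    have "degree (map_poly g K) \<le> degree K"
      by (rule degree_le) (simp add: coeff_map_poly that coeff_eq_0)
    then show ?thesis
      unfolding poly_altdef using that
      by (intro sum.mono_neutral_cong_left) (auto simp: coeff_map_poly intro!: le_degree)
  qed
  show "poly (map_poly Re K) x = Re (poly K (of_real x))" "poly (map_poly Im K) x = Im (poly K (of_real x))"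
    by (simp_all add: * poly_altdef[of K] flip: of_real_power)
qed

lemma biorthogonal_structure:
  fixes P Q :: "nat \<Rightarrow> complex poly"
  assumes t: "\<tau> > 0" and n: "n \<ge> 1" and bi: "biorthogonal \<tau> t n P Q"
  defines "K \<equiv> \<lambda>k. heat (1 / (2 * of_nat n)) (P k)"
  shows "\<exists>\<rho>. \<rho> 0 = 0 \<and> (\<forall>k\<ge>1. \<rho> k > 0) \<and>
    (\<forall>k. pCons 0 (K k) = K (Suc k) + smult (complex_of_real (\<rho> k)) (K (k - 1))) \<and>
    (\<forall>k. real k = \<rho> k * (n / \<tau> ^ 4 * (\<rho> (Suc k) + \<rho> k + \<rho> (k - 1)) + n * (t - \<tau>\<^sup>2) / \<tau>\<^sup>2))"
proof -
  define c where "c = t - \<tau>\<^sup>2"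
  have N: "real n > 0" using n by simp
  have P: "degree (P k) = k" "coeff (P k) k = 1" for k using bi unfolding biorthogonal_def by metis+
  have K: "degree (K k) = k" "coeff (K k) k = 1" for k
    using P[of k] lead_coeff_heat[of "1 / (2 * of_nat n)" "P k"] by (simp_all add: K_def)
  \<comment> \<open>The given polynomials are complex while the positivity argument needs real ones.
    The weight is real, so both coefficient parts inherit orthogonality to real polynomials.\<close>
  define R where "R = (\<lambda>k. map_poly Re (K k))"
  define I where "I = (\<lambda>k. map_poly Im (K k))"
  have coeffR: "coeff (R k) j = Re (coeff (K k) j)" "coeff (I k) j = Im (coeff (K k) j)" for k j
    by (auto simp: R_def I_def coeff_map_poly)
  have deg: "degree (R k) = k" for k
  proof (rule antisym)
    show "degree (R k) \<le> k" by (rule degree_le) (simp add: coeffR coeff_eq_0 K)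
    show "k \<le> degree (R k)" by (rule le_degree) (simp add: coeffR K)
  qed
  have orth: "quartic_form n c \<tau> (R k * f) = 0 \<and> quartic_form n c \<tau> (I k * f) = 0"
    if f: "\<And>j. j \<ge> k \<Longrightarrow> coeff f j = 0" for f k
  proof -
    define F where "F = map_poly complex_of_real f"
    have pF: "poly F (of_real x) = complex_of_real (poly f x)" for x
      unfolding F_def by (induction f) (simp_all add: map_poly_pCons)
    let ?g = "\<lambda>y. poly (K k * F) (of_real (\<tau> * y)) * complex_of_real (quartic_weight n c y)"
    have 0: "(LINT y|lborel. ?g y) = 0"
      unfolding K_def c_def
      by (rule biorthogonal_heat_orthogonal[OF t n bi]) (simp add: F_def coeff_map_poly f)
    have int: "integrable lborel ?g" by (rule integrable_quartic_form[OF N])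
    have "quartic_form n c \<tau> (R k * f) = (LINT y|lborel. Re (?g y))"
      unfolding quartic_form_def R_def
      by (intro Bochner_Integration.integral_cong) (simp_all add: poly_map_poly_Re_Im pF del: of_real_mult)
    moreover have "quartic_form n c \<tau> (I k * f) = (LINT y|lborel. Im (?g y))"
      unfolding quartic_form_def I_def
      by (intro Bochner_Integration.integral_cong) (simp_all add: poly_map_poly_Re_Im pF del: of_real_mult)
    ultimately show ?thesis
      by (simp only: integral_Re[OF int] integral_Im[OF int] 0 zero_complex.sel simp_thms)
  qed
  \<comment> \<open>The leading coefficient 1 is real, so \<open>I k\<close> has degree below
    \<open>k\<close> and is orthogonal to itself.\<close>
  have I0: "I k = 0" for k
  proof (rule ccontr)
    assume "I k \<noteq> 0"
    then have "quartic_form n c \<tau> (I k * I k) > 0" by (rule quartic_form_square_pos[OF N t])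
    moreover have "coeff (I k) j = 0" if "j \<ge> k" for j
      using that by (cases "j = k") (auto simp: coeffR K coeff_eq_0)
    ultimately show False using orth[of k "I k"] by simp
  qed
  have KR: "K k = map_poly complex_of_real (R k)" for k
  proof (rule poly_eqI)
    fix j show "coeff (K k) j = coeff (map_poly complex_of_real (R k)) j"
      using coeffR(2)[of k j] I0[of k] by (simp add: coeff_map_poly coeffR complex_eq_iff)
  qed
  interpret quartic_functional "quartic_form n c \<tau>" "n / \<tau> ^ 4" "n * c / \<tau>\<^sup>2" R
  proof (rule quartic_functional_quartic_form[OF N t deg])
    show "coeff (R k) k = 1" for k by (simp add: coeffR K)
    show "quartic_form n c \<tau> (R k * f) = 0" if "degree f < k" for k f
      using orth[of k f] that by (simp add: coeff_eq_0)
  qed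
  have "pCons 0 (K k) = K (Suc k) + smult (complex_of_real (\<rho> k)) (K (k - 1))" for k
  proof (rule poly_eqI)
    fix j
    have "coeff (pCons 0 (R k)) j = coeff (R (Suc k) + smult (\<rho> k) (R (k - 1))) j"
      by (simp only: three_term)
    then show "coeff (pCons 0 (K k)) j = coeff (K (Suc k) + smult (complex_of_real (\<rho> k)) (K (k - 1))) j"
      unfolding KR by (cases j) (simp_all add: coeff_map_poly flip: of_real_mult of_real_add)
  qed
  moreover define r where "r = quartic_functional.\<rho> (quartic_form n c \<tau>) R"
  ultimately have "r 0 = 0 \<and> (\<forall>k\<ge>1. r k > 0) \<and>
    (\<forall>k. pCons 0 (K k) = K (Suc k) + smult (complex_of_real (r k)) (K (k - 1))) \<and>
    (\<forall>k. real k = r k * (n / \<tau> ^ 4 * (r (Suc k) + r k + r (k - 1)) + n * (t - \<tau>\<^sup>2) / \<tau>\<^sup>2))"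
    using \<rho>_0 \<rho>_pos freud unfolding r_def c_def by blast
  then show ?thesis by blast
qed

section \<open>Recurrences with the Freud equation\<close>

text \<open>The structure relation: as V' is cubic, the derivative of the k-th polynomial involves
  only the members k - 1 and k - 3. Stated for sequences in a ring, it serves both the polynomials
  themselves and their values on the imaginary axis, where the recurrence coefficients change
  sign.\<close>

lemma freud_derivative:
  fixes p d r :: "nat \<Rightarrow> 'a::comm_ring_1"
  assumes r0: "r 0 = 0" and d0: "d 0 = 0"
    and p: "\<And>k. x * p k = p (Suc k) + r k * p (k - 1)"
    and d: "\<And>k. d (Suc k) = p k + x * d k - r k * d (k - 1)"
    and freud: "\<And>k. of_nat k = r k * (a * (r (Suc k) + r k + r (k - 1)) + b)"
  shows "d k = of_nat k * p (k - 1) + a * (r k * r (k - 1) * r (k - 2)) * p (k - 3)"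
proof (induction k rule: less_induct)
  case (less k)
  consider "k = 0" | "k = 1" | "k = 2" | "k = 3" | m where "k = Suc (Suc (Suc (Suc m)))"
    by (metis One_nat_def Suc_1 numeral_3_eq_3 not0_implies_Suc)
  then show ?case
  proof cases
    case 1
    then show ?thesis by (simp add: d0 r0)
  next
    case 2
    then show ?thesis using d[of 0] by (simp add: d0 r0)
  next
    case 3
    have "d 1 = p 0" using d[of 0] by (simp add: d0 r0)
    then show ?thesis using d[of 1] p[of 0] by (simp add: 3 d0 r0 numeral_2_eq_2)
  next
    case 4
    have d1: "d (Suc 0) = p 0" using d[of 0] by (simp add: d0 r0)
    have d2: "d (Suc (Suc 0)) = 2 * p (Suc 0)" using d[of "Suc 0"] p[of 0] d1 by (simp add: d0 r0)
    have "d 3 = p 2 + 2 * (x * p 1) - r 2 * p 0"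
      using d[of "Suc (Suc 0)"] by (simp add: d1 d2 numeral_3_eq_3 numeral_2_eq_2 mult_ac)
    also have "x * p 1 = p 2 + r 1 * p 0" using p[of 1] by (simp add: numeral_2_eq_2)
    also have "p 2 + 2 * (p 2 + r 1 * p 0) - r 2 * p 0 = 3 * p 2 + (2 * r 1 - r 2) * p 0"
      by (simp add: algebra_simps)
    also have "2 * r 1 - r 2 = a * (r 3 * r 2 * r 1)"
    proof -
      have "2 * r 1 - 1 * r 2 = r 2 * (a * (r 3 + r 2 + r 1) + b) * r 1 - r 1 * (a * (r 2 + r 1 + r 0) + b) * r 2"
        using freud[of 2] freud[of 1] by (simp add: numeral_3_eq_3 numeral_2_eq_2)
      also have "\<dots> = a * (r 3 * r 2 * r 1)" by (simp add: r0 algebra_simps)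
      finally show ?thesis by simp
    qed
    finally show ?thesis by (simp add: 4)
  next
    case (5 m)
    let ?k = "Suc (Suc (Suc m))"
    have IH1: "d ?k = of_nat ?k * p (Suc (Suc m)) + a * (r ?k * r (Suc (Suc m)) * r (Suc m)) * p m"
      using less[of ?k] by (simp add: 5 numeral_2_eq_2 numeral_3_eq_3)
    have IH2: "d (Suc (Suc m)) = of_nat (Suc (Suc m)) * p (Suc m) + a * (r (Suc (Suc m)) * r (Suc m) * r m) * p (m - 1)"
      using less[of "Suc (Suc m)"] by (simp add: 5 numeral_2_eq_2 numeral_3_eq_3)
    have P1: "x * p (Suc (Suc m)) = p ?k + r (Suc (Suc m)) * p (Suc m)"
      using p[of "Suc (Suc m)"] by simp
    have P2: "x * p m = p (Suc m) + r m * p (m - 1)" by (rule p)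
    \<comment> \<open>Cross-multiplying Freud's equation at two consecutive indices eliminates
      \<open>b\<close>.\<close>
    have F: "of_nat ?k * r (Suc (Suc m)) - of_nat (Suc (Suc m)) * r ?k =
        a * (r ?k * r (Suc (Suc m))) * (r (Suc ?k) - r (Suc m))"
      using freud[of ?k] freud[of "Suc (Suc m)"] by (simp add: algebra_simps del: of_nat_Suc)
    have "d k = p ?k + x * d ?k - r ?k * d (Suc (Suc m))"
      using d[of ?k] by (simp add: 5)
    also have "x * d ?k = of_nat ?k * (x * p (Suc (Suc m))) +
        a * (r ?k * r (Suc (Suc m)) * r (Suc m)) * (x * p m)"
      unfolding IH1 by (simp add: algebra_simps del: of_nat_Suc)
    also have "p ?k + (of_nat ?k * (x * p (Suc (Suc m))) + a * (r ?k * r (Suc (Suc m)) * r (Suc m)) * (x * p m)) -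
        r ?k * d (Suc (Suc m)) = (of_nat ?k + 1) * p ?k +
        (of_nat ?k * r (Suc (Suc m)) - of_nat (Suc (Suc m)) * r ?k + a * (r ?k * r (Suc (Suc m)) * r (Suc m))) * p (Suc m)"
      unfolding P1 P2 IH2 by (simp add: algebra_simps del: of_nat_Suc)
    also have "\<dots> = (of_nat ?k + 1) * p ?k + a * (r (Suc ?k) * r ?k * r (Suc (Suc m))) * p (Suc m)"
      unfolding F by (simp add: algebra_simps del: of_nat_Suc)
    finally show ?thesis by (simp add: 5 numeral_2_eq_2 numeral_3_eq_3 add.commute)
  qed
qed

section \<open>The recurrence on the imaginary axis\<close>

text \<open>
  \<open>rec_imag \<rho> x k\<close> is the value at \<open>\<i> x\<close> of the \<open>k\<close>-th polynomial of a symmetric three-term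
  recurrence, divided by \<open>\<i> ^ k\<close>; the division makes all terms positive for \<open>x > 0\<close>.
\<close>

fun rec_imag :: "(nat \<Rightarrow> real) \<Rightarrow> real \<Rightarrow> nat \<Rightarrow> real" where
  "rec_imag \<rho> x 0 = 1"
| "rec_imag \<rho> x (Suc k) = x * rec_imag \<rho> x k + \<rho> k * rec_imag \<rho> x (k - 1)"

fun rec_imag_deriv :: "(nat \<Rightarrow> real) \<Rightarrow> real \<Rightarrow> nat \<Rightarrow> real" where
  "rec_imag_deriv \<rho> x 0 = 0"
| "rec_imag_deriv \<rho> x (Suc k) = rec_imag \<rho> x k + x * rec_imag_deriv \<rho> x k + \<rho> k * rec_imag_deriv \<rho> x (k - 1)"

lemma continuous_rec_imag: "continuous_on S (\<lambda>x. rec_imag \<rho> x k)"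
proof (induction k rule: less_induct)
  case (less k)
  then show ?case by (cases k) (auto intro!: continuous_intros)
qed

lemma continuous_rec_imag_deriv: "continuous_on S (\<lambda>x. rec_imag_deriv \<rho> x k)"
proof (induction k rule: less_induct)
  case (less k)
  then show ?case by (cases k) (auto intro!: continuous_intros continuous_rec_imag)
qed

locale positive_recurrence =
  fixes \<rho> :: "nat \<Rightarrow> real"
  assumes \<rho>0: "\<rho> 0 = 0" and \<rho>_pos: "k \<ge> 1 \<Longrightarrow> \<rho> k > 0"
begin

lemma \<rho>_nonneg: "\<rho> k \<ge> 0"
  using \<rho>0 \<rho>_pos[of k] by (cases k) (auto simp: less_imp_le)

lemma rec_imag_pos:
  assumes "x > 0"
  shows "rec_imag \<rho> x k > 0"
proof (induction k rule: less_induct)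
  case (less k)
  show ?case
  proof (cases k)
    case (Suc m)
    have "0 < x * rec_imag \<rho> x m" using less[of m] assms Suc by simp
    moreover have "0 \<le> \<rho> m * rec_imag \<rho> x (m - 1)"
      using less[of "m - 1"] \<rho>_nonneg[of m] Suc by (simp add: less_imp_le)
    ultimately show ?thesis by (simp add: Suc)
  qed simp
qed

text \<open>\<open>rec_imag\<close> is a polynomial in x of degree k with nonnegative coefficients,
  whence 0 <= x S' <= k S; the recurrence gives this without expanding it.\<close>

lemma rec_imag_deriv_bounds:
  assumes "x > 0"
  shows "0 \<le> rec_imag_deriv \<rho> x k \<and> x * rec_imag_deriv \<rho> x k \<le> real k * rec_imag \<rho> x k"
proof (induction k rule: less_induct)
  case (less k)
  show ?case
  proof (cases k)
    case (Suc m)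
    let ?s = "rec_imag \<rho> x" and ?d = "rec_imag_deriv \<rho> x"
    have s: "?s j > 0" for j by (rule rec_imag_pos[OF assms])
    have m: "0 \<le> ?d m" "x * ?d m \<le> real m * ?s m" using less[of m] Suc by auto
    have m1: "0 \<le> ?d (m - 1)" "x * ?d (m - 1) \<le> real (m - 1) * ?s (m - 1)" using less[of "m - 1"] Suc by auto
    have "x * (x * ?d m) \<le> x * (real m * ?s m)" using m assms by (intro mult_left_mono) auto
    moreover have "\<rho> m * (x * ?d (m - 1)) \<le> \<rho> m * (real (Suc m) * ?s (m - 1))"
    proof (intro mult_left_mono \<rho>_nonneg)
      have "real (m - 1) * ?s (m - 1) \<le> real (Suc m) * ?s (m - 1)"
        using s[of "m - 1"] by (intro mult_right_mono) auto
      then show "x * ?d (m - 1) \<le> real (Suc m) * ?s (m - 1)" using m1 by simp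
    qed
    moreover have "x * ?d k = x * ?s m + x * (x * ?d m) + \<rho> m * (x * ?d (m - 1))"
      by (simp add: Suc algebra_simps)
    moreover have "real k * ?s k = x * ?s m + x * (real m * ?s m) + \<rho> m * (real (Suc m) * ?s (m - 1))"
      by (simp add: Suc algebra_simps)
    ultimately have "x * ?d k \<le> real k * ?s k" by linarith
    moreover have "?d k \<ge> 0" unfolding Suc using s[of m] m m1 assms \<rho>_nonneg by simp
    ultimately show ?thesis by simp
  qed simp
qed

definition wronskian :: "real \<Rightarrow> nat \<Rightarrow> real" where
  "wronskian x k = rec_imag \<rho> x k * rec_imag_deriv \<rho> x (Suc k) - rec_imag_deriv \<rho> x k * rec_imag \<rho> x (Suc k)"

text \<open>Bounding the two products separately would lose a factor of order k. The recursion
  W_(k+1) = S_(k+1)^2 - \<rho>_(k+1) W_k avoids the loss, so that W / N is a genuine 1 / N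
  error.\<close>

lemma wronskian_bound:
  assumes "x > 0"
  shows "x * \<bar>wronskian x k\<bar> \<le> rec_imag \<rho> x k * rec_imag \<rho> x (Suc k)"
proof (induction k)
  case 0
  then show ?case using assms by (simp add: wronskian_def \<rho>0)
next
  case (Suc k)
  let ?s = "rec_imag \<rho> x"
  have s: "?s j > 0" for j by (rule rec_imag_pos[OF assms])
  have "wronskian x (Suc k) = (?s (Suc k))\<^sup>2 - \<rho> (Suc k) * wronskian x k"
    unfolding wronskian_def by (simp add: power2_eq_square algebra_simps)
  then have "\<bar>wronskian x (Suc k)\<bar> \<le> (?s (Suc k))\<^sup>2 + \<rho> (Suc k) * \<bar>wronskian x k\<bar>"
    using \<rho>_nonneg[of "Suc k"] abs_triangle_ineq4[of "(?s (Suc k))\<^sup>2" "\<rho> (Suc k) * wronskian x k"]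
    by (simp add: abs_mult)
  then have "x * \<bar>wronskian x (Suc k)\<bar> \<le> x * ((?s (Suc k))\<^sup>2 + \<rho> (Suc k) * \<bar>wronskian x k\<bar>)"
    using assms by (intro mult_left_mono) auto
  also have "\<dots> = x * (?s (Suc k))\<^sup>2 + \<rho> (Suc k) * (x * \<bar>wronskian x k\<bar>)"
    by (simp add: algebra_simps)
  also have "\<dots> \<le> x * (?s (Suc k))\<^sup>2 + \<rho> (Suc k) * (?s k * ?s (Suc k))"
    using Suc.IH by (intro add_left_mono mult_left_mono \<rho>_nonneg)
  also have "\<dots> = ?s (Suc k) * ?s (Suc (Suc k))"
    by (simp add: power2_eq_square algebra_simps)
  finally show ?case .
qed

end

locale freud_recurrence = positive_recurrence +
  fixes N A B :: real
  assumes freud: "real k = \<rho> k * (N * A * (\<rho> (Suc k) + \<rho> k + \<rho> (k - 1)) + N * B)"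
begin

text \<open>A ladder relation: in the structure relation the member k - 2 is eliminated by two steps
  of the recurrence, leaving two consecutive members.\<close>

lemma rec_imag_deriv_Suc:
  "rec_imag_deriv \<rho> x (Suc k) = N * (\<rho> (Suc k) *
    ((A * (\<rho> (Suc (Suc k)) + \<rho> (Suc k)) + B - A * x\<^sup>2) * rec_imag \<rho> x k + A * x * rec_imag \<rho> x (Suc k)))"
proof -
  let ?s = "rec_imag \<rho> x" and ?d = "rec_imag_deriv \<rho> x"
  have D: "?d (Suc k) = real (Suc k) * ?s k + N * A * (- \<rho> (Suc k) * - \<rho> k * - \<rho> (k - 1)) * ?s (k - 2)"
  proof -
    have "?d (Suc k) = real (Suc k) * ?s (Suc k - 1) +
      N * A * (- \<rho> (Suc k) * - \<rho> (Suc k - 1) * - \<rho> (Suc k - 2)) * ?s (Suc k - 3)"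
    \<comment> \<open>Dividing by \<i>^k reverses the sign of the recurrence coefficients, so
      Freud's equation holds with \<open>b\<close> negated too.\<close>
    proof (rule freud_derivative[where x = x and b = "- (N * B)"])
      show "real k = - \<rho> k * (N * A * (- \<rho> (Suc k) + - \<rho> k + - \<rho> (k - 1)) + - (N * B))" for k
        by (subst freud) (simp add: algebra_simps)
    qed (simp_all add: \<rho>0)
    then show ?thesis by (simp add: numeral_2_eq_2 numeral_3_eq_3)
  qed
  have E: "\<rho> k * (\<rho> (k - 1) * ?s (k - 2)) = \<rho> k * ?s k - x * ?s (Suc k) + x\<^sup>2 * ?s k"
  proof (cases k)
    case (Suc m)
    have "\<rho> m * ?s (m - 1) = ?s (Suc m) - x * ?s m" by simp
    moreover have "\<rho> (Suc m) * ?s m = ?s (Suc (Suc m)) - x * ?s (Suc m)" by simp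
    ultimately show ?thesis
      unfolding Suc by (simp add: power2_eq_square algebra_simps numeral_2_eq_2)
  qed (simp add: \<rho>0 power2_eq_square)
  have "?d (Suc k) = real (Suc k) * ?s k - N * A * \<rho> (Suc k) * (\<rho> k * (\<rho> (k - 1) * ?s (k - 2)))"
    unfolding D by (simp add: algebra_simps)
  also have "real (Suc k) = \<rho> (Suc k) * (N * A * (\<rho> (Suc (Suc k)) + \<rho> (Suc k) + \<rho> k) + N * B)"
    using freud[of "Suc k"] by simp
  finally show ?thesis unfolding E by (simp add: algebra_simps)
qed

text \<open>
  This is the loop equation \<open>G\<^sup>2 - V' G + \<dots> = 0\<close> of the equilibrium problem on the imaginary axis;
  the Wronskian, which is of relative size \<open>1 / N\<close>, is its exact error term.
\<close>

lemma loop_equation_exact: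
  fixes x :: real
  assumes N: "N = real (Suc k)"
  defines "S \<equiv> rec_imag \<rho> x (Suc k)"
  defines "G \<equiv> rec_imag_deriv \<rho> x (Suc k) / N"
  defines "\<alpha> \<equiv> A * (\<rho> (Suc (Suc k)) + \<rho> (Suc k)) + B"
  defines "\<beta> \<equiv> A * (\<rho> (Suc k) + \<rho> k) + B"
  shows "G\<^sup>2 - x * (A * x\<^sup>2 - B) * G * S + A * x\<^sup>2 * S\<^sup>2 - \<rho> (Suc k) * \<alpha> * \<beta> * S\<^sup>2 =
    \<rho> (Suc k) * (\<alpha> - A * x\<^sup>2) * (wronskian x k / N)"
proof -
  define T where "T = rec_imag \<rho> x k"
  define H where "H = rec_imag_deriv \<rho> x k / N"
  have N0: "N \<noteq> 0" using N by simp
  have G: "G = \<rho> (Suc k) * ((\<alpha> - A * x\<^sup>2) * T + A * x * S)"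
    unfolding G_def rec_imag_deriv_Suc using N0 by (simp add: \<alpha>_def T_def S_def)
  have H: "H = (\<beta> - A * x\<^sup>2) * (S - x * T) + A * \<rho> k * x * T"
  proof (cases k)
    case 0
    then show ?thesis by (simp add: H_def S_def T_def \<rho>0)
  next
    case (Suc m)
    have "\<rho> k * rec_imag \<rho> x m = S - x * T" by (simp add: Suc S_def T_def)
    moreover have "H = (\<beta> - A * x\<^sup>2) * (\<rho> k * rec_imag \<rho> x m) + A * \<rho> k * x * T"
    proof -
      have "H = \<rho> (Suc m) * ((A * (\<rho> (Suc (Suc m)) + \<rho> (Suc m)) + B - A * x\<^sup>2) * rec_imag \<rho> x m + A * x * rec_imag \<rho> x (Suc m))"
        unfolding H_def Suc rec_imag_deriv_Suc using N0 by simp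
      also have "\<dots> = (\<beta> - A * x\<^sup>2) * (\<rho> k * rec_imag \<rho> x m) + A * \<rho> k * x * T"
        unfolding \<beta>_def T_def Suc by (simp only: algebra_simps)
      finally show ?thesis .
    qed
    ultimately show ?thesis by simp
  qed
  have W: "wronskian x k / N = T * G - H * S"
    by (simp add: wronskian_def T_def G_def H_def S_def diff_divide_distrib)
  \<comment> \<open>Freud's equation at the index that equals \<open>N\<close>, divided by
    \<open>N\<close>; the diagonal choice of degree enters here.\<close>
  have f: "\<rho> (Suc k) * (\<alpha> + A * \<rho> k) = 1"
  proof -
    have "N = \<rho> (Suc k) * (N * A * (\<rho> (Suc (Suc k)) + \<rho> (Suc k) + \<rho> k) + N * B)"
      using freud[of "Suc k"] N by simp
    then have "N * (\<rho> (Suc k) * (\<alpha> + A * \<rho> k)) = N * 1"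
      by (simp add: \<alpha>_def algebra_simps)
    then show ?thesis by (rule mult_left_cancel[OF N0, THEN iffD1])
  qed
  define r r' where "r = \<rho> (Suc k)" and "r' = \<rho> k"
  have b: "\<beta> = A * (r + r') + B" by (simp add: \<beta>_def r_def r'_def)
  have f1: "r * \<alpha> = 1 - A * r * r'" using f by (simp add: r_def r'_def algebra_simps)
  \<comment> \<open>Used to eliminate T; what is left of it is T G - H S, the Wronskian.\<close>
  have G1: "r * \<alpha> * T = G + r * A * x\<^sup>2 * T - r * A * x * S" using G by (simp add: r_def algebra_simps)
  have "G * G - r * (\<alpha> - A * x\<^sup>2) * (T * G - H * S) = S * (r * A * x * G + r * (\<alpha> - A * x\<^sup>2) * H)"
    using arg_cong[OF G1, of "\<lambda>u. G * u"] by (simp add: algebra_simps power2_eq_square)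
  also have "r * (\<alpha> - A * x\<^sup>2) * H = r * (\<alpha> - A * x\<^sup>2) * (\<beta> - A * x\<^sup>2) * S +
      (A * r' - (\<beta> - A * x\<^sup>2)) * x * (G - r * A * x * S)"
  proof -
    have "r * (\<alpha> - A * x\<^sup>2) * T = G - r * A * x * S" using G1 by (simp add: algebra_simps)
    then have "(A * r' - (\<beta> - A * x\<^sup>2)) * x * (r * (\<alpha> - A * x\<^sup>2) * T) =
        (A * r' - (\<beta> - A * x\<^sup>2)) * x * (G - r * A * x * S)" by simp
    moreover have "r * (\<alpha> - A * x\<^sup>2) * H = r * (\<alpha> - A * x\<^sup>2) * (\<beta> - A * x\<^sup>2) * S +
      (A * r' - (\<beta> - A * x\<^sup>2)) * x * (r * (\<alpha> - A * x\<^sup>2) * T)"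
      unfolding H r'_def[symmetric] by (simp add: algebra_simps)
    ultimately show ?thesis by simp
  qed
  also have "S * (r * A * x * G + (r * (\<alpha> - A * x\<^sup>2) * (\<beta> - A * x\<^sup>2) * S +
      (A * r' - (\<beta> - A * x\<^sup>2)) * x * (G - r * A * x * S))) =
      x * (A * x\<^sup>2 - B) * G * S + (r * \<alpha> * \<beta> - A * x\<^sup>2 * (r * \<alpha> + A * r * r')) * S\<^sup>2"
    unfolding b by (simp add: algebra_simps power2_eq_square)
  also have "r * \<alpha> + A * r * r' = 1" using f1 by simp
  finally show ?thesis
    unfolding W r_def[symmetric] by (simp add: algebra_simps power2_eq_square)
qed

text \<open>The exact equation divided by S^2. From x T <= S and \<open>wronskian_bound\<close>, |W|
  / S^2 <= 1 / x^2; the prefactor grows like x^2, so the error is bounded away from 0.\<close>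

lemma loop_equation_approx:
  fixes x :: real
  assumes N: "N = real n" "n \<ge> 1" and A: "A > 0" and x: "x > 0"
    and C: "\<And>k. k \<le> Suc n \<Longrightarrow> \<rho> k \<le> C"
  defines "g \<equiv> rec_imag_deriv \<rho> x n / (n * rec_imag \<rho> x n)"
  shows "\<bar>g\<^sup>2 - x * (A * x\<^sup>2 - B) * g + A * x\<^sup>2 -
      \<rho> n * (A * (\<rho> (Suc n) + \<rho> n) + B) * (A * (\<rho> n + \<rho> (n - 1)) + B)\<bar> \<le>
    C * (2 * A * C + \<bar>B\<bar> + A) * (1 + 1 / x\<^sup>2) / n"
proof -
  obtain k where k: "n = Suc k" using N(2) by (metis Suc_le_D One_nat_def)
  define S where "S = rec_imag \<rho> x n"
  define T where "T = rec_imag \<rho> x k"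
  define \<alpha> where "\<alpha> = A * (\<rho> (Suc n) + \<rho> n) + B"
  define \<beta> where "\<beta> = A * (\<rho> n + \<rho> (n - 1)) + B"
  have S: "S > 0" "T > 0" unfolding S_def T_def using rec_imag_pos[OF x] by auto
  have NN: "N = real (Suc k)" using N k by simp
  have gS: "rec_imag_deriv \<rho> x (Suc k) / N = g * S"
    using S by (simp add: g_def S_def k NN)
  have "(g\<^sup>2 - x * (A * x\<^sup>2 - B) * g + A * x\<^sup>2 - \<rho> n * \<alpha> * \<beta>) * S\<^sup>2 =
      \<rho> n * (\<alpha> - A * x\<^sup>2) * (wronskian x k / N)"
    using loop_equation_exact[OF NN, of x] unfolding gS
    by (simp add: S_def[symmetric] k[symmetric] \<alpha>_def \<beta>_def) (simp add: k S_def \<alpha>_def \<beta>_def algebra_simps power2_eq_square)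
  then have e: "g\<^sup>2 - x * (A * x\<^sup>2 - B) * g + A * x\<^sup>2 - \<rho> n * \<alpha> * \<beta> =
      \<rho> n * (\<alpha> - A * x\<^sup>2) * (wronskian x k / N) / S\<^sup>2"
    by (rule nonzero_eq_divide_eq[THEN iffD2, rotated]) (use S in simp)
  have Cn: "0 \<le> \<rho> n" "\<rho> n \<le> C" "0 \<le> \<rho> (Suc n)" "\<rho> (Suc n) \<le> C" using C \<rho>_nonneg by auto
  have C0: "C \<ge> 0" using Cn by linarith
  have "A * \<rho> n \<le> A * C" "A * \<rho> (Suc n) \<le> A * C" "0 \<le> A * \<rho> n" "0 \<le> A * \<rho> (Suc n)"
    using A Cn by (auto intro: mult_left_mono)
  then have "\<bar>A * (\<rho> (Suc n) + \<rho> n)\<bar> \<le> 2 * A * C" by (simp add: distrib_left)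
  then have al: "\<bar>\<alpha> - A * x\<^sup>2\<bar> \<le> 2 * A * C + \<bar>B\<bar> + A * x\<^sup>2"
    using A unfolding \<alpha>_def by (smt (verit) mult_nonneg_nonneg zero_le_power2)
  have "x * \<bar>wronskian x k\<bar> \<le> T * S"
    using wronskian_bound[OF x, of k] by (simp add: T_def S_def k)
  moreover have "x * T \<le> S"
    using rec_imag_pos[OF x, of "k - 1"] \<rho>_nonneg[of k] by (simp add: T_def S_def k)
  ultimately have "x * (x * \<bar>wronskian x k\<bar>) \<le> x * (T * S)" "(x * T) * S \<le> S * S"
    using S x by (auto intro: mult_left_mono mult_right_mono)
  then have "x * (x * \<bar>wronskian x k\<bar>) \<le> S * S" by (simp only: mult.assoc)
  then have w: "\<bar>wronskian x k\<bar> / S\<^sup>2 \<le> 1 / x\<^sup>2"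
    using S x by (simp add: divide_simps power2_eq_square mult_ac)
  have "\<bar>g\<^sup>2 - x * (A * x\<^sup>2 - B) * g + A * x\<^sup>2 - \<rho> n * \<alpha> * \<beta>\<bar> =
      \<rho> n * \<bar>\<alpha> - A * x\<^sup>2\<bar> * (\<bar>wronskian x k\<bar> / S\<^sup>2) / n"
    unfolding e using N Cn by (simp add: abs_mult abs_divide)
  also have "\<dots> \<le> C * (2 * A * C + \<bar>B\<bar> + A * x\<^sup>2) * (1 / x\<^sup>2) / n"
    using Cn C0 al w A N by (intro divide_right_mono mult_mono mult_nonneg_nonneg add_nonneg_nonneg) auto
  also have "\<dots> \<le> C * (2 * A * C + \<bar>B\<bar> + A) * (1 + 1 / x\<^sup>2) / n"
  proof (rule divide_right_mono)
    have "(2 * A * C + \<bar>B\<bar> + A * x\<^sup>2) * (1 / x\<^sup>2) = (2 * A * C + \<bar>B\<bar>) * (1 / x\<^sup>2) + A"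
      using x by (simp add: field_simps)
    also have "\<dots> \<le> (2 * A * C + \<bar>B\<bar> + A) * (1 + 1 / x\<^sup>2)"
      using A C0 x by (simp add: algebra_simps)
    finally show "C * (2 * A * C + \<bar>B\<bar> + A * x\<^sup>2) * (1 / x\<^sup>2) \<le> C * (2 * A * C + \<bar>B\<bar> + A) * (1 + 1 / x\<^sup>2)"
      using C0 mult_left_mono by (simp only: mult.assoc)
  qed simp
  finally show ?thesis unfolding \<alpha>_def \<beta>_def .
qed

text \<open>The neighbours are nonnegative, so Freud's equation bounds \<rho>_k (A \<rho>_k + B) by
  k / n, which is at most 2. The bound is the same for all \<open>n\<close>.\<close>

lemma \<rho>_bound:
  assumes N: "N = real n" "n \<ge> 1" and A: "A > 0" and k: "k \<le> Suc n"
  shows "\<rho> k \<le> (\<bar>B\<bar> + 2) / A + 1"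
proof (rule ccontr)
  assume "\<not> ?thesis"
  then have r: "\<rho> k > (\<bar>B\<bar> + 2) / A + 1" by simp
  have "(\<bar>B\<bar> + 2) / A \<ge> 0" using A by simp
  then have r1: "\<rho> k > 1" using r by linarith
  have "\<rho> k - 1 > (\<bar>B\<bar> + 2) / A" using r by linarith
  then have "A * (\<rho> k - 1) > \<bar>B\<bar> + 2" using A by (simp add: pos_divide_less_eq mult.commute)
  moreover have "0 \<le> A * \<rho> (Suc k)" "0 \<le> A * \<rho> (k - 1)" using A \<rho>_nonneg by auto
  ultimately have "2 < A * (\<rho> (Suc k) + \<rho> k + \<rho> (k - 1)) + B"
    using A by (simp add: algebra_simps)
  then have "1 * 2 < \<rho> k * (A * (\<rho> (Suc k) + \<rho> k + \<rho> (k - 1)) + B)"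
    using r1 by (intro mult_strict_mono) auto
  then have "real n * 2 < real n * (\<rho> k * (A * (\<rho> (Suc k) + \<rho> k + \<rho> (k - 1)) + B))"
    using N by (intro mult_strict_left_mono) auto
  also have "\<dots> = real k" using freud[of k] N by (simp add: algebra_simps)
  finally show False using k N by linarith
qed

end

text \<open>Since p n = 0, the vector (p 0, ..., p (n - 1)) is an eigenvector of a banded matrix
  with eigenvalue z. The bound is a row sum, read off at an entry of largest modulus; truncated
  indices stay below \<open>n\<close> and do no harm.\<close>

lemma banded_recurrence_root_bound:
  fixes p \<beta> \<gamma> :: "nat \<Rightarrow> complex" and z :: complex
  assumes "p 0 \<noteq> 0" "p n = 0"
    and rec: "\<And>k. k < n \<Longrightarrow> z * p k = p (Suc k) + \<beta> k * p (k - 1) + \<gamma> k * p (k - 3)"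
    and b: "\<And>k. k < n \<Longrightarrow> cmod (\<beta> k) \<le> b" and c: "\<And>k. k < n \<Longrightarrow> cmod (\<gamma> k) \<le> c"
  shows "cmod z \<le> 1 + b + c"
proof -
  have n: "n > 0" using assms by (cases n) auto
  have ne: "finite ((\<lambda>k. cmod (p k)) ` {..<n})" "(\<lambda>k. cmod (p k)) ` {..<n} \<noteq> {}" using n by auto
  obtain k where k: "k < n" "cmod (p k) = Max ((\<lambda>k. cmod (p k)) ` {..<n})"
    using Max_in[OF ne] by auto
  have le: "cmod (p j) \<le> cmod (p k)" if "j < n" for j
    unfolding k(2) using that by (intro Max_ge) auto
  have pos: "cmod (p k) > 0" using le[of 0] n assms(1) by (meson less_le_trans zero_less_norm_iff)
  have le': "cmod (p (Suc k)) \<le> cmod (p k)"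
    using le[of "Suc k"] assms(2) k(1) by (cases "Suc k = n") auto
  have "cmod z * cmod (p k) = cmod (p (Suc k) + \<beta> k * p (k - 1) + \<gamma> k * p (k - 3))"
    using rec[OF k(1)] by (simp flip: norm_mult)
  also have "\<dots> \<le> cmod (p (Suc k)) + cmod (\<beta> k) * cmod (p (k - 1)) + cmod (\<gamma> k) * cmod (p (k - 3))"
    by (intro norm_triangle_le add_mono) (auto simp: norm_mult intro: norm_triangle_le)
  also have "\<dots> \<le> cmod (p k) + b * cmod (p k) + c * cmod (p k)"
    using le' le[of "k - 1"] le[of "k - 3"] k(1) b[OF k(1)] c[OF k(1)] order.trans[OF norm_ge_zero b[OF k(1)]]
      order.trans[OF norm_ge_zero c[OF k(1)]]
    by (intro add_mono mult_mono) auto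
  finally have "cmod z * cmod (p k) \<le> (1 + b + c) * cmod (p k)" by (simp add: algebra_simps)
  then show ?thesis using pos by simp
qed

text \<open>As in the Christoffel-Darboux formula, Im (p (k+1) * cnj (p k)) gains Im z |p k|^2 at
  each step, so it keeps the sign of Im z and no member can vanish.\<close>

lemma three_term_recurrence_real_roots:
  fixes p :: "nat \<Rightarrow> complex" and \<rho> :: "nat \<Rightarrow> real"
  assumes p0: "p 0 = 1" and r0: "\<rho> 0 = 0" and r: "\<And>k. \<rho> k \<ge> 0"
    and rec: "\<And>k. z * p k = p (Suc k) + of_real (\<rho> k) * p (k - 1)"
    and z: "Im z \<noteq> 0"
  shows "p k \<noteq> 0"
proof -
  have step: "Im (p (Suc k) * cnj (p k)) = Im z * (cmod (p k))\<^sup>2 + \<rho> k * Im (p k * cnj (p (k - 1)))" for k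
  proof -
    have "p (Suc k) * cnj (p k) = z * (p k * cnj (p k)) - of_real (\<rho> k) * (p (k - 1) * cnj (p k))"
    proof -
      have "p (Suc k) = z * p k - of_real (\<rho> k) * p (k - 1)" by (simp add: rec[of k])
      then show ?thesis by (simp only: left_diff_distrib mult.assoc)
    qed
    also have "p k * cnj (p k) = of_real ((cmod (p k))\<^sup>2)" by (simp only: complex_norm_square)
    finally have "Im (p (Suc k) * cnj (p k)) = Im z * (cmod (p k))\<^sup>2 - \<rho> k * Im (p (k - 1) * cnj (p k))"
      by (simp only: minus_complex.sel Im_complex_of_real times_complex.sel(2) Re_complex_of_real mult_zero_left mult_zero_right add_0 add_0_right)
    moreover have "Im (p (k - 1) * cnj (p k)) = - Im (p k * cnj (p (k - 1)))" by simp
    ultimately show ?thesis by (simp only: mult_minus_right diff_minus_eq_add)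
  qed
  have "Im z * Im (p (Suc k) * cnj (p k)) > 0 \<and> p k \<noteq> 0" for k
  proof (induction k)
    case 0
    show ?case unfolding step using z by (auto simp: p0 r0 zero_less_mult_iff)
  next
    case (Suc k)
    then have ne: "p (Suc k) \<noteq> 0" by auto
    have "Im z * Im (p (Suc (Suc k)) * cnj (p (Suc k))) =
        (Im z)\<^sup>2 * (cmod (p (Suc k)))\<^sup>2 + \<rho> (Suc k) * (Im z * Im (p (Suc k) * cnj (p k)))"
      unfolding step[of "Suc k"] by (simp add: power2_eq_square algebra_simps)
    moreover have "(Im z)\<^sup>2 * (cmod (p (Suc k)))\<^sup>2 > 0" using z ne by simp
    ultimately show ?case using Suc r[of "Suc k"] ne by (simp add: add_pos_nonneg)
  qed
  then show ?thesis by blast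
qed

section \<open>The limiting zero distribution\<close>

lemma psum_generating_function:
  fixes A :: "complex multiset"
  assumes "\<And>a. a \<in># A \<Longrightarrow> cmod (a * u) < 1"
  shows "(\<lambda>j. (\<Sum>a\<in>#A. a ^ j) * u ^ j) sums (\<Sum>a\<in>#A. 1 / (1 - a * u))"
  using assms
proof (induction A)
  case (add b A)
  have "(\<lambda>j. (b * u) ^ j) sums (1 / (1 - b * u))"
    by (rule geometric_sums) (use add.prems in simp)
  moreover have "(\<lambda>j. (\<Sum>a\<in>#A. a ^ j) * u ^ j) sums (\<Sum>a\<in>#A. 1 / (1 - a * u))"
    using add by simp
  ultimately show ?case
    using sums_add by (fastforce simp: distrib_right power_mult_distrib)
qed simp

text \<open>The expansion of P' / P at infinity, in the variable u = 1 / z.\<close>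

lemma log_derivative_sums:
  fixes P :: "complex poly"
  assumes P: "lead_coeff P = 1" and R: "\<And>a. poly P a = 0 \<Longrightarrow> cmod a \<le> R"
    and u: "u \<noteq> 0" "R * cmod u < 1"
  shows "(\<lambda>j. u * psum j P * u ^ j) sums (poly (pderiv P) (1 / u) / poly P (1 / u))"
proof -
  have nz: "P \<noteq> 0" using P by auto
  have small: "cmod (a * u) < 1" if "a \<in># proots P" for a
  proof -
    have "cmod a \<le> R" using R[of a] that nz by simp
    then have "cmod a * cmod u \<le> R * cmod u" by (intro mult_right_mono) auto
    then show ?thesis unfolding norm_mult using u(2) by linarith
  qed
  have "poly P (1 / u) \<noteq> 0"
  proof
    assume "poly P (1 / u) = 0"
    then have "cmod (1 / u * u) < 1" using small[of "1 / u"] nz by simp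
    then show False using u by simp
  qed
  then have "poly (pderiv P) (1 / u) / poly P (1 / u) = (\<Sum>a\<in>#proots P. 1 / (1 / u - a))"
    using poly_pderiv_eq_sum_proots[OF P] by simp
  also have "\<dots> = u * (\<Sum>a\<in>#proots P. 1 / (1 - a * u))"
  proof -
    have "1 / (1 / u - a) = u * (1 / (1 - a * u))" for a
      using u by (simp add: field_simps)
    then show ?thesis by (simp add: sum_mset_distrib_left)
  qed
  finally show ?thesis
    using sums_mult[OF psum_generating_function[of "proots P" u], of u] small
    by (simp add: psum_def mult.assoc)
qed

lemma cmod_psum_le:
  fixes P :: "complex poly"
  assumes "P \<noteq> 0" "\<And>a. poly P a = 0 \<Longrightarrow> cmod a \<le> R"
  shows "cmod (psum j P) \<le> real (degree P) * R ^ j"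
  unfolding psum_def size_proots_complex[symmetric]
  by (rule norm_sum_mset_le) (use assms in \<open>auto simp: norm_power intro!: power_mono\<close>)

lemma recurrence_imaginary_axis:
  fixes K :: "nat \<Rightarrow> complex poly"
  assumes K0: "K 0 = 1" and r0: "\<rho> 0 = 0"
    and rec: "\<And>k. pCons 0 (K k) = K (Suc k) + smult (complex_of_real (\<rho> k)) (K (k - 1))"
  shows "poly (K k) (\<i> * of_real x) = \<i> ^ k * of_real (rec_imag \<rho> x k) \<and>
    \<i> * poly (pderiv (K k)) (\<i> * of_real x) = \<i> ^ k * of_real (rec_imag_deriv \<rho> x k)"
proof (induction k rule: less_induct)
  case (less k)
  show ?case
  proof (cases k)
    case 0
    then show ?thesis by (simp add: K0)
  next
    case (Suc m)
    have K: "K k = pCons 0 (K m) - smult (complex_of_real (\<rho> m)) (K (m - 1))"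
      using rec[of m] Suc by simp
    have IHm: "poly (K m) (\<i> * of_real x) = \<i> ^ m * of_real (rec_imag \<rho> x m)"
      "\<i> * poly (pderiv (K m)) (\<i> * of_real x) = \<i> ^ m * of_real (rec_imag_deriv \<rho> x m)"
      using less[of m] Suc by auto
    \<comment> \<open>At m = 0 the exponent is truncated, and \<open>\<rho> 0 = 0\<close> removes
      the term.\<close>
    have pw: "complex_of_real (\<rho> m) * \<i> ^ (m - 1) = - (of_real (\<rho> m) * (\<i> * \<i> ^ m))"
      by (cases m) (simp_all add: r0)
    have IHm1: "complex_of_real (\<rho> m) * poly (K (m - 1)) (\<i> * of_real x) =
        - (of_real (\<rho> m) * (\<i> * \<i> ^ m)) * of_real (rec_imag \<rho> x (m - 1))"
      "complex_of_real (\<rho> m) * (\<i> * poly (pderiv (K (m - 1))) (\<i> * of_real x)) =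
        - (of_real (\<rho> m) * (\<i> * \<i> ^ m)) * of_real (rec_imag_deriv \<rho> x (m - 1))"
      using less[of "m - 1"] Suc unfolding pw[symmetric] by auto
    have "poly (K k) (\<i> * of_real x) = \<i> * of_real x * poly (K m) (\<i> * of_real x) -
        complex_of_real (\<rho> m) * poly (K (m - 1)) (\<i> * of_real x)"
      unfolding K by simp
    then have 1: "poly (K k) (\<i> * of_real x) = \<i> ^ k * of_real (rec_imag \<rho> x k)"
      unfolding IHm IHm1 Suc by (simp add: algebra_simps)
    have "\<i> * poly (pderiv (K k)) (\<i> * of_real x) = \<i> * poly (K m) (\<i> * of_real x) +
        \<i> * of_real x * (\<i> * poly (pderiv (K m)) (\<i> * of_real x)) -
        complex_of_real (\<rho> m) * (\<i> * poly (pderiv (K (m - 1))) (\<i> * of_real x))"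
      unfolding K by (simp add: pderiv_diff pderiv_pCons pderiv_smult algebra_simps)
    then have "\<i> * poly (pderiv (K k)) (\<i> * of_real x) = \<i> ^ k * of_real (rec_imag_deriv \<rho> x k)"
      unfolding IHm IHm1 Suc by (simp add: algebra_simps)
    with 1 show ?thesis by simp
  qed
qed

context freud_recurrence
begin

text \<open>Moving \<open>x\<close> past the flow adds 1 / N times the flow of the derivative. The
  structure relation writes that derivative with the members k - 1 and k - 3, which creates the
  extra band.\<close>

lemma heat_recurrence:
  fixes K :: "nat \<Rightarrow> complex poly"
  assumes N: "N > 0" and K0: "K 0 = 1"
    and rec: "\<And>k. pCons 0 (K k) = K (Suc k) + smult (complex_of_real (\<rho> k)) (K (k - 1))"
  defines "P \<equiv> \<lambda>k. heat (- (1 / (2 * complex_of_real N))) (K k)"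
  shows "pCons 0 (P k) = P (Suc k) + smult (complex_of_real (\<rho> k + k / N)) (P (k - 1)) +
    smult (complex_of_real (A * (\<rho> k * \<rho> (k - 1) * \<rho> (k - 2)))) (P (k - 3))"
proof -
  let ?r = "\<lambda>k. [:complex_of_real (\<rho> k):]"
  have "pderiv (K k) = of_nat k * K (k - 1) +
      [:complex_of_real (N * A):] * (?r k * ?r (k - 1) * ?r (k - 2)) * K (k - 3)"
  proof (rule freud_derivative[where x = "[:0, 1:]" and b = "[:complex_of_real (N * B):]"])
    show "pderiv (K 0) = 0" by (simp add: K0)
    show "[:0, 1:] * K k = K (Suc k) + ?r k * K (k - 1)" for k
      using rec[of k] by simp
    show "pderiv (K (Suc k)) = K k + [:0, 1:] * pderiv (K k) - ?r k * pderiv (K (k - 1))" for k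
    proof -
      have "K (Suc k) = pCons 0 (K k) - smult (complex_of_real (\<rho> k)) (K (k - 1))"
        using rec[of k] by simp
      then show ?thesis by (simp add: pderiv_diff pderiv_pCons pderiv_smult)
    qed
    show "of_nat k = ?r k * ([:complex_of_real (N * A):] * (?r (Suc k) + ?r k + ?r (k - 1)) + [:complex_of_real (N * B):])" for k
    proof -
      have "complex_of_nat k = complex_of_real (\<rho> k * (N * A * (\<rho> (Suc k) + \<rho> k + \<rho> (k - 1)) + N * B))"
        using freud[of k] by (metis of_real_of_nat_eq)
      then show ?thesis by (simp add: of_nat_poly)
    qed
  qed (simp add: \<rho>0)
  then have dK: "pderiv (K k) = smult (of_nat k) (K (k - 1)) +
      smult (complex_of_real (N * A * (\<rho> k * \<rho> (k - 1) * \<rho> (k - 2)))) (K (k - 3))"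
    by (simp add: of_nat_poly mult_ac)
  define c where "c = - (1 / (2 * complex_of_real N))"
  have c: "2 * c = - (1 / complex_of_real N)" by (simp add: c_def)
  have P: "P = (\<lambda>k. heat c (K k))" by (simp add: P_def c_def)
  have "pCons 0 (P k) = heat c (pCons 0 (K k)) + smult (1 / complex_of_real N) (heat c (pderiv (K k)))"
    unfolding P heat_pCons c by simp
  also have "heat c (pCons 0 (K k)) = P (Suc k) + smult (complex_of_real (\<rho> k)) (P (k - 1))"
    unfolding rec heat_add heat_smult P ..
  also have "smult (1 / complex_of_real N) (heat c (pderiv (K k))) =
      smult (complex_of_real (k / N)) (P (k - 1)) +
      smult (complex_of_real (A * (\<rho> k * \<rho> (k - 1) * \<rho> (k - 2)))) (P (k - 3))"
    unfolding dK heat_add heat_smult P using N by (simp add: smult_add_right mult_ac)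
  finally show ?thesis by (simp add: smult_add_left add.assoc)
qed

end

text \<open>The point is z = \<i> / x, so 1 / z = - \<i> x and the expansion at infinity becomes a
  power series in a positive real variable.\<close>

lemma log_derivative_imaginary_axis_sums:
  fixes K :: "nat \<Rightarrow> complex poly"
  assumes pr: "positive_recurrence \<rho>" and K0: "K 0 = 1"
    and rec: "\<And>k. pCons 0 (K k) = K (Suc k) + smult (complex_of_real (\<rho> k)) (K (k - 1))"
    and lc: "lead_coeff (K n) = 1" and R: "\<And>a. poly (K n) a = 0 \<Longrightarrow> cmod a \<le> R"
    and x: "0 < x" "R * x < 1"
  shows "(\<lambda>j. psum j (K n) * (- \<i>) ^ j * of_real x ^ j) sums
    of_real (rec_imag_deriv \<rho> (1 / x) n / rec_imag \<rho> (1 / x) n / x)"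
proof -
  interpret positive_recurrence \<rho> by fact
  define u where "u = - \<i> * complex_of_real x"
  have u: "u \<noteq> 0" "R * cmod u < 1" "1 / u = \<i> * complex_of_real (1 / x)"
    using x by (auto simp: u_def norm_mult field_simps)
  have v: "poly (K n) (1 / u) = \<i> ^ n * of_real (rec_imag \<rho> (1 / x) n)"
    "\<i> * poly (pderiv (K n)) (1 / u) = \<i> ^ n * of_real (rec_imag_deriv \<rho> (1 / x) n)"
    using recurrence_imaginary_axis[of K \<rho>, OF K0 \<rho>0 rec] unfolding u(3) by blast+
  have "rec_imag \<rho> (1 / x) n \<noteq> 0" using rec_imag_pos[of "1 / x" n] x by simp
  then have q: "poly (pderiv (K n)) (1 / u) / poly (K n) (1 / u) =
      of_real (rec_imag_deriv \<rho> (1 / x) n / rec_imag \<rho> (1 / x) n) / \<i>"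
  proof -
    have "poly (pderiv (K n)) (1 / u) = \<i> ^ n * of_real (rec_imag_deriv \<rho> (1 / x) n) / \<i>"
      using v(2) by (simp only: nonzero_eq_divide_eq[OF complex_i_not_zero] mult.commute)
    then show ?thesis unfolding v(1) by simp
  qed
  have "(\<lambda>j. (1 / u) * (u * psum j (K n) * u ^ j)) sums
      ((1 / u) * (poly (pderiv (K n)) (1 / u) / poly (K n) (1 / u)))"
    by (intro sums_mult log_derivative_sums[where R = R] lc R u)
  also have "(\<lambda>j. (1 / u) * (u * psum j (K n) * u ^ j)) = (\<lambda>j. psum j (K n) * (- \<i>) ^ j * of_real x ^ j)"
  proof
    fix j
    have "u ^ j = (- \<i>) ^ j * of_real x ^ j" unfolding u_def by (rule power_mult_distrib)
    then show "(1 / u) * (u * psum j (K n) * u ^ j) = psum j (K n) * (- \<i>) ^ j * of_real x ^ j"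
      using u(1) by simp
  qed
  also have "(1 / u) * (poly (pderiv (K n)) (1 / u) / poly (K n) (1 / u)) =
      of_real (rec_imag_deriv \<rho> (1 / x) n / rec_imag \<rho> (1 / x) n / x)"
    unfolding q unfolding u(3) by simp
  finally show ?thesis .
qed

text \<open>The loop equation gives limits of the logarithmic derivative only far up the imaginary
  axis. That is a neighbourhood of 0 in x = 1 / |z|, which suffices to recover every moment as a
  power series coefficient.\<close>

lemma convergent_psum_freud:
  fixes \<rho> :: "nat \<Rightarrow> nat \<Rightarrow> real" and K :: "nat \<Rightarrow> nat \<Rightarrow> complex poly"
  assumes A: "A > 0" and fr: "\<And>n. n \<ge> 1 \<Longrightarrow> freud_recurrence (\<rho> n) (real n) A B"
    and K0: "\<And>n. n \<ge> 1 \<Longrightarrow> K n 0 = 1"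
    and rec: "\<And>n k. n \<ge> 1 \<Longrightarrow> pCons 0 (K n k) = K n (Suc k) + smult (complex_of_real (\<rho> n k)) (K n (k - 1))"
    and deg: "\<And>n. n \<ge> 1 \<Longrightarrow> degree (K n n) = n" and lc: "\<And>n. n \<ge> 1 \<Longrightarrow> lead_coeff (K n n) = 1"
    and R: "R > 0" "\<And>n a. n \<ge> 1 \<Longrightarrow> poly (K n n) a = 0 \<Longrightarrow> cmod a \<le> R"
  shows "convergent (\<lambda>n. psum j (if n = 0 then 1 else K n n) / of_nat n)"
proof -
  define Q where "Q = (\<lambda>n. if n = 0 then 1 else K n n)"
  define C where "C = (\<bar>B\<bar> + 2) / A + 1"
  define g where "g = (\<lambda>n x. rec_imag_deriv (\<rho> n) x n / (real n * rec_imag (\<rho> n) x n))"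
  have pr: "positive_recurrence (\<rho> n)" if "n \<ge> 1" for n
    using fr[OF that] by (rule freud_recurrence.axioms)
  have C0: "C \<ge> 0" using A by (simp add: C_def)
  have "\<exists>X. \<forall>x\<ge>X. convergent (\<lambda>n. g n x)"
  proof (rule loop_equation_convergent[where A = A and B = B and K = "C * (2 * A * C + \<bar>B\<bar> + A)"
        and e = "\<lambda>n. \<rho> n n * (A * (\<rho> n (Suc n) + \<rho> n n) + B) * (A * (\<rho> n n + \<rho> n (n - 1)) + B)"])
    show "0 \<le> C * (2 * A * C + \<bar>B\<bar> + A)" using A C0 by simp
    fix n :: nat assume n: "n \<ge> 1"
    interpret freud_recurrence "\<rho> n" "real n" A B by (rule fr[OF n])
    have "rec_imag (\<rho> n) x n \<noteq> 0" if "x > 0" for x using rec_imag_pos[OF that, of n] by simp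
    then show "continuous_on {0<..} (g n)"
      unfolding g_def using n
      by (intro continuous_intros continuous_rec_imag continuous_rec_imag_deriv) auto
    fix x :: real assume x: "x > 0"
    show "0 \<le> g n x"
      unfolding g_def using rec_imag_deriv_bounds[OF x, of n] rec_imag_pos[OF x, of n] by simp
    show "x * g n x \<le> 1"
      unfolding g_def using rec_imag_deriv_bounds[OF x, of n] rec_imag_pos[OF x, of n] n
      by (simp add: divide_le_eq)
    show "\<bar>(g n x)\<^sup>2 - x * (A * x\<^sup>2 - B) * g n x + A * x\<^sup>2 -
        \<rho> n n * (A * (\<rho> n (Suc n) + \<rho> n n) + B) * (A * (\<rho> n n + \<rho> n (n - 1)) + B)\<bar> \<le>
        C * (2 * A * C + \<bar>B\<bar> + A) * (1 + 1 / x\<^sup>2) / n"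
      unfolding g_def
      by (rule loop_equation_approx[OF refl n A x]) (unfold C_def, rule \<rho>_bound[OF refl n A])
  qed (rule A)
  then obtain X where X: "\<And>x. x \<ge> X \<Longrightarrow> convergent (\<lambda>n. g n x)" by blast
  define a where "a = (\<lambda>n j. psum j (Q n) * (- \<i>) ^ j / of_nat n)"
  \<comment> \<open>Below \<delta> both requirements hold: 1 / x >= X, and R x <= 1/2 for the
    series; \<open>max X 1\<close> keeps the quotient positive.\<close>
  define \<delta> where "\<delta> = min (1 / (2 * R)) (1 / max X 1)"
  have d: "0 < \<delta>" "R * \<delta> \<le> 1 / 2"
  proof -
    show "0 < \<delta>" using R by (simp add: \<delta>_def)
    have "R * \<delta> \<le> R * (1 / (2 * R))" using R by (intro mult_left_mono) (auto simp: \<delta>_def)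
    then show "R * \<delta> \<le> 1 / 2" using R by simp
  qed
  have bound: "cmod (a n j) \<le> 1 * R ^ j" for n j
  proof (cases "n = 0")
    case False
    then have n: "n \<ge> 1" by simp
    have "K n n \<noteq> 0" using lc[OF n] by auto
    then have "cmod (psum j (K n n)) \<le> real n * R ^ j"
      using cmod_psum_le[of "K n n" R j] R(2)[OF n] deg[OF n] by simp
    then show ?thesis using n
      by (simp add: a_def Q_def norm_mult norm_power norm_divide pos_divide_le_eq mult.commute)
  qed (use R in \<open>simp add: a_def\<close>)
  have "convergent (\<lambda>n. \<Sum>j. a n j * complex_of_real x ^ j)" if x: "0 < x" "x < \<delta>" for x
  proof -
    have Rx: "R * x < 1"
    proof -
      have "R * x \<le> R * \<delta>" using x R by (intro mult_left_mono) auto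
      then show ?thesis using d by simp
    qed
    have "x < 1 / max X 1" using x by (simp add: \<delta>_def)
    then have "x * max X 1 < 1" by (simp add: pos_less_divide_eq)
    then have "max X 1 < 1 / x" by (simp only: pos_less_divide_eq[OF x(1)] mult.commute)
    then have Xx: "X \<le> 1 / x" by (meson max.cobounded1 less_imp_le order.trans)
    have "(\<Sum>j. a n j * complex_of_real x ^ j) = complex_of_real (g n (1 / x) / x)" if n: "n \<ge> 1" for n
    proof -
      have "(\<lambda>j. psum j (K n n) * (- \<i>) ^ j * of_real x ^ j / of_nat n) sums
          (of_real (rec_imag_deriv (\<rho> n) (1 / x) n / rec_imag (\<rho> n) (1 / x) n / x) / of_nat n)"
        by (intro sums_divide log_derivative_imaginary_axis_sums[where K = "K n" and R = R] pr[OF n] K0[OF n] rec[OF n] lc[OF n] R(2)[OF n] x Rx)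
      then show ?thesis
        using n by (simp add: sums_iff a_def Q_def g_def field_simps)
    qed
    then have ev: "\<forall>\<^sub>F n in sequentially. (\<Sum>j. a n j * complex_of_real x ^ j) = complex_of_real (g n (1 / x) / x)"
      by (auto simp: eventually_sequentially intro!: exI[of _ 1])
    obtain l where "(\<lambda>n. g n (1 / x)) \<longlonglongrightarrow> l" using X[OF Xx] convergent_def by blast
    then have "(\<lambda>n. complex_of_real (g n (1 / x) / x)) \<longlonglongrightarrow> complex_of_real (l / x)"
      using x by (intro tendsto_intros) auto
    then have "convergent (\<lambda>n. complex_of_real (g n (1 / x) / x))" by (rule convergentI)
    then show ?thesis using convergent_cong[OF ev] by simp
  qed
  from convergent_power_series_coefficients[OF R(1) bound d this]
  have "convergent (\<lambda>n. a n j * \<i> ^ j)" by (intro convergent_mult convergent_const)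
  moreover have "a n j * \<i> ^ j = psum j (Q n) / of_nat n" for n
    by (simp add: a_def flip: power_mult_distrib)
  ultimately show ?thesis by (simp add: Q_def)
qed

theorem theorem2p2:
  fixes \<tau> t :: real and p q :: "nat \<Rightarrow> nat \<Rightarrow> complex poly"
  assumes "\<tau> > 0"
    and "\<And>n. n \<ge> 1 \<Longrightarrow> biorthogonal \<tau> t n (\<lambda>k. p k n) (\<lambda>k. q k n)"
  shows "\<exists>\<nu>\<^sub>1 :: complex measure.
    prob_space \<nu>\<^sub>1 \<and> sets \<nu>\<^sub>1 = sets borel \<and> measure_support \<nu>\<^sub>1 \<subseteq> \<real> \<and>
    converges_weakly (\<lambda>n. zero_counting_measure (p n n)) \<nu>\<^sub>1"
proof -
  note bi = assms(2)
  \<comment> \<open>\<open>A\<close> and \<open>B\<close> are the coefficients of V' / n in the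
    variable \<open>\<tau> * y\<close>.\<close>
  define A where "A = 1 / \<tau> ^ 4"
  define B where "B = (t - \<tau>\<^sup>2) / \<tau>\<^sup>2"
  have A: "A > 0" using assms(1) by (simp add: A_def)
  define C where "C = (\<bar>B\<bar> + 2) / A + 1"
  have C: "C \<ge> 1" using A by (simp add: C_def)
  define K where "K = (\<lambda>n k. heat (1 / (2 * of_nat n)) (p k n))"
  have p: "degree (p k n) = k" "coeff (p k n) k = 1" if "n \<ge> 1" for k n
    using bi[OF that] unfolding biorthogonal_def by metis+
  have K: "degree (K n k) = k" "coeff (K n k) k = 1" if "n \<ge> 1" for k n
    using p[OF that, of k] lead_coeff_heat[of "1 / (2 * of_nat n)" "p k n"] by (simp_all add: K_def)
  have K0: "K n 0 = 1" if "n \<ge> 1" for n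
    using K[OF that, of 0] by (metis degree_0_id of_nat_1 one_pCons)
  have heatK: "p k n = heat (- (1 / (2 * complex_of_real (real n)))) (K n k)" for n k
    by (simp add: K_def heat_uminus_heat)
  have "\<exists>r. freud_recurrence r (real n) A B \<and>
      (\<forall>k. pCons 0 (K n k) = K n (Suc k) + smult (complex_of_real (r k)) (K n (k - 1)))" if n: "n \<ge> 1" for n
  proof -
    obtain r where r: "r 0 = 0" "\<forall>k\<ge>1. r k > 0"
      "\<forall>k. pCons 0 (K n k) = K n (Suc k) + smult (complex_of_real (r k)) (K n (k - 1))"
      "\<forall>k. real k = r k * (n / \<tau> ^ 4 * (r (Suc k) + r k + r (k - 1)) + n * (t - \<tau>\<^sup>2) / \<tau>\<^sup>2)"
      using biorthogonal_structure[OF assms(1) n bi[OF n]] unfolding K_def by blast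
    have "freud_recurrence r (real n) A B"
    proof unfold_locales
      show "r 0 = 0" by (rule r(1))
      show "r k > 0" if "k \<ge> 1" for k using r(2) that by blast
      show "real k = r k * (real n * A * (r (Suc k) + r k + r (k - 1)) + real n * B)" for k
        using r(4)[rule_format, of k] unfolding A_def B_def by (simp only: times_divide_eq_right mult_1_right)
    qed
    with r(3) show ?thesis by blast
  qed
  then obtain \<rho> where fr: "\<And>n. n \<ge> 1 \<Longrightarrow> freud_recurrence (\<rho> n) (real n) A B"
    and rec: "\<And>n k. n \<ge> 1 \<Longrightarrow> pCons 0 (K n k) = K n (Suc k) + smult (complex_of_real (\<rho> n k)) (K n (k - 1))"
    by metis
  have \<rho>: "0 \<le> \<rho> n k" "k \<le> Suc n \<Longrightarrow> \<rho> n k \<le> C" if n: "n \<ge> 1" for n k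
  proof -
    interpret freud_recurrence "\<rho> n" "real n" A B by (rule fr[OF n])
    show "0 \<le> \<rho> n k" by (rule \<rho>_nonneg)
    show "\<rho> n k \<le> C" if "k \<le> Suc n" unfolding C_def by (rule \<rho>_bound[OF refl n A that])
  qed
  have rrK: "real_rooted (K n n)" if n: "n \<ge> 1" for n
    unfolding real_rooted_def
  proof (intro allI impI, rule ccontr)
    fix z assume z: "poly (K n n) z = 0" "Im z \<noteq> 0"
    interpret freud_recurrence "\<rho> n" "real n" A B by (rule fr[OF n])
    have "poly (K n n) z \<noteq> 0"
    proof (rule three_term_recurrence_real_roots[where p = "\<lambda>k. poly (K n k) z" and \<rho> = "\<rho> n" and z = z])
      show "poly (K n 0) z = 1" by (simp add: K0[OF n])
      show "z * poly (K n k) z = poly (K n (Suc k)) z + of_real (\<rho> n k) * poly (K n (k - 1)) z" for k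
        using arg_cong[OF rec[OF n, of k], of "\<lambda>P. poly P z"] by simp
    qed (use \<rho>0 \<rho>_nonneg z in auto)
    then show False using z by simp
  qed
  \<comment> \<open>A three-term recurrence has no third band, whence the summand 0. This is the
    radius for the expansion at infinity.\<close>
  have bK: "cmod z \<le> 1 + C + 0" if n: "n \<ge> 1" and z: "poly (K n n) z = 0" for n z
  proof (rule banded_recurrence_root_bound[where p = "\<lambda>k. poly (K n k) z" and n = n and \<gamma> = "\<lambda>_. 0" and \<beta> = "\<lambda>k. of_real (\<rho> n k)"])
    show "z * poly (K n k) z = poly (K n (Suc k)) z + of_real (\<rho> n k) * poly (K n (k - 1)) z + 0 * poly (K n (k - 3)) z" for k
      using arg_cong[OF rec[OF n, of k], of "\<lambda>P. poly P z"] by simp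
  qed (use K0[OF n] z \<rho>[OF n] in auto)
  \<comment> \<open>The backward flow may spread the zeros, so they are bounded anew from the
    recurrence after the flow, where k / n < 1 contributes the extra 1.\<close>
  have bp: "cmod z \<le> 1 + (C + 1) + A * (C * C * C)" if n: "n \<ge> 1" and z: "poly (p n n) z = 0" for n z
  proof -
    interpret freud_recurrence "\<rho> n" "real n" A B by (rule fr[OF n])
    have N: "real n > 0" using n by simp
    show ?thesis
    proof (rule banded_recurrence_root_bound[where p = "\<lambda>k. poly (p k n) z" and n = n
          and \<beta> = "\<lambda>k. complex_of_real (\<rho> n k + k / real n)"
          and \<gamma> = "\<lambda>k. complex_of_real (A * (\<rho> n k * \<rho> n (k - 1) * \<rho> n (k - 2)))"])
      show "poly (p 0 n) z \<noteq> 0" by (simp add: heatK K0[OF n])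
      show "poly (p n n) z = 0" by (rule z)
      fix k assume k: "k < n"
      show "z * poly (p k n) z = poly (p (Suc k) n) z + complex_of_real (\<rho> n k + k / real n) * poly (p (k - 1) n) z +
          complex_of_real (A * (\<rho> n k * \<rho> n (k - 1) * \<rho> n (k - 2))) * poly (p (k - 3) n) z"
        using arg_cong[OF heat_recurrence[of "K n", OF N K0[OF n] rec[OF n], of k], of "\<lambda>P. poly P z"]
        unfolding heatK[symmetric] by simp
      have "0 \<le> \<rho> n k + k / real n" "\<rho> n k + k / real n \<le> C + 1"
        using \<rho>[OF n, of k] k by (auto intro!: add_mono)
      then show "cmod (complex_of_real (\<rho> n k + k / real n)) \<le> C + 1" by (simp only: norm_of_real abs_of_nonneg)
      have "\<rho> n k * \<rho> n (k - 1) * \<rho> n (k - 2) \<le> C * C * C"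
        using \<rho>[OF n] k C by (intro mult_mono) auto
      then have "A * (\<rho> n k * \<rho> n (k - 1) * \<rho> n (k - 2)) \<le> A * (C * C * C)" using A by (intro mult_left_mono) auto
      moreover have "0 \<le> A * (\<rho> n k * \<rho> n (k - 1) * \<rho> n (k - 2))" using A \<rho>(1)[OF n] by simp
      ultimately show "cmod (complex_of_real (A * (\<rho> n k * \<rho> n (k - 1) * \<rho> n (k - 2)))) \<le> A * (C * C * C)"
        by (simp only: norm_of_real abs_of_nonneg)
    qed
  qed
  \<comment> \<open>The hypotheses start at n = 1; the constant 1 is a monic polynomial of degree 0
    that fills the gap without affecting the limit.\<close>
  define Q where "Q = (\<lambda>n. if n = 0 then 1 else K n n)"
  define P where "P = (\<lambda>n. heat (- (1 / (2 * of_nat n))) (Q n))"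
  have P: "P n = p n n" if "n \<ge> 1" for n
    using that heatK[of n n] by (simp add: P_def Q_def)
  have lcQ: "lead_coeff (Q n) = 1" for n using K[of n n] by (auto simp: Q_def)
  have convQ: "convergent (\<lambda>n. psum j (Q n) / of_nat n)" for j
    unfolding Q_def
    by (rule convergent_psum_freud[OF A fr K0 rec _ _ _ bK]) (use K C in auto)
  have "\<exists>\<nu> :: complex measure. prob_space \<nu> \<and> sets \<nu> = sets borel \<and> measure_support \<nu> \<subseteq> \<real> \<and>
    converges_weakly (\<lambda>n. zero_counting_measure (P n)) \<nu>"
  proof (rule zero_counting_measures_converge)
    have dQ: "degree (Q n) = n" for n using K[of n n] by (auto simp: Q_def)
    show "degree (P n) = n" for n by (simp add: P_def dQ)
    show "lead_coeff (P n) = 1" for n using lcQ[of n] by (simp add: P_def)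
    show "real_rooted (P n)" if n: "n \<ge> 1" for n
      using real_rooted_heat[of "1 / (2 * real n)" "K n n"] rrK[OF n] K[OF n, of n] n by (simp add: P_def Q_def)
    show "cmod z \<le> 1 + (C + 1) + A * (C * C * C)" if "n \<ge> 1" "poly (P n) z = 0" for n z
      using bp[OF that(1)] that P by simp
    show "convergent (\<lambda>n. psum k (P n) / of_nat n)" for k
      unfolding P_def by (rule convergent_psum_heat[OF lcQ convQ])
  qed
  moreover have "converges_weakly (\<lambda>n. zero_counting_measure (P n)) \<nu> \<Longrightarrow>
      converges_weakly (\<lambda>n. zero_counting_measure (p n n)) \<nu>" for \<nu>
    unfolding converges_weakly_def
  proof (intro allI impI)
    fix f :: "complex \<Rightarrow> real"
    assume H: "\<forall>f :: complex \<Rightarrow> real. continuous_on UNIV f \<longrightarrow> bounded (range f) \<longrightarrow>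
        (\<lambda>n. LINT x|zero_counting_measure (P n). f x) \<longlonglongrightarrow> (LINT x|\<nu>. f x)"
      and f: "continuous_on UNIV f" "bounded (range f)"
    have "(\<lambda>n. LINT x|zero_counting_measure (P n). f x) \<longlonglongrightarrow> (LINT x|\<nu>. f x)"
      by (rule H[rule_format, OF f])
    moreover have "\<forall>\<^sub>F n in sequentially. (LINT x|zero_counting_measure (P n). f x) = (LINT x|zero_counting_measure (p n n). f x)"
      using P by (auto simp: eventually_sequentially intro!: exI[of _ 1])
    ultimately show "(\<lambda>n. LINT x|zero_counting_measure (p n n). f x) \<longlonglongrightarrow> (LINT x|\<nu>. f x)"
      by (rule Lim_transform_eventually)
  qed
  ultimately show ?thesis by blast
qed

end
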